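(* Let $\boldsymbol f=(f_R,f_B)$ be the maximal solution on $[0,\kappa_{\boldsymbol f})$ of the Cauchy problem $\boldsymbol f'(x)=\frac{\boldsymbol\beta(\boldsymbol f(x))}{\beta_R(\boldsymbol f(x))+\beta_B(\boldsymbol f(x))}$, $\boldsymbol f(0)=(0,0)$, with $\boldsymbol\beta=(\beta_R,\beta_B)$, and let $$\eta:=\begin{cases}1 & \text{if } q=g,\\ \frac{n(qp)^r}{q} & \text{if } g\ll q\ll p^{-1},\\ \frac nq & \text{if } q=p^{-1}\text{ or } q\gg p^{-1}.\end{cases}$$ (i) For each $\kappa<\kappa_{\boldsymbol f}$, $$\eta\,T_{\lfloor\kappa q\rfloor}\to\int_0^{\kappa}\frac{1}{\beta_R(\boldsymbol f(x))+\beta_B(\boldsymbol f(x))}\,dx,\qquad\text{almost surely.}$$ (ii) Let $S\in\{R,B\}$ and $\kappa_S\in\big(0,\lim_{x\uparrow\kappa_{\boldsymbol f}}f_S(x)\big)$. Then $$\eta\,T^S_{\lfloor\kappa_S q\rfloor}\to\int_0^{f_S^{-1}(\kappa_S)}\frac{1}{\beta_R(\boldsymbol f(x))+\beta_B(\boldsymbol f(x))}\,dx,\qquad\text{almost surely.}$$ Here $T_k$ is the time of the $k$-th activation of a non-seed node and $T_k^S$ the time of the $k$-th activation of a non-seed node with color $S$.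
   Context: Asymptotic setting. All limits are as $n\to\infty$; $a_n\ll b_n$ means $a_n=o(b_n)$. Fix a constant integer $r\ge2$; $p=p_n\in(0,1)$ with $\frac1n\ll p\ll\frac1{n^{1/r}\log n}$; $g=g_n:=(1-\frac1r)\big(\frac{(r-1)!}{np^r}\big)^{1/(r-1)}$. The sequence $q=q_n$ is in one of four regimes: $q=g$; $g\ll q\ll p^{-1}$; $q=p^{-1}$; $p^{-1}\ll q\ll n$. The seed numbers $a_R,a_B$ (integers depending on $n$) satisfy $a_R/q\to\alpha_R$, $a_B/q\to\alpha_B$ with constants $\alpha_R>\alpha_B>0$. For $S\in\{R,B\}$, $\overline S$ is the other color. Functions $\beta_S$ on $[0,\infty)^2$: $\beta_S(x_R,x_B)$ equals - $r^{-1}(1-r^{-1})^{r-1}(x_S+\alpha_S)^r-x_S$ if $q=g$; - $\frac1{r!}(x_S+\alpha_S)^r$ if $g\ll q\ll p^{-1}$; - $\sum_{r'=r}^\infty\sum_{r''=0}^{r'-r}\frac{(x_S+\alpha_S)^{r'}}{r'!}\frac{(x_{\overline S}+\alpha_{\overline S})^{r''}}{r''!}e^{-(x_R+x_B+\alpha_R+\alpha_B)}$ if $q=p^{-1}$; - $1$ if $\frac{x_S+\alpha_S}{x_R+\alpha_R+x_B+\alpha_B}\ge\frac12$ and $0$ otherwise, if $p^{-1}\ll q\ll n$. Process (for each $n$, independent over $n$, all on one probability space). It represents competing bootstrap percolation on the Erdős–Rényi graph $G(n,p)$ started from $a_R$ red and $a_B$ black uniformly random seeds. Let $\mathcal V_W$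 be the set of $n_W=n-a_R-a_B$ non-seed nodes, initially white. Each $v\in\mathcal V_W$ has an independent unit-rate Poisson clock. Independently, let $E_i^{S,(v)}$ ($i\ge1$, $S\in\{R,B\}$, $v\in\mathcal V_W$) be i.i.d. Bernoulli($p$) ($E^{S,(v)}_i$ indicates an edge between $v$ and the $i$-th node of color $S$, seeds counted first), and $L_k$ ($k\ge1$) i.i.d. uniform on $(0,1)$, independent of everything else. Let $\mathcal V_S(t)$ be the set of non-seed nodes of color $S$ at time $t$, $N_S(t)=|\mathcal V_S(t)|$, $\mathcal V_W(t)=\mathcal V_W\setminus(\mathcal V_R(t)\cup\mathcal V_B(t))$ the white nodes, $D_S^{(v)}(t)=\sum_{i=1}^{N_S(t)+a_S}E_i^{S,(v)}$, $\mathcal S_S(t)=\{v\in\mathcal V_W: D_S^{(v)}(t)-D_{\overline S}^{(v)}(t)\ge r\}$, $\mathcal S(t)=\mathcal S_R(t)\cup\mathcal S_B(t)$. When the clock of a white node $v$ rings at time $t$ and $v\in\mathcal S_S(t^-)$, it takes color $S$ permanently; otherwise it stays white. Let $T_k$ be the time of the $k$-th activation, $T_0=0$, and $K^*=\min\{k\ge0:\mathcal S(T_k)\cap\mathcal V_W(T_k)=\emptyset\}$ the index at which the process naturally stops. Extension beyond $T_{K^*}$: after time $T_{K^*}$ every white node whose clock rings is activated; if this is the $(k+1)$-th activation ($k\ge K^*$) it gets color $R$ if $L_{k+1}<U^R_{k+1}$ and color $B$ otherwise ($U$ defined below). All quantities $N_S,T_k,T_k^S,\dots$ refer to this extended process.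 The notation $[k]$ means "evaluated at $T_k$" for $0\le k\le n_W$; $T_k=\infty$ for $k>n_W$. Define $$Q^S_{k+1}=|\mathcal S_S[k]|-N_S[k]+\big|(\mathcal V_W\setminus\mathcal S_S[k])\cap\mathcal V_S[k]\cap\{v:D_S^{(v)}[k]\ge r\}\big|-\big|\mathcal S_S[k]\cap\mathcal V_{\overline S}[k]\cap\{v:D_{\overline S}^{(v)}[k]\ge r\}\big|,$$ $U^S_{k+1}=\frac{|Q^S_{k+1}|}{|Q^R_{k+1}|+|Q^B_{k+1}|}$ with $0/0:=1/2$ (for $k\le K^*$, $Q^S_{k+1}=|\mathcal V_W[k]\cap\mathcal S_S[k]|$). *)

theory Defs
  imports "HOL-Probability.Probability" "HOL-Library.Landau_Symbols"
begin

section \<open>Colours, scales and regimes\<close>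

datatype color = Red | Black

fun other :: "color \<Rightarrow> color" where
  "other Red = Black"
| "other Black = Red"

definition crit :: "nat \<Rightarrow> (nat \<Rightarrow> real) \<Rightarrow> nat \<Rightarrow> real" where
  "crit r p n =
     (1 - 1 / real r) * (fact (r - 1) / (real n * p n ^ r)) powr (1 / (real r - 1))"

datatype regime =
    At_crit       (* q = g *)
  | Below_inverse (* g << q << 1/p *)
  | At_inverse    (* q = 1/p *)
  | Above_inverse (* 1/p << q << n *)

fun in_regime :: "regime \<Rightarrow> nat \<Rightarrow> (nat \<Rightarrow> real) \<Rightarrow> (nat \<Rightarrow> real) \<Rightarrow> bool" where
  "in_regime At_crit r p q \<longleftrightarrow> (\<forall>n\<ge>1. q n = crit r p n)"
| "in_regime Below_inverse r p q \<longleftrightarrow> crit r p \<in> o(q) \<and> q \<in> o(\<lambda>n. 1 / p n)"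
| "in_regime At_inverse r p q \<longleftrightarrow> (\<forall>n\<ge>1. q n = 1 / p n)"
| "in_regime Above_inverse r p q \<longleftrightarrow> (\<lambda>n. 1 / p n) \<in> o(q) \<and> q \<in> o(\<lambda>n. real n)"

fun eta :: "regime \<Rightarrow> nat \<Rightarrow> (nat \<Rightarrow> real) \<Rightarrow> (nat \<Rightarrow> real) \<Rightarrow> nat \<Rightarrow> real" where
  "eta At_crit r p q n = 1"
| "eta Below_inverse r p q n = real n * (q n * p n) ^ r / q n"
| "eta At_inverse r p q n = real n / q n"
| "eta Above_inverse r p q n = real n / q n"

fun beta :: "regime \<Rightarrow> nat \<Rightarrow> (color \<Rightarrow> real) \<Rightarrow> color \<Rightarrow> (color \<Rightarrow> real) \<Rightarrow> real" where
  "beta At_crit r \<alpha> S x =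
     1 / real r * (1 - 1 / real r) ^ (r - 1) * (x S + \<alpha> S) ^ r - x S"
| "beta Below_inverse r \<alpha> S x = 1 / fact r * (x S + \<alpha> S) ^ r"
| "beta At_inverse r \<alpha> S x =
     (\<Sum>\<^sub>\<infinity>i\<in>{r..}. \<Sum>j=0..i - r.
        (x S + \<alpha> S) ^ i / fact i * ((x (other S) + \<alpha> (other S)) ^ j / fact j)
        * exp (- (x Red + x Black + \<alpha> Red + \<alpha> Black)))"
| "beta Above_inverse r \<alpha> S x =
     (if (x S + \<alpha> S) / (x Red + \<alpha> Red + x Black + \<alpha> Black) \<ge> 1 / 2 then 1 else 0)"


section \<open>The Cauchy problem\<close>

text \<open>
  The vector field is \<open>\<beta> / (\<beta> Red + \<beta> Black)\<close>, with domain the points of the closed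
  quadrant at which the denominator does not vanish; since division by zero is total here, a
  solution is explicitly required to stay in that domain. The right end point \<open>\<kappa>\<close> may be
  \<open>\<infinity>\<close>, and at 0 the derivative is one-sided.
\<close>

definition solution ::
  "(color \<Rightarrow> (color \<Rightarrow> real) \<Rightarrow> real) \<Rightarrow> (color \<Rightarrow> real \<Rightarrow> real) \<Rightarrow> ereal \<Rightarrow> bool" where
  "solution \<beta> f \<kappa> \<longleftrightarrow>
     0 < \<kappa> \<and> (\<forall>S. f S 0 = 0) \<and>
     (\<forall>x. 0 \<le> x \<and> ereal x < \<kappa> \<longrightarrow>
        (let y = (\<lambda>S. f S x); b = \<beta> Red y + \<beta> Black y in
           (\<forall>S. 0 \<le> y S) \<and> b \<noteq> 0 \<and>
           (\<forall>S. (f S has_real_derivative \<beta> S y / b)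
                  (at x within {z. 0 \<le> z \<and> ereal z < \<kappa>}))))"

definition maximal_solution ::
  "(color \<Rightarrow> (color \<Rightarrow> real) \<Rightarrow> real) \<Rightarrow> (color \<Rightarrow> real \<Rightarrow> real) \<Rightarrow> ereal \<Rightarrow> bool" where
  "maximal_solution \<beta> f \<kappa> \<longleftrightarrow>
     solution \<beta> f \<kappa> \<and>
     \<not> (\<exists>h \<kappa>'. \<kappa> < \<kappa>' \<and> solution \<beta> h \<kappa>' \<and>
           (\<forall>S x. 0 \<le> x \<and> ereal x < \<kappa> \<longrightarrow> h S x = f S x))"


section \<open>One realisation of the extended process\<close>

text \<open>
  Everything in this locale is deterministic: \<open>X v j\<close> are the waiting times between successive
  rings of the clock of node \<open>v\<close>, \<open>E S v i\<close> says whether \<open>v\<close> is adjacent to the \<open>i\<close>-th node of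
  colour \<open>S\<close> (\<open>i \<ge> 1\<close>, seeds first), \<open>L k\<close> (\<open>k \<ge> 1\<close>) are the auxiliary uniform variables,
  \<open>a S\<close> is the number of seeds of colour \<open>S\<close>. The \<open>nW\<close> non-seed nodes are \<open>0, \<dots>, nW - 1\<close>.
  A configuration \<open>V\<close> gives the set \<open>V S\<close> of non-seed nodes of each colour.
\<close>

locale bootstrap =
  fixes r nW :: nat
    and a :: "color \<Rightarrow> nat"
    and X :: "nat \<Rightarrow> nat \<Rightarrow> real"
    and E :: "color \<Rightarrow> nat \<Rightarrow> nat \<Rightarrow> bool"
    and L :: "nat \<Rightarrow> real"
begin

definition nodes :: "nat set" where
  "nodes = {..<nW}"

definition white :: "(color \<Rightarrow> nat set) \<Rightarrow> nat set" where
  "white V = nodes - (V Red \<union> V Black)"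

definition deg :: "(color \<Rightarrow> nat set) \<Rightarrow> color \<Rightarrow> nat \<Rightarrow> int" where
  "deg V S v = (\<Sum>i=1..card (V S) + a S. of_bool (E S v i))"

text \<open>
  \<open>susceptible V S\<close> ranges over all non-seed nodes, including those that are already coloured.
\<close>

definition susceptible :: "(color \<Rightarrow> nat set) \<Rightarrow> color \<Rightarrow> nat set" where
  "susceptible V S = {v \<in> nodes. deg V S v - deg V (other S) v \<ge> int r}"

definition eligible :: "(color \<Rightarrow> nat set) \<Rightarrow> nat set" where
  "eligible V = (susceptible V Red \<union> susceptible V Black) \<inter> white V"

definition Q :: "(color \<Rightarrow> nat set) \<Rightarrow> color \<Rightarrow> int" where
  "Q V S =
     int (card (susceptible V S)) - int (card (V S))
     + int (card ((nodes - susceptible V S) \<inter> V S \<inter> {v. deg V S v \<ge> int r}))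
     - int (card (susceptible V S \<inter> V (other S) \<inter> {v. deg V (other S) v \<ge> int r}))"

definition U :: "(color \<Rightarrow> nat set) \<Rightarrow> color \<Rightarrow> real" where
  "U V S =
     (if Q V Red = 0 \<and> Q V Black = 0 then 1 / 2
      else real_of_int \<bar>Q V S\<bar> / real_of_int (\<bar>Q V Red\<bar> + \<bar>Q V Black\<bar>))"

definition ring_time :: "nat \<Rightarrow> nat \<Rightarrow> real" where
  "ring_time v j = (\<Sum>i\<le>j. X v i)"

text \<open>First ring of the clock of \<open>v\<close> strictly after time \<open>t\<close>.\<close>

definition next_ring :: "nat \<Rightarrow> ereal \<Rightarrow> ereal" where
  "next_ring v t = Inf {ereal (ring_time v j) |j. t < ereal (ring_time v j)}"

text \<open>
  \<open>state k\<close> is the triple consisting of the time of the \<open>k\<close>-th activation, the configuration just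
  after it, and the truth value of \<open>K\<^sup>* \<le> k\<close>, i.e. whether some configuration up to the
  \<open>k\<close>-th one had no eligible node. The configuration is constant between consecutive activations,
  so the next activation is the first later ring of a clock of a node that would be activated by
  it: an eligible node before \<open>K\<^sup>*\<close>, any white node from \<open>K\<^sup>*\<close> on. A susceptible node
  cannot be susceptible for both colours when \<open>r \<ge> 1\<close>. Taking the least node that attains the
  next ring time only matters when two clocks ring simultaneously, a null event.
  When no white node is left, the time is \<open>\<infinity>\<close>.
\<close>

primrec state :: "nat \<Rightarrow> ereal \<times> (color \<Rightarrow> nat set) \<times> bool" where
  "state 0 = (0, (\<lambda>S. {}), eligible (\<lambda>S. {}) = {})"
| "state (Suc k) =
     (case state k of (t, V, stopped) \<Rightarrow>
        let C = (if stopped then white V else eligible V) in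
        if C = {} then (\<infinity>, V, stopped)
        else
          let t' = (INF v\<in>C. next_ring v t);
              v = (LEAST v. v \<in> C \<and> next_ring v t = t');
              S = (if stopped then (if L (Suc k) < U V Red then Red else Black)
                   else (if v \<in> susceptible V Red then Red else Black));
              V' = V(S := insert v (V S))
          in (t', V', stopped \<or> eligible V' = {}))"

definition activation_time :: "nat \<Rightarrow> ereal" where
  "activation_time k = fst (state k)"

definition active :: "nat \<Rightarrow> color \<Rightarrow> nat set" where
  "active k = fst (snd (state k))"

text \<open>The value is \<open>\<infinity>\<close> if there are fewer than \<open>k\<close> activations with colour \<open>S\<close>.\<close>

definition color_activation_time :: "color \<Rightarrow> nat \<Rightarrow> ereal" where
  "color_activation_time S k = Inf {activation_time j |j. card (active j S) \<ge> k}"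

end


section \<open>The random input\<close>

text \<open>
  The index \<open>n\<close> of the asymptotics is the first argument of all random inputs. All of them are
  jointly independent, also over \<open>n\<close>; to state this with a single family they are all read as
  real random variables indexed by \<open>source\<close>. Each unit-rate Poisson clock is given by its
  i.i.d. exponential waiting times. \<open>W n\<close> is the number of non-seed nodes.
\<close>

datatype source = Wait nat nat nat | Edge nat color nat nat | Tie nat nat

definition sources :: "(nat \<Rightarrow> nat) \<Rightarrow> source set" where
  "sources W =
     {Wait n v j |n v j. v < W n} \<union> {Edge n S v i |n S v i. v < W n \<and> 1 \<le> i} \<union>
     {Tie n k |n k. 1 \<le> k}"

fun source_var ::
  "(nat \<Rightarrow> nat \<Rightarrow> nat \<Rightarrow> 'w \<Rightarrow> real) \<Rightarrow> (nat \<Rightarrow> color \<Rightarrow> nat \<Rightarrow> nat \<Rightarrow> 'w \<Rightarrow> bool) \<Rightarrow>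
   (nat \<Rightarrow> nat \<Rightarrow> 'w \<Rightarrow> real) \<Rightarrow> source \<Rightarrow> 'w \<Rightarrow> real" where
  "source_var X E L (Wait n v j) = X n v j"
| "source_var X E L (Edge n S v i) = (\<lambda>\<omega>. of_bool (E n S v i \<omega>))"
| "source_var X E L (Tie n k) = L n k"

definition random_input ::
  "'w measure \<Rightarrow> (nat \<Rightarrow> real) \<Rightarrow> (nat \<Rightarrow> nat) \<Rightarrow> (nat \<Rightarrow> nat \<Rightarrow> nat \<Rightarrow> 'w \<Rightarrow> real) \<Rightarrow>
   (nat \<Rightarrow> color \<Rightarrow> nat \<Rightarrow> nat \<Rightarrow> 'w \<Rightarrow> bool) \<Rightarrow> (nat \<Rightarrow> nat \<Rightarrow> 'w \<Rightarrow> real) \<Rightarrow> bool" where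
  "random_input M p W X E L \<longleftrightarrow>
     prob_space M \<and>
     (\<forall>n v j. v < W n \<longrightarrow> distributed M lborel (X n v j) (exponential_density 1)) \<and>
     (\<forall>n S v i. v < W n \<and> 1 \<le> i \<longrightarrow>
        E n S v i \<in> M \<rightarrow>\<^sub>M count_space UNIV \<and>
        distr M (count_space UNIV) (E n S v i) = measure_pmf (bernoulli_pmf (p n))) \<and>
     (\<forall>n k. 1 \<le> k \<longrightarrow>
        L n k \<in> borel_measurable M \<and>
        distr M lborel (L n k) = uniform_measure lborel {0<..<1}) \<and>
     prob_space.indep_vars M (\<lambda>_. borel) (source_var X E L) (sources W)"


section \<open>Activation times as random variables\<close>

text \<open>
  The truncation of the natural-number subtraction can only occur for finitely many \<open>n\<close>, as
  \<open>a Red n + a Black n\<close> is of order \<open>q n\<close> and hence \<open>o(n)\<close>.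
\<close>

definition n_white :: "(color \<Rightarrow> nat \<Rightarrow> nat) \<Rightarrow> nat \<Rightarrow> nat" where
  "n_white a n = n - a Red n - a Black n"

definition T ::
  "nat \<Rightarrow> (color \<Rightarrow> nat \<Rightarrow> nat) \<Rightarrow> (nat \<Rightarrow> nat \<Rightarrow> nat \<Rightarrow> 'w \<Rightarrow> real) \<Rightarrow>
   (nat \<Rightarrow> color \<Rightarrow> nat \<Rightarrow> nat \<Rightarrow> 'w \<Rightarrow> bool) \<Rightarrow> (nat \<Rightarrow> nat \<Rightarrow> 'w \<Rightarrow> real) \<Rightarrow>
   nat \<Rightarrow> nat \<Rightarrow> 'w \<Rightarrow> ereal" where
  "T r a X E L n k \<omega> =
     bootstrap.activation_time r (n_white a n) (\<lambda>S. a S n)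
       (\<lambda>v j. X n v j \<omega>) (\<lambda>S v i. E n S v i \<omega>) (\<lambda>k. L n k \<omega>) k"

definition T_color ::
  "nat \<Rightarrow> (color \<Rightarrow> nat \<Rightarrow> nat) \<Rightarrow> (nat \<Rightarrow> nat \<Rightarrow> nat \<Rightarrow> 'w \<Rightarrow> real) \<Rightarrow>
   (nat \<Rightarrow> color \<Rightarrow> nat \<Rightarrow> nat \<Rightarrow> 'w \<Rightarrow> bool) \<Rightarrow> (nat \<Rightarrow> nat \<Rightarrow> 'w \<Rightarrow> real) \<Rightarrow>
   color \<Rightarrow> nat \<Rightarrow> nat \<Rightarrow> 'w \<Rightarrow> ereal" where
  "T_color r a X E L S n k \<omega> =
     bootstrap.color_activation_time r (n_white a n) (\<lambda>S. a S n)
       (\<lambda>v j. X n v j \<omega>) (\<lambda>S v i. E n S v i \<omega>) (\<lambda>k. L n k \<omega>) S k"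

end

(*
  Up to the index K* the process is determined by its counts of red and black nodes, and no Markov
  property is needed to control them. Fix finitely many times t_0 < ... < t_m and deterministic
  barriers l_S^i <= N_S(t_i) <= u_S^i. As long as the counts respect the barriers, a node can only
  take colour S in the i-th block if it would be susceptible with u_S^(i+1) nodes of colour S and
  l^i nodes of the other colour and its clock rings in that block; conversely such a ring suffices
  if it is susceptible with l_S^i nodes of colour S and u^(i+1) of the other. Both conditions involve
  only the edges and the clock of that node, so the numbers of such nodes are sums of independent
  indicators, which a Chernoff bound concentrates with an error probability exp(-c q); this is
  summable because q >> log n. If the barriers are a discretisation of the solution of the Cauchy
  problem, in the time scale of the process, with a margin that grows exponentially as in Gronwall's
  lemma, the process therefore almost surely stays between them. In the critical regime the
  nodes coloured earlier are not negligible; there susceptibility is monotone in time, and summation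
  by parts over the block in which a node becomes susceptible accounts for them.
*)

theory Submission
  imports Defs
begin

text \<open>Three difficulties shape the argument. The upper barrier at the end of a block enters
  the very condition that is used to establish it; inside a block it is therefore justified by an
  induction over single activations. Outside the critical regime \<eta> tends to infinity, so the
  blocks have vanishing length: to first order a clock rings in a block with probability equal to
  its length, and blocks can be treated separately. In the critical regime time is of order one; a
  node may ring long after it has become susceptible, and the nodes already coloured reduce the
  number of pending ones, which is the damping term -x_S. Finally, for q >> 1/p the limiting rates
  jump where both colours are equally strong; since \<alpha> Red > \<alpha> Black, the solution
  keeps a positive distance from this line, and Lipschitz bounds are required only in a
  neighbourhood of the solution. The number of blocks is fixed before n tends to infinity, so
  finitely many deviation events have to be excluded for each n. The lower barriers also show that
  for large n the process is still running at the times in question, so the activations considered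
  do not come after K*.\<close>

definition edges :: "(nat \<Rightarrow> bool) \<Rightarrow> nat \<Rightarrow> int" where
  "edges e N = (\<Sum>i=1..N. of_bool (e i))"

lemma edges_mono: "N \<le> N' \<Longrightarrow> edges e N \<le> edges e N'"
  unfolding edges_def by (intro sum_mono2) auto

lemma other_other [simp]: "other (other S) = S"
  by (cases S) auto

lemma other_neq [simp]: "other S \<noteq> S" "S \<noteq> other S"
  by (cases S; simp)+

lemma color_cases2: "S = S' \<or> S = other S'"
  by (cases S; cases S') auto

lemma all_color: "(\<forall>S. P S) \<longleftrightarrow> P Red \<and> P Black"
  by (metis color.exhaust)

section \<open>Deterministic dynamics up to K*\<close>

context bootstrap
begin

definition stopped :: "nat \<Rightarrow> bool" where
  "stopped k = snd (snd (state k))"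

text \<open>This says k \<le> K*: the first k activations follow the original rule, in which only
  susceptible nodes are coloured.\<close>

definition natural :: "nat \<Rightarrow> bool" where
  "natural k \<longleftrightarrow> (\<forall>j<k. \<not> stopped j)"

text \<open>The almost sure properties of the clocks. The last conjunct excludes simultaneous rings
  of distinct nodes, so a ring time identifies the node that causes an activation.\<close>

definition good_clocks :: bool where
  "good_clocks \<longleftrightarrow> (\<forall>v<nW. \<forall>j. 0 < X v j) \<and> (\<forall>v<nW. \<forall>t. \<exists>j. t < ring_time v j) \<and>
     (\<forall>v<nW. \<forall>w<nW. \<forall>i j. ring_time v i = ring_time w j \<longrightarrow> v = w)"

text \<open>Open on the left and closed on the right, so that consecutive blocks cover all positive
  times without overlap.\<close>

definition rings :: "nat \<Rightarrow> real \<Rightarrow> real \<Rightarrow> bool" where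
  "rings v s t \<longleftrightarrow> (\<exists>j. s < ring_time v j \<and> ring_time v j \<le> t)"

declare state.simps(2) [simp del]

lemma state_eq: "state k = (activation_time k, active k, stopped k)"
  by (simp add: activation_time_def active_def stopped_def)

lemma activation_time_0 [simp]: "activation_time 0 = 0"
  by (simp add: activation_time_def)

lemma active_0 [simp]: "active 0 S = {}"
  by (simp add: active_def)

lemma eligible_subset: "eligible V \<subseteq> white V" "eligible V \<subseteq> nodes"
  by (auto simp: eligible_def white_def)

definition candidates :: "nat \<Rightarrow> nat set" where
  "candidates k = (if stopped k then white (active k) else eligible (active k))"

lemma state_Suc_empty:
  assumes "candidates k = {}"
  shows "activation_time (Suc k) = \<infinity>" "active (Suc k) = active k" "stopped (Suc k) = stopped k"
proof -
  have "state (Suc k) = (\<infinity>, active k, stopped k)"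
    using assms unfolding candidates_def
    by (simp only: state.simps(2) state_eq[of k] prod.case Let_def if_True simp_thms)
  then show "activation_time (Suc k) = \<infinity>" "active (Suc k) = active k" "stopped (Suc k) = stopped k"
    by (simp_all add: state_eq)
qed

lemma state_Suc_nonempty:
  assumes "candidates k \<noteq> {}"
  defines "v \<equiv> LEAST v. v \<in> candidates k \<and>
      next_ring v (activation_time k) = (INF v\<in>candidates k. next_ring v (activation_time k))"
  defines "S \<equiv> if stopped k then (if L (Suc k) < U (active k) Red then Red else Black)
      else (if v \<in> susceptible (active k) Red then Red else Black)"
  shows "activation_time (Suc k) = (INF v\<in>candidates k. next_ring v (activation_time k))"
    "active (Suc k) = (active k)(S := insert v (active k S))"
    "stopped (Suc k) \<longleftrightarrow> stopped k \<or> eligible (active (Suc k)) = {}"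
proof -
  let ?V = "(active k)(S := insert v (active k S))"
  have "state (Suc k) = (INF v\<in>candidates k. next_ring v (activation_time k), ?V,
      stopped k \<or> eligible ?V = {})"
    using assms(1) unfolding v_def S_def candidates_def
    by (simp only: state.simps(2) state_eq[of k] prod.case Let_def if_False)
  then show "activation_time (Suc k) = (INF v\<in>candidates k. next_ring v (activation_time k))"
    "active (Suc k) = ?V" "stopped (Suc k) \<longleftrightarrow> stopped k \<or> eligible (active (Suc k)) = {}"
    by (simp_all add: state_eq)
qed

lemma stopped_0: "stopped 0 \<longleftrightarrow> eligible (active 0) = {}"
  by (simp add: stopped_def active_def)

lemma not_stopped_eligible: "\<not> stopped k \<Longrightarrow> eligible (active k) \<noteq> {}"
proof (induction k)
  case (Suc k)
  show ?case
  proof (cases "candidates k = {}")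
    case True
    then show ?thesis using state_Suc_empty(2,3)[OF True] Suc by simp
  next
    case False
    then show ?thesis using state_Suc_nonempty(3)[OF False] Suc.prems by blast
  qed
qed (simp add: stopped_0)

lemma stopped_Suc: "stopped (Suc k) \<longleftrightarrow> stopped k \<or> eligible (active (Suc k)) = {}"
  using state_Suc_empty(2,3)[of k] state_Suc_nonempty(3)[of k] not_stopped_eligible[of k]
  by (cases "candidates k = {}") auto

lemma natural_eligible_not_stopped:
  assumes "natural k" "eligible (active k) \<noteq> {}"
  shows "\<not> stopped k"
proof (cases k)
  case 0
  then show ?thesis using assms by (simp add: stopped_0)
next
  case (Suc j)
  then have "\<not> stopped j" using assms(1) by (auto simp: natural_def)
  then show ?thesis using assms Suc by (simp add: stopped_Suc)
qed

lemma natural_0 [simp]: "natural 0"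
  by (simp add: natural_def)

lemma natural_Suc: "natural (Suc k) \<longleftrightarrow> natural k \<and> \<not> stopped k"
  by (auto simp: natural_def less_Suc_eq)

lemma natural_mono: "natural k \<Longrightarrow> j \<le> k \<Longrightarrow> natural j"
  by (auto simp: natural_def)

lemma next_ring_ge: "t \<le> next_ring v t"
  unfolding next_ring_def by (rule Inf_greatest) auto

lemma activation_time_le_Suc: "activation_time k \<le> activation_time (Suc k)"
  by (cases "candidates k = {}")
    (auto simp: state_Suc_empty state_Suc_nonempty(1) intro!: INF_greatest next_ring_ge)

lemma activation_time_mono: "i \<le> j \<Longrightarrow> activation_time i \<le> activation_time j"
  by (rule lift_Suc_mono_le[of activation_time, OF activation_time_le_Suc])

lemma active_mono_Suc: "active k S \<subseteq> active (Suc k) S"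
  by (cases "candidates k = {}") (auto simp: state_Suc_empty state_Suc_nonempty(2))

lemma active_mono: "i \<le> j \<Longrightarrow> active i S \<subseteq> active j S"
  by (rule lift_Suc_mono_le[of "\<lambda>k. active k S", OF active_mono_Suc])

lemma deg_eq: "deg V S v = edges (E S v) (card (V S) + a S)"
  by (simp add: deg_def edges_def)

lemma susceptible_unique:
  assumes "r \<ge> 1" "v \<in> susceptible V S" "v \<in> susceptible V S'"
  shows "S = S'"
  using assms color_cases2[of S S'] by (auto simp: susceptible_def)

end

locale good_bootstrap = bootstrap +
  assumes r_pos: "r \<ge> 1" and good: good_clocks
begin

lemma X_pos: "v < nW \<Longrightarrow> 0 < X v j"
  using good by (auto simp: good_clocks_def)

lemma ring_time_unbounded: "v < nW \<Longrightarrow> \<exists>j. t < ring_time v j"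
  using good by (auto simp: good_clocks_def)

lemma ring_time_inj: "v < nW \<Longrightarrow> w < nW \<Longrightarrow> ring_time v i = ring_time w j \<Longrightarrow> v = w"
  using good unfolding good_clocks_def by blast

lemma ring_time_mono: "v < nW \<Longrightarrow> i \<le> j \<Longrightarrow> ring_time v i \<le> ring_time v j"
  unfolding ring_time_def by (intro sum_mono2) (auto intro: less_imp_le X_pos)

lemma next_ring_attained:
  assumes "v < nW"
  obtains j where "next_ring v (ereal t) = ereal (ring_time v j)" "t < ring_time v j"
    "\<And>i. t < ring_time v i \<Longrightarrow> ring_time v j \<le> ring_time v i"
proof -
  obtain j0 where "t < ring_time v j0" using ring_time_unbounded[OF assms] by blast
  define j where "j = (LEAST j. t < ring_time v j)"
  have j: "t < ring_time v j" unfolding j_def by (rule LeastI[of "\<lambda>j. t < ring_time v j", OF \<open>t < ring_time v j0\<close>])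
  have least: "ring_time v j \<le> ring_time v i" if "t < ring_time v i" for i
    using that ring_time_mono[OF assms] Least_le[of "\<lambda>j. t < ring_time v j" i] by (auto simp: j_def)
  have "next_ring v (ereal t) = ereal (ring_time v j)"
    unfolding next_ring_def
    by (rule antisym) (auto intro!: Inf_lower Inf_greatest j least)
  then show thesis using that j least by blast
qed

text \<open>Only finitely many nodes are eligible, so the infimum of their next rings is attained.
  The last conclusion, that no eligible node rings before the activation, is what later forces a
  surely susceptible node to be coloured at its ring.\<close>

lemma natural_step:
  assumes nat: "natural (Suc k)" and t: "activation_time k = ereal t"
  obtains t' v S i where "activation_time (Suc k) = ereal t'" "t < t'"
    "v \<in> eligible (active k)" "v \<in> susceptible (active k) S"
    "active (Suc k) = (active k)(S := insert v (active k S))" "ring_time v i = t'"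
    "\<And>w j. w \<in> eligible (active k) \<Longrightarrow> t < ring_time w j \<Longrightarrow> t' \<le> ring_time w j"
proof -
  define C where "C = eligible (active k)"
  have ns: "\<not> stopped k" using nat by (simp add: natural_Suc)
  have "C \<noteq> {}" using not_stopped_eligible[OF ns] by (simp add: C_def)
  have Cn: "w < nW" if "w \<in> C" for w using that eligible_subset(2) by (auto simp: C_def nodes_def)
  then have fin: "finite C" by (meson finite_nat_set_iff_bounded)
  define t'' where "t'' = (INF v\<in>C. next_ring v (activation_time k))"
  have "t'' \<in> (\<lambda>v. next_ring v (activation_time k)) ` C"
    unfolding t''_def using \<open>C \<noteq> {}\<close> fin
    by (metis Min_Inf Min_in finite_imageI image_is_empty)
  then obtain v0 where v0: "v0 \<in> C" "next_ring v0 (activation_time k) = t''" by auto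
  define v where "v = (LEAST v. v \<in> C \<and> next_ring v (activation_time k) = t'')"
  have v: "v \<in> C" "next_ring v (activation_time k) = t''"
    using LeastI[of "\<lambda>v. v \<in> C \<and> next_ring v (activation_time k) = t''" v0] v0 by (auto simp: v_def)
  define S where "S = (if v \<in> susceptible (active k) Red then Red else Black)"
  have C: "candidates k = C" using ns by (simp add: candidates_def C_def)
  have step: "activation_time (Suc k) = t''" "active (Suc k) = (active k)(S := insert v (active k S))"
    using state_Suc_nonempty(1,2)[of k] \<open>C \<noteq> {}\<close> ns unfolding C t''_def v_def S_def by simp_all
  obtain i where i: "next_ring v (ereal t) = ereal (ring_time v i)" "t < ring_time v i"
    "\<And>j. t < ring_time v j \<Longrightarrow> ring_time v i \<le> ring_time v j"
    using next_ring_attained[OF Cn[OF v(1)]] by blast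
  have 1: "activation_time (Suc k) = ereal (ring_time v i)"
    using step v(2) t i by simp
  have 2: "active (Suc k) = (active k)(S := insert v (active k S))"
    using step by simp
  have 3: "v \<in> susceptible (active k) S"
    using v(1) by (auto simp: C_def eligible_def S_def)
  have 4: "ring_time v i \<le> ring_time w j" if w: "w \<in> eligible (active k)" "t < ring_time w j" for w j
  proof -
    have "t'' \<le> next_ring w (activation_time k)"
      unfolding t''_def using w by (intro INF_lower) (auto simp: C_def)
    also have "\<dots> \<le> ereal (ring_time w j)"
      unfolding next_ring_def t using w(2) by (intro Inf_lower) auto
    finally show ?thesis using v(2) i(1) t by (metis ereal_less_eq(3))
  qed
  show thesis
    by (rule that[OF 1 i(2) _ 3 2 refl 4]) (use v(1) in \<open>auto simp: C_def\<close>)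
qed

lemma natural_invariants:
  assumes "natural k"
  shows "(\<exists>t\<ge>0. activation_time k = ereal t) \<and> active k Red \<inter> active k Black = {} \<and>
    (\<forall>S. active k S \<subseteq> nodes) \<and> card (active k Red) + card (active k Black) = k"
  using assms
proof (induction k)
  case 0
  then show ?case by (auto intro!: exI[of _ 0] simp: zero_ereal_def)
next
  case (Suc k)
  then have IH: "\<exists>t\<ge>0. activation_time k = ereal t" "active k Red \<inter> active k Black = {}"
    "\<And>S. active k S \<subseteq> nodes" "card (active k Red) + card (active k Black) = k"
    by (auto simp: natural_Suc)
  obtain t where t: "activation_time k = ereal t" "t \<ge> 0" using IH(1) by auto
  obtain t' v S i where *: "activation_time (Suc k) = ereal t'" "t < t'"
    "v \<in> eligible (active k)" "active (Suc k) = (active k)(S := insert v (active k S))"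
    using natural_step[OF Suc.prems t(1)] by metis
  have v: "v \<notin> active k Red" "v \<notin> active k Black" "v \<in> nodes"
    using *(3) eligible_subset(1)[of "active k"] by (auto simp: white_def)
  have fin: "finite (active k S)" for S using IH(3)[of S] by (rule finite_subset) (simp add: nodes_def)
  show ?case
    using IH v fin * t(2) by (cases S) (auto intro!: exI[of _ t'])
qed

lemma natural_time: "natural k \<Longrightarrow> \<exists>t\<ge>0. activation_time k = ereal t"
  and natural_disjoint: "natural k \<Longrightarrow> active k S \<inter> active k (other S) = {}"
  and natural_nodes: "natural k \<Longrightarrow> active k S \<subseteq> nodes"
  and natural_card: "natural k \<Longrightarrow> card (active k Red) + card (active k Black) = k"
  using natural_invariants[of k] by (cases S; auto)+

lemma finite_nodes [simp]: "finite nodes"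
  by (simp add: nodes_def)

lemma natural_finite: "natural k \<Longrightarrow> finite (active k S)"
  using natural_nodes finite_subset finite_nodes by blast

lemma natural_le: "natural k \<Longrightarrow> k \<le> nW"
proof -
  assume k: "natural k"
  have "k = card (active k Red \<union> active k Black)"
    using natural_card[OF k] natural_disjoint[OF k, of Red] natural_finite[OF k]
    by (simp add: card_Un_disjoint)
  also have "\<dots> \<le> card nodes"
    using natural_nodes[OF k] by (intro card_mono) auto
  finally show ?thesis by (simp add: nodes_def)
qed

text \<open>The index of the last activation up to time \<open>s\<close> of the process that stops at \<open>K\<^sup>*\<close>.\<close>

definition last_index :: "real \<Rightarrow> nat" where
  "last_index s = Max {k. natural k \<and> activation_time k \<le> ereal s}"

definition count :: "color \<Rightarrow> real \<Rightarrow> nat" where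
  "count S s = card (active (last_index s) S)"

lemma last_index:
  assumes "s \<ge> 0"
  shows "natural (last_index s)" "activation_time (last_index s) \<le> ereal s"
    "natural k \<Longrightarrow> activation_time k \<le> ereal s \<Longrightarrow> k \<le> last_index s"
proof -
  let ?A = "{k. natural k \<and> activation_time k \<le> ereal s}"
  have fin: "finite ?A" using natural_le by (auto intro: finite_subset[of _ "{..nW}"])
  have "0 \<in> ?A" using assms by auto
  then have "last_index s \<in> ?A" unfolding last_index_def using fin Max_in by blast
  then show "natural (last_index s)" "activation_time (last_index s) \<le> ereal s" by auto
  show "natural k \<Longrightarrow> activation_time k \<le> ereal s \<Longrightarrow> k \<le> last_index s"
    unfolding last_index_def using fin by (intro Max_ge) auto
qed

lemma le_last_index_iff:
  assumes "s \<ge> 0"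
  shows "k \<le> last_index s \<longleftrightarrow> natural k \<and> activation_time k \<le> ereal s"
proof
  assume "k \<le> last_index s"
  then show "natural k \<and> activation_time k \<le> ereal s"
    using last_index(1,2)[OF assms] natural_mono[of _ k] activation_time_mono[of k] order_trans by blast
qed (use last_index(3)[OF assms] in blast)

lemma count_total: "s \<ge> 0 \<Longrightarrow> count Red s + count Black s = last_index s"
  using natural_card last_index by (simp add: count_def)

lemma active_subset_last:
  assumes "s \<ge> 0" "natural k" "activation_time k \<le> ereal s"
  shows "active k S \<subseteq> active (last_index s) S"
  using assms by (intro active_mono last_index)

end

section \<open>Deterministic comparison with barriers\<close>

locale tube = good_bootstrap +
  fixes m :: nat and t :: "nat \<Rightarrow> real" and u l :: "color \<Rightarrow> nat \<Rightarrow> nat"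
  assumes t0: "t 0 = 0" and t_mono: "\<And>i. i < m \<Longrightarrow> t i \<le> t (Suc i)"
begin

definition possibly :: "color \<Rightarrow> nat \<Rightarrow> nat \<Rightarrow> bool" where
  "possibly S j v \<longleftrightarrow> edges (E S v) (u S (Suc j) + a S)
      - edges (E (other S) v) (l (other S) j + a (other S)) \<ge> int r"

definition surely :: "color \<Rightarrow> nat \<Rightarrow> nat \<Rightarrow> bool" where
  "surely S j v \<longleftrightarrow> edges (E S v) (l S j + a S)
      - edges (E (other S) v) (u (other S) (Suc j) + a (other S)) \<ge> int r"

definition upper_set :: "color \<Rightarrow> nat \<Rightarrow> nat set" where
  "upper_set S i = {v. v < nW \<and> (\<exists>j\<le>i. possibly S j v \<and> rings v (t j) (t (Suc j)))}"

text \<open>Being surely susceptible at a ring is not enough, because the other colour may have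
  taken the node before. The last clause excludes every ring, up to and including block
  \<open>j\<close>, at which this could have happened.\<close>

definition lower_set :: "color \<Rightarrow> nat \<Rightarrow> nat set" where
  "lower_set S i = {v. v < nW \<and> (\<exists>j\<le>i. surely S j v \<and> rings v (t j) (t (Suc j)) \<and>
      (\<forall>j'\<le>j. \<not> (possibly (other S) j' v \<and> rings v (t j') (t (Suc j')))))}"

lemma t_mono_le: "i \<le> j \<Longrightarrow> j \<le> m \<Longrightarrow> t i \<le> t j"
proof (induction j)
  case (Suc j)
  then show ?case using t_mono[of j] by (cases "i = Suc j") (auto intro: order_trans)
qed simp

lemma t_nonneg: "j \<le> m \<Longrightarrow> t j \<ge> 0"
  using t_mono_le[of 0 j] t0 by simp

lemma find_block: "0 < s \<Longrightarrow> s \<le> t (Suc i) \<Longrightarrow> \<exists>j\<le>i. t j < s \<and> s \<le> t (Suc j)"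
proof (induction i)
  case 0
  then show ?case using t0 by auto
next
  case (Suc i)
  then show ?case by (cases "s \<le> t (Suc i)") (auto intro: le_SucI)
qed

text \<open>The bounds are proved in the order: lower bounds up to t_i and upper bounds for earlier
  blocks give the upper bound in block i, which gives the lower bound at t_(i+1). The upper bound in
  block i refers to itself; this is resolved by an induction over activations, since the nodes
  coloured so far lie in \<open>upper_set\<close>, whose size is within the barrier, when the next
  node is coloured.\<close>

lemma count_in_tube:
  assumes l0: "\<And>S. l S 0 = 0"
    and up: "\<And>S i. i < m \<Longrightarrow> card (upper_set S i) \<le> u S (Suc i)"
    and lo: "\<And>S i. i < m \<Longrightarrow> l S (Suc i) \<le> card (lower_set S i)"
    and "i \<le> m"
  shows "\<And>S. l S i \<le> count S (t i)"
    and "\<And>S k. 0 < i \<Longrightarrow> natural k \<Longrightarrow> activation_time k \<le> ereal (t i) \<Longrightarrow> card (active k S) \<le> u S i"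
proof -
  \<comment> \<open>\<open>Up\<close> is an inclusion of sets and not just a bound on cardinalities,
    because the lower bound has to know which nodes the other colour can have taken.\<close>
  define Low where "Low i = (\<forall>S. l S i \<le> count S (t i))" for i
  define Up where "Up i = (\<forall>k S. natural k \<longrightarrow> activation_time k \<le> ereal (t (Suc i)) \<longrightarrow>
      active k S \<subseteq> upper_set S i)" for i
  have fin: "finite (upper_set S i)" "finite (lower_set S i)" for S i
    by (simp_all add: upper_set_def lower_set_def)
  have Up_card: "card (active k S) \<le> u S (Suc i)"
    if "Up i" "i < m" "natural k" "activation_time k \<le> ereal (t (Suc i))" for i k S
    using that card_mono[OF fin(1)[of S i], of "active k S"] up[of i S] unfolding Up_def by fastforce
  have main: "(\<forall>j\<le>i. Low j) \<and> (\<forall>j<i. Up j)" if "i \<le> m" for i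
    using that
  proof (induction i)
    case 0
    then show ?case using l0 by (simp add: Low_def)
  next
    case (Suc i)
    then have IH: "\<forall>j\<le>i. Low j" "\<forall>j<i. Up j" and im: "i < m" by auto
    have UpI: "natural k \<Longrightarrow> activation_time k \<le> ereal (t (Suc i)) \<Longrightarrow>
        active k S \<subseteq> upper_set S i" for k S
    proof (induction k arbitrary: S)
      case 0
      then show ?case by simp
    next
      case (Suc k)
      have nk: "natural k" using Suc.prems by (simp add: natural_Suc)
      obtain s where s: "activation_time k = ereal s" "s \<ge> 0" using natural_time[OF nk] by auto
      obtain s' v S' x where step: "activation_time (Suc k) = ereal s'" "s < s'"
        "v \<in> eligible (active k)" "v \<in> susceptible (active k) S'"
        "active (Suc k) = (active k)(S' := insert v (active k S'))" "ring_time v x = s'"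
        using natural_step[OF Suc.prems(1) s(1)] by metis
      have ti: "activation_time k \<le> ereal (t (Suc i))"
        using step(1,2) s(1) Suc.prems(2) by simp
      have IHk: "active k S \<subseteq> upper_set S i" for S using Suc.IH[OF nk ti] .
      obtain j where j: "j \<le> i" "t j < s'" "s' \<le> t (Suc j)"
        using find_block[of s' i] s step Suc.prems(2) by auto
      have vW: "v < nW" using step(3) eligible_subset(2) by (auto simp: nodes_def)
      \<comment> \<open>In an earlier block this is the outer induction hypothesis; in the current
        block the inner one, for the configuration before the activation, applies.\<close>
      have cu: "card (active k S') \<le> u S' (Suc j)"
      proof (cases "j < i")
        case True
        then show ?thesis using Up_card[of j k S'] IH(2) im nk s step(2) j by auto
      next
        case False
        then have "j = i" using j by simp
        then show ?thesis using card_mono[OF fin(1) IHk[of S']] up[OF im, of S'] by simp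
      qed
      have tj: "t j \<ge> 0" using t_nonneg[of j] j im by simp
      \<comment> \<open>Activation \<open>Suc k\<close> happens after \<open>t j\<close>, so
        everything counted at \<open>t j\<close> is already contained in
        \<open>active k\<close>.\<close>
      have "last_index (t j) \<le> k"
      proof (rule ccontr)
        assume "\<not> ?thesis"
        then have "Suc k \<le> last_index (t j)" by simp
        then show False using le_last_index_iff[OF tj, of "Suc k"] step(1) j(2) by simp
      qed
      then have "count (other S') (t j) \<le> card (active k (other S'))"
        unfolding count_def by (intro card_mono active_mono natural_finite nk)
      then have cl: "l (other S') j \<le> card (active k (other S'))"
        using IH(1) j(1) unfolding Low_def by (meson order_trans)
      have "possibly S' j v"
        using step(4) edges_mono[of "card (active k S') + a S'" "u S' (Suc j) + a S'" "E S' v"]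
          edges_mono[of "l (other S') j + a (other S')"
            "card (active k (other S')) + a (other S')" "E (other S') v"] cu cl
        by (auto simp: susceptible_def deg_eq possibly_def)
      moreover have "rings v (t j) (t (Suc j))"
        using j step(6) unfolding rings_def by blast
      ultimately have "v \<in> upper_set S' i"
        using j(1) vW unfolding upper_set_def by blast
      then show ?case using IHk[of S] step(5) by auto
    qed
    then have Upi: "Up i" unfolding Up_def by blast
    have Upj: "Up j" if "j \<le> i" for j using Upi IH(2) that by (cases "j = i") auto
    have tS: "t (Suc i) \<ge> 0" using t_nonneg[of "Suc i"] im by simp
    have sub: "lower_set S i \<subseteq> active (last_index (t (Suc i))) S" for S
    proof
      fix v assume "v \<in> lower_set S i"
      then obtain j x where v: "v < nW" and j: "j \<le> i" "surely S j v"
        and x: "t j < ring_time v x" "ring_time v x \<le> t (Suc j)"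
        and no: "\<And>j'. j' \<le> j \<Longrightarrow> \<not> (possibly (other S) j' v \<and> rings v (t j') (t (Suc j')))"
        unfolding lower_set_def rings_def by blast
      have jm: "j < m" using j im by simp
      have tj: "t j \<ge> 0" using t_nonneg[of j] jm by simp
      have tjS: "t (Suc j) \<le> t (Suc i)" using t_mono_le[of "Suc j" "Suc i"] j im by simp
      \<comment> \<open>The last activation strictly before the ring of \<open>v\<close> is
        selected; its configuration is the one that \<open>v\<close> sees when its clock
        rings.\<close>
      let ?A = "{k. natural k \<and> activation_time k < ereal (ring_time v x)}"
      have finA: "finite ?A" using natural_le by (auto intro: finite_subset[of _ "{..nW}"])
      have "0 \<in> ?A" using tj x by auto
      define k where "k = Max ?A"
      have "k \<in> ?A" using finA \<open>0 \<in> ?A\<close> Max_in unfolding k_def by blast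
      then have k: "natural k" "activation_time k < ereal (ring_time v x)" by auto
      have kmax: "k' \<le> k" if "natural k'" "activation_time k' < ereal (ring_time v x)" for k'
        unfolding k_def using that finA by (intro Max_ge) auto
      have kt: "activation_time k \<le> ereal (t (Suc j))"
        using k(2) x(2) by (metis ereal_less_eq(3) less_imp_le order_trans)
      have "last_index (t j) \<le> k"
        using last_index[OF tj] x(1) by (intro kmax) (auto intro: le_less_trans)
      then have "count S (t j) \<le> card (active k S)"
        unfolding count_def by (intro card_mono active_mono natural_finite k)
      then have cl: "l S j \<le> card (active k S)"
        using IH(1) j(1) unfolding Low_def by (meson order_trans)
      have cu: "card (active k (other S)) \<le> u (other S) (Suc j)"
        using Up_card[OF Upj[OF j(1)] jm k(1) kt] .
      have sus: "v \<in> susceptible (active k) S"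
        using j(2) v edges_mono[of "l S j + a S" "card (active k S) + a S" "E S v"]
          edges_mono[of "card (active k (other S)) + a (other S)"
            "u (other S) (Suc j) + a (other S)" "E (other S) v"] cu cl
        by (auto simp: susceptible_def deg_eq surely_def nodes_def)
      \<comment> \<open>Here the inclusion \<open>Up\<close> is used: a node taken by the other
        colour would be in \<open>upper_set (other S) j\<close>, which the last clause of
        \<open>lower_set\<close> forbids.\<close>
      have notother: "v \<notin> active k (other S)"
      proof
        assume "v \<in> active k (other S)"
        then have "v \<in> upper_set (other S) j"
          using Upj[OF j(1)] k(1) kt unfolding Up_def by blast
        then show False using no unfolding upper_set_def by blast
      qed
      show "v \<in> active (last_index (t (Suc i))) S"
      proof (cases "v \<in> active k S")
        case True
        have "activation_time k \<le> ereal (t (Suc i))"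
          using kt tjS by (meson ereal_less_eq(3) order_trans)
        then show ?thesis using active_subset_last[OF tS k(1), of S] True by blast
      next
        case False
        then have wh: "v \<in> white (active k)"
          using notother v by (cases S) (auto simp: white_def nodes_def)
        then have el: "v \<in> eligible (active k)"
          using sus by (cases S) (auto simp: eligible_def)
        then have nk: "natural (Suc k)"
          using natural_eligible_not_stopped[OF k(1)] k(1) by (auto simp: natural_Suc)
        obtain s where s: "activation_time k = ereal s" "s \<ge> 0" using natural_time[OF k(1)] by auto
        obtain s' w S' y where step: "activation_time (Suc k) = ereal s'" "s < s'"
          "w \<in> eligible (active k)" "w \<in> susceptible (active k) S'"
          "active (Suc k) = (active k)(S' := insert w (active k S'))" "ring_time w y = s'"
          and first: "\<And>w j. w \<in> eligible (active k) \<Longrightarrow> s < ring_time w j \<Longrightarrow> s' \<le> ring_time w j"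
          using natural_step[OF nk s(1)] by metis
        \<comment> \<open>The next activation is not later than the ring because \<open>v\<close> is
          eligible, and not earlier by maximality of \<open>k\<close>. So it happens at the ring of
          \<open>v\<close>, and since distinct clocks do not tie, \<open>v\<close> is the activated
          node.\<close>
        have "s' \<le> ring_time v x" using first[OF el] k(2) s(1) by simp
        moreover have "\<not> s' < ring_time v x" using kmax[OF nk] step(1) by auto
        ultimately have eq: "s' = ring_time v x" by simp
        have "w < nW" using step(3) eligible_subset(2) by (auto simp: nodes_def)
        then have "w = v" using ring_time_inj[of w v y x] v step(6) eq by simp
        then have "S' = S" using susceptible_unique[OF r_pos step(4)] sus by simp
        then have "v \<in> active (Suc k) S" using step(5) \<open>w = v\<close> by simp
        moreover have "activation_time (Suc k) \<le> ereal (t (Suc i))"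
          using step(1) eq x(2) tjS by simp
        ultimately show ?thesis using active_subset_last[OF tS nk, of S] by blast
      qed
    qed
    have "Low (Suc i)"
      unfolding Low_def count_def
      using lo[OF im] card_mono[OF natural_finite[OF last_index(1)[OF tS]] sub] order_trans by blast
    then show ?case using IH Upi by (auto simp: le_Suc_eq less_Suc_eq)
  qed
  show "l S i \<le> count S (t i)" for S using main[OF \<open>i \<le> m\<close>] by (auto simp: Low_def)
  show "card (active k S) \<le> u S i" if "0 < i" "natural k" "activation_time k \<le> ereal (t i)" for S k
    using main[OF \<open>i \<le> m\<close>] that Up_card[of "i - 1" k S] \<open>i \<le> m\<close> by simp
qed

end

section \<open>Chernoff bounds\<close>

text \<open>The exponential Markov inequality, with each factor
  \<open>1 + (exp s - 1) * prob\<close> bounded by an exponential. The event keeps the factor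
  \<open>s\<close> on both sides, so that positive \<open>s\<close> gives the upper tail and
  negative \<open>s\<close> the lower tail.\<close>

lemma (in prob_space) count_mgf_bound:
  fixes P :: "'i \<Rightarrow> 'a \<Rightarrow> bool"
  assumes fin: "finite I" and ind: "indep_vars (\<lambda>_. borel) (\<lambda>v \<omega>. of_bool (P v \<omega>) :: real) I"
  shows "prob {\<omega>\<in>space M. s * real (card {v\<in>I. P v \<omega>}) \<ge> s * c}
    \<le> exp (- s * c + (exp s - 1) * (\<Sum>v\<in>I. prob {\<omega>\<in>space M. P v \<omega>}))"
proof -
  define Y where "Y v \<omega> = exp (s * of_bool (P v \<omega>))" for v \<omega>
  have rv: "(\<lambda>\<omega>. of_bool (P v \<omega>) :: real) \<in> borel_measurable M" if "v \<in> I" for v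
    using ind that by (auto simp: indep_vars_def)
  have setsP: "{\<omega>\<in>space M. P v \<omega>} \<in> sets M" if "v \<in> I" for v
  proof -
    have "{\<omega>\<in>space M. P v \<omega>} = (\<lambda>\<omega>. of_bool (P v \<omega>) :: real) -` {1} \<inter> space M" by auto
    then show ?thesis using measurable_sets[OF rv[OF that], of "{1}"] by simp
  qed
  have Yeq: "Y v \<omega> = 1 + (exp s - 1) * indicator {\<omega>\<in>space M. P v \<omega>} \<omega>"
    if "\<omega> \<in> space M" for v \<omega>
    using that by (simp add: Y_def indicator_def)
  have intY: "integrable M (Y v)" if "v \<in> I" for v
  proof -
    have "integrable M (\<lambda>\<omega>. 1 + (exp s - 1) * indicator {\<omega>\<in>space M. P v \<omega>} \<omega> :: real)"
      using setsP[OF that] by (intro Bochner_Integration.integrable_add integrable_const integrable_mult_right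
        integrable_real_indicator) (auto simp: emeasure_eq_measure)
    then show ?thesis
      by (rule Bochner_Integration.integrable_cong[THEN iffD2, rotated -1]) (simp_all add: Yeq)
  qed
  have EY: "expectation (Y v) = 1 + (exp s - 1) * prob {\<omega>\<in>space M. P v \<omega>}" if "v \<in> I" for v
  proof -
    have "expectation (Y v) = expectation (\<lambda>\<omega>. 1 + (exp s - 1) * indicator {\<omega>\<in>space M. P v \<omega>} \<omega>)"
      by (rule Bochner_Integration.integral_cong) (simp_all add: Yeq)
    also have "\<dots> = 1 + (exp s - 1) * prob {\<omega>\<in>space M. P v \<omega>}"
      using setsP[OF that] by (subst Bochner_Integration.integral_add)
        (auto simp: emeasure_eq_measure prob_space)
    finally show ?thesis .
  qed
  have indY: "indep_vars (\<lambda>_. borel) Y I"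
    unfolding Y_def[abs_def] by (rule indep_vars_compose2[OF ind, where Y="\<lambda>_ x. exp (s * x)"]) measurable
  have prodY: "(\<Prod>v\<in>I. Y v \<omega>) = exp (s * real (card {v\<in>I. P v \<omega>}))" for \<omega>
  proof -
    have "(\<Prod>v\<in>I. Y v \<omega>) = exp (\<Sum>v\<in>I. s * of_bool (P v \<omega>))"
      unfolding Y_def by (simp only: exp_sum[OF fin])
    also have "(\<Sum>v\<in>I. s * of_bool (P v \<omega>)) = s * real (card {v\<in>I. P v \<omega>})"
      using fin by (simp add: sum_distrib_left[symmetric] Int_def)
    finally show ?thesis .
  qed
  have "prob {\<omega>\<in>space M. s * real (card {v\<in>I. P v \<omega>}) \<ge> s * c}
      = prob {\<omega>\<in>space M. (\<Prod>v\<in>I. Y v \<omega>) \<ge> exp (s * c)}"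
    by (simp add: prodY)
  also have "\<dots> \<le> expectation (\<lambda>\<omega>. \<Prod>v\<in>I. Y v \<omega>) / exp (s * c)"
    by (rule integral_Markov_inequality_measure[OF indep_vars_integrable[OF fin indY intY], where A="{}"])
      (simp_all add: prodY)
  also have "expectation (\<lambda>\<omega>. \<Prod>v\<in>I. Y v \<omega>) = (\<Prod>v\<in>I. 1 + (exp s - 1) * prob {\<omega>\<in>space M. P v \<omega>})"
    by (subst indep_vars_lebesgue_integral) (auto intro!: fin indY intY prod.cong simp: EY)
  also have "\<dots> \<le> (\<Prod>v\<in>I. exp ((exp s - 1) * prob {\<omega>\<in>space M. P v \<omega>}))"
  proof (intro prod_mono conjI)
    fix v assume v: "v \<in> I"
    have "0 \<le> expectation (Y v)" by (intro integral_nonneg_AE) (simp add: Y_def)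
    then show "0 \<le> 1 + (exp s - 1) * prob {\<omega>\<in>space M. P v \<omega>}" using EY[OF v] by simp
  qed (rule exp_ge_add_one_self)
  also have "\<dots> = exp ((exp s - 1) * (\<Sum>v\<in>I. prob {\<omega>\<in>space M. P v \<omega>}))"
    using fin by (simp add: exp_sum sum_distrib_left)
  finally have "prob {\<omega>\<in>space M. s * real (card {v\<in>I. P v \<omega>}) \<ge> s * c}
      \<le> exp ((exp s - 1) * (\<Sum>v\<in>I. prob {\<omega>\<in>space M. P v \<omega>})) / exp (s * c)"
    by (simp add: divide_right_mono)
  also have "\<dots> = exp (- s * c + (exp s - 1) * (\<Sum>v\<in>I. prob {\<omega>\<in>space M. P v \<omega>}))"
    by (simp only: exp_diff[symmetric]) simp
  finally show ?thesis .
qed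

text \<open>The parameter \<theta> stays free; it is later tuned to the gap between mean and
  threshold.\<close>

lemma (in prob_space) count_upper_tail:
  fixes P :: "'i \<Rightarrow> 'a \<Rightarrow> bool"
  assumes "finite I" "indep_vars (\<lambda>_. borel) (\<lambda>v \<omega>. of_bool (P v \<omega>) :: real) I"
    and le: "(\<Sum>v\<in>I. prob {\<omega>\<in>space M. P v \<omega>}) \<le> \<mu>" and \<theta>: "0 < \<theta>" "\<theta> \<le> 1"
  shows "prob {\<omega>\<in>space M. real (card {v\<in>I. P v \<omega>}) \<ge> c} \<le> exp (- \<theta> * c + \<mu> * (\<theta> + \<theta>\<^sup>2))"
proof -
  have \<mu>: "0 \<le> \<mu>" using le sum_nonneg[of I "\<lambda>v. prob {\<omega>\<in>space M. P v \<omega>}"] by simp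
  have "exp \<theta> - 1 \<le> \<theta> + \<theta>\<^sup>2" using exp_bound[of \<theta>] \<theta> by simp
  then have "(exp \<theta> - 1) * (\<Sum>v\<in>I. prob {\<omega>\<in>space M. P v \<omega>}) \<le> (\<theta> + \<theta>\<^sup>2) * \<mu>"
    using le \<theta> \<mu> by (intro mult_mono) (auto intro: sum_nonneg)
  then show ?thesis
    using count_mgf_bound[OF assms(1,2), of \<theta> c] \<theta>
    by (auto simp: algebra_simps elim: order_trans)
qed

lemma (in prob_space) count_lower_tail:
  fixes P :: "'i \<Rightarrow> 'a \<Rightarrow> bool"
  assumes "finite I" "indep_vars (\<lambda>_. borel) (\<lambda>v \<omega>. of_bool (P v \<omega>) :: real) I"
    and ge: "\<mu> \<le> (\<Sum>v\<in>I. prob {\<omega>\<in>space M. P v \<omega>})" and \<theta>: "0 < \<theta>" "\<theta> \<le> 1" and \<mu>: "0 \<le> \<mu>"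
  shows "prob {\<omega>\<in>space M. real (card {v\<in>I. P v \<omega>}) \<le> c} \<le> exp (\<theta> * c - \<mu> * (\<theta> - \<theta>\<^sup>2))"
proof -
  have e: "exp (- \<theta>) \<le> 1 - \<theta> + \<theta>\<^sup>2"
  proof -
    have "inverse (exp \<theta>) \<le> inverse (1 + \<theta>)"
      using \<theta> exp_ge_add_one_self[of \<theta>] by (intro le_imp_inverse_le) auto
    also have "\<dots> \<le> 1 - \<theta> + \<theta>\<^sup>2"
    proof -
      have "1 \<le> (1 - \<theta> + \<theta>\<^sup>2) * (1 + \<theta>)" using \<theta> by (simp add: algebra_simps power2_eq_square)
      then show ?thesis using \<theta> by (simp add: field_simps)
    qed
    finally show ?thesis by (simp add: exp_minus)
  qed
  have "\<mu> * (\<theta> - \<theta>\<^sup>2) \<le> \<mu> * (1 - exp (- \<theta>))"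
    using e \<mu> by (intro mult_left_mono) auto
  also have "\<dots> \<le> (\<Sum>v\<in>I. prob {\<omega>\<in>space M. P v \<omega>}) * (1 - exp (- \<theta>))"
    using ge \<theta> by (intro mult_right_mono) auto
  finally have "(exp (- \<theta>) - 1) * (\<Sum>v\<in>I. prob {\<omega>\<in>space M. P v \<omega>}) \<le> - \<mu> * (\<theta> - \<theta>\<^sup>2)"
    by (simp add: algebra_simps)
  then show ?thesis
    using count_mgf_bound[OF assms(1,2), of "-\<theta>" c] \<theta>
    by (auto simp: algebra_simps elim: order_trans)
qed

section \<open>Rings of a unit-rate Poisson clock\<close>

text \<open>The notion \<open>rings\<close> for a single sequence of waiting times, detached from
  the locale so that it can be studied as an event.\<close>

definition rings_in :: "(nat \<Rightarrow> real) \<Rightarrow> real \<Rightarrow> real \<Rightarrow> bool" where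
  "rings_in w s t \<longleftrightarrow> (\<exists>j. s < (\<Sum>i\<le>j. w i) \<and> (\<Sum>i\<le>j. w i) \<le> t)"

lemma (in prob_space) exponential_gt:
  assumes "distributed M lborel X (exponential_density 1)" "0 \<le> a"
  shows "prob {\<omega>\<in>space M. a < X \<omega>} = exp (- a)"
  using exponential_distributedD_gt[OF assms] by simp

text \<open>Memorylessness, in a form that compares two overshoots of the same level.\<close>

lemma (in prob_space) exponential_overshoot:
  assumes ind: "indep_var borel X borel Y"
    and X: "distributed M lborel X (exponential_density 1)" and st: "s \<le> t"
  shows "prob {\<omega>\<in>space M. Y \<omega> \<le> s \<and> t < Y \<omega> + X \<omega>}
    = exp (- (t - s)) * prob {\<omega>\<in>space M. Y \<omega> \<le> s \<and> s < Y \<omega> + X \<omega>}"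
proof -
  have rv [measurable]: "Y \<in> borel_measurable M" "X \<in> borel_measurable M"
    using indep_var_rv1[OF ind] indep_var_rv2[OF ind] by auto
  interpret DX: prob_space "distr M borel X" by (rule prob_space_distr) simp
  interpret DY: prob_space "distr M borel Y" by (rule prob_space_distr) simp
  interpret D: pair_sigma_finite "distr M borel X" "distr M borel Y" ..
  \<comment> \<open>Given Y = y \<le> s, the event is X > t - y, of probability exp(-(t - y)). The
    level t enters only through the factor exp(-(t - s)), uniformly in y.\<close>
  have joint: "emeasure M {\<omega>\<in>space M. Y \<omega> \<le> s \<and> t < Y \<omega> + X \<omega>}
      = (\<integral>\<^sup>+y. indicator {..s} y * ennreal (exp (- (t - y))) \<partial>distr M borel Y)" if st: "s \<le> t" for t
  proof -
    let ?A = "{z. snd z \<le> s \<and> t < snd z + fst z} :: (real \<times> real) set"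
    have "Measurable.pred (borel \<Otimes>\<^sub>M borel) (\<lambda>z :: real \<times> real. snd z \<le> s \<and> t < snd z + fst z)"
      by measurable
    then have A: "?A \<in> sets (borel \<Otimes>\<^sub>M borel)"
      by (simp add: pred_def space_pair_measure)
    have "emeasure M {\<omega>\<in>space M. Y \<omega> \<le> s \<and> t < Y \<omega> + X \<omega>}
        = emeasure (distr M (borel \<Otimes>\<^sub>M borel) (\<lambda>\<omega>. (X \<omega>, Y \<omega>))) ?A"
      using A by (subst emeasure_distr) (auto intro!: arg_cong[where f="emeasure M"])
    also have "distr M (borel \<Otimes>\<^sub>M borel) (\<lambda>\<omega>. (X \<omega>, Y \<omega>)) = distr M borel X \<Otimes>\<^sub>M distr M borel Y"
      using ind by (simp add: indep_var_distribution_eq)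
    also have "emeasure (distr M borel X \<Otimes>\<^sub>M distr M borel Y) ?A
        = (\<integral>\<^sup>+y. emeasure (distr M borel X) ((\<lambda>x. (x, y)) -` ?A) \<partial>distr M borel Y)"
      using A by (intro D.emeasure_pair_measure_alt2) simp
    also have "\<dots> = (\<integral>\<^sup>+y. indicator {..s} y * ennreal (exp (- (t - y))) \<partial>distr M borel Y)"
    proof (rule nn_integral_cong)
      fix y :: real
      show "emeasure (distr M borel X) ((\<lambda>x. (x, y)) -` ?A) = indicator {..s} y * ennreal (exp (- (t - y)))"
      proof (cases "y \<le> s")
        case True
        have "emeasure (distr M borel X) ((\<lambda>x. (x, y)) -` ?A) = emeasure (distr M borel X) {t - y<..}"
          using True by (intro arg_cong[where f="emeasure _"]) auto
        also have "\<dots> = emeasure M {\<omega>\<in>space M. t - y < X \<omega>}"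
          by (subst emeasure_distr) (auto intro!: arg_cong[where f="emeasure M"])
        also have "\<dots> = ennreal (exp (- (t - y)))"
          using exponential_gt[OF X, of "t - y"] True st by (simp add: emeasure_eq_measure)
        finally show ?thesis using True by simp
      qed auto
    qed
    finally show ?thesis .
  qed
  have "emeasure M {\<omega>\<in>space M. Y \<omega> \<le> s \<and> t < Y \<omega> + X \<omega>}
      = (\<integral>\<^sup>+y. ennreal (exp (- (t - s))) * (indicator {..s} y * ennreal (exp (- (s - y)))) \<partial>distr M borel Y)"
    unfolding joint[OF st]
    by (intro nn_integral_cong) (auto simp: indicator_def ennreal_mult[symmetric] exp_add[symmetric])
  also have "\<dots> = ennreal (exp (- (t - s))) * emeasure M {\<omega>\<in>space M. Y \<omega> \<le> s \<and> s < Y \<omega> + X \<omega>}"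
    unfolding joint[OF order_refl] by (rule nn_integral_cmult) measurable
  finally show ?thesis by (simp add: emeasure_eq_measure ennreal_mult[symmetric])
qed

text \<open>No ring in (s,t] means that one waiting time spans the whole interval: the partial sum
  before it is at most s and the one after it exceeds t. The empty sum is at most s, which is where
  \<open>0 \<le> s\<close> enters.\<close>

lemma not_rings_in_iff:
  assumes pos: "\<And>i. 0 < w i" and unb: "\<exists>j. s < (\<Sum>i<j. w i)" and st: "0 \<le> s" "s \<le> (t::real)"
  shows "\<not> rings_in w s t \<longleftrightarrow> (\<exists>j. (\<Sum>i<j. w i) \<le> s \<and> t < (\<Sum>i<j. w i) + w j)"
proof
  have mono: "(\<Sum>i<j. w i) \<le> (\<Sum>i<k. w i)" if "j \<le> k" for j k
    using that pos by (intro sum_mono2) (auto intro: less_imp_le)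
  { assume no: "\<not> rings_in w s t"
    define k where "k = (LEAST j. s < (\<Sum>i<j. w i))"
    have k: "s < (\<Sum>i<k. w i)" unfolding k_def by (rule LeastI_ex[OF unb])
    then have "k \<noteq> 0" using st by (cases k) auto
    then obtain j where j: "k = Suc j" by (cases k) auto
    have "\<not> s < (\<Sum>i<j. w i)" using not_less_Least[of j "\<lambda>j. s < (\<Sum>i<j. w i)"] j k_def by simp
    moreover have "t < (\<Sum>i<Suc j. w i)"
      using no k unfolding j rings_in_def lessThan_Suc_atMost by (meson not_le)
    ultimately show "\<exists>j. (\<Sum>i<j. w i) \<le> s \<and> t < (\<Sum>i<j. w i) + w j" by (intro exI[of _ j]) auto }
  { assume "\<exists>j. (\<Sum>i<j. w i) \<le> s \<and> t < (\<Sum>i<j. w i) + w j"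
    then obtain j where j: "(\<Sum>i<j. w i) \<le> s" "t < (\<Sum>i<Suc j. w i)" by auto
    show "\<not> rings_in w s t"
      unfolding rings_in_def lessThan_Suc_atMost[symmetric]
    proof safe
      fix k assume k: "s < (\<Sum>i<Suc k. w i)" "(\<Sum>i<Suc k. w i) \<le> t"
      show False using mono[of "Suc k" j] mono[of "Suc j" "Suc k"] j k
        by (cases "Suc k \<le> j") auto
    qed }
qed

context prob_space
begin

context
  fixes X :: "nat \<Rightarrow> 'a \<Rightarrow> real"
  assumes X: "\<And>j. distributed M lborel (X j) (exponential_density 1)"
    and ind: "indep_vars (\<lambda>_. borel) X UNIV"
begin

lemma waiting_measurable [measurable]: "X j \<in> borel_measurable M"
  using distributed_measurable[OF X] by simp

lemma AE_waiting_pos: "AE \<omega> in M. \<forall>j. 0 < X j \<omega>"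
proof -
  have "AE \<omega> in M. 0 < X j \<omega>" for j
    using exponential_gt[OF X, of 0 j] by (subst prob_Collect_eq_1[symmetric]) auto
  then show ?thesis by (simp add: AE_all_countable)
qed

text \<open>Even single waiting times are unbounded: the probability that all of them are at most N
  is at most c^k for every k, with c < 1.\<close>

lemma AE_waiting_unbounded: "AE \<omega> in M. \<forall>s. \<exists>j. s < (\<Sum>i<j. X i \<omega>)"
proof -
  have 1: "AE \<omega> in M. \<exists>i. real N < X i \<omega>" for N :: nat
  proof -
    let ?B = "{\<omega>\<in>space M. \<forall>i. X i \<omega> \<le> real N}"
    define c where "c = 1 - exp (- real N)"
    have c: "0 \<le> c" "c < 1" by (auto simp: c_def)
    have "prob ?B \<le> c ^ Suc k" for k
    proof -
      have le: "prob {\<omega>\<in>space M. X i \<omega> \<le> real N} = c" for i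
        using exponential_distributedD_le[OF X, of "real N" i] by (simp add: c_def)
      have "prob ?B \<le> prob (\<Inter>i\<in>{..k}. X i -` {..real N} \<inter> space M)"
        by (intro finite_measure_mono) auto
      also have "\<dots> = (\<Prod>i\<in>{..k}. prob (X i -` {..real N} \<inter> space M))"
        by (rule indep_varsD[OF ind]) auto
      also have "\<dots> = (\<Prod>i\<in>{..k}. c)"
      proof (intro prod.cong refl)
        fix i
        have "X i -` {..real N} \<inter> space M = {\<omega>\<in>space M. X i \<omega> \<le> real N}" by auto
        then show "prob (X i -` {..real N} \<inter> space M) = c" using le by simp
      qed
      finally show ?thesis by simp
    qed
    moreover have "(\<lambda>k. c ^ Suc k) \<longlonglongrightarrow> 0" using c by (intro LIMSEQ_Suc LIMSEQ_power_zero) auto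
    ultimately have "prob ?B \<le> 0" by (intro LIMSEQ_le_const) auto
    then have "prob ?B = 0" by (simp add: measure_le_0_iff)
    then have "AE \<omega> in M. \<omega> \<notin> ?B" by (subst prob_eq_0[symmetric]) auto
    then show ?thesis by (rule AE_mp) (auto simp: not_le)
  qed
  then have "AE \<omega> in M. \<forall>N::nat. \<exists>i. real N < X i \<omega>" by (simp add: AE_all_countable)
  then show ?thesis using AE_waiting_pos
  proof eventually_elim
    case (elim \<omega>)
    show ?case
    proof
      fix s :: real
      obtain N where "s < real N" using reals_Archimedean2 by blast
      moreover obtain i where "real N < X i \<omega>" using elim(1) by blast
      moreover have "0 \<le> (\<Sum>l<i. X l \<omega>)" using elim(2) by (intro sum_nonneg) (auto intro: less_imp_le)
      ultimately show "\<exists>j. s < (\<Sum>l<j. X l \<omega>)" by (intro exI[of _ "Suc i"]) simp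
    qed
  qed
qed

lemma rings_in_sets [measurable]: "Measurable.pred M (\<lambda>\<omega>. rings_in (\<lambda>j. X j \<omega>) s t)"
  unfolding rings_in_def by measurable

text \<open>\<open>B t j\<close> is the event of exactly j rings up to s and none in (s,t]. These
  events are disjoint and exhaust the absence of rings; by memorylessness each has exp(-(t - s))
  times its probability for t = s, and for t = s the probabilities sum to 1. The distribution of the
  number of rings is not computed.\<close>

lemma prob_not_rings_in:
  assumes "0 \<le> s" "s \<le> t"
  shows "prob {\<omega>\<in>space M. \<not> rings_in (\<lambda>j. X j \<omega>) s t} = exp (- (t - s))"
proof -
  define B where "B t j = {\<omega>\<in>space M. (\<forall>i. 0 < X i \<omega>) \<and> (\<Sum>i<j. X i \<omega>) \<le> s \<and> t < (\<Sum>i<j. X i \<omega>) + X j \<omega>}" for t j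
  have Bm: "B t j \<in> sets M" for t j unfolding B_def by measurable
  have indS: "indep_var borel (X j) borel (\<lambda>\<omega>. \<Sum>i<j. X i \<omega>)" for j
    by (rule indep_vars_sum) (auto intro: indep_vars_subset[OF ind])
  have B: "prob (B t j) = prob {\<omega>\<in>space M. (\<Sum>i<j. X i \<omega>) \<le> s \<and> t < (\<Sum>i<j. X i \<omega>) + X j \<omega>}" for t j
    unfolding B_def
    by (intro finite_measure_eq_AE) (use AE_waiting_pos in \<open>auto elim!: eventually_mono\<close>)
  have scale: "prob (B t j) = exp (- (t - s)) * prob (B s j)" if "s \<le> t" for t j
    unfolding B by (rule exponential_overshoot[OF indS X that])
  have sums: "(\<lambda>j. prob (B t j)) sums prob {\<omega>\<in>space M. \<not> rings_in (\<lambda>j. X j \<omega>) s t}" if "s \<le> t" for t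
  proof -
    have "disjoint_family (B t)"
      unfolding disjoint_family_on_def
    proof (intro ballI impI)
      fix j k :: nat assume "j \<noteq> k"
      have "False" if "j < k" "\<omega> \<in> B t j" "\<omega> \<in> B t k" for j k \<omega>
      proof -
        have "(\<Sum>i<Suc j. X i \<omega>) \<le> (\<Sum>i<k. X i \<omega>)"
          using that by (intro sum_mono2) (auto simp: B_def intro: less_imp_le)
        then show False using that \<open>s \<le> t\<close> by (auto simp: B_def)
      qed
      then show "B t j \<inter> B t k = {}" using \<open>j \<noteq> k\<close> by (metis disjoint_iff linorder_neqE_nat)
    qed
    then have "(\<lambda>j. prob (B t j)) sums prob (\<Union>j. B t j)"
      using Bm by (intro finite_measure_UNION) auto
    also have "prob (\<Union>j. B t j) = prob {\<omega>\<in>space M. \<not> rings_in (\<lambda>j. X j \<omega>) s t}"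
    proof (intro finite_measure_eq_AE)
      show "AE \<omega> in M. (\<omega> \<in> (\<Union>j. B t j)) = (\<omega> \<in> {\<omega>\<in>space M. \<not> rings_in (\<lambda>j. X j \<omega>) s t})"
        using AE_waiting_pos AE_waiting_unbounded AE_space
        by eventually_elim (use not_rings_in_iff assms(1) that in \<open>auto simp: B_def\<close>)
    qed (use Bm in auto)
    finally show ?thesis .
  qed
  \<comment> \<open>The empty interval normalises the series.\<close>
  have "\<not> rings_in w s s" for w by (auto simp: rings_in_def)
  then have one: "(\<lambda>j. prob (B s j)) sums 1" using sums[of s] by (simp add: prob_space)
  have "(\<lambda>j. prob (B t j)) sums (exp (- (t - s)) * 1)"
    using sums_mult[OF one, of "exp (- (t - s))"] scale[OF assms(2)] by simp
  then show ?thesis using sums[OF assms(2)] sums_unique2 by fastforce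
qed

lemma prob_rings_in:
  assumes "0 \<le> s" "s \<le> t"
  shows "prob {\<omega>\<in>space M. rings_in (\<lambda>j. X j \<omega>) s t} = 1 - exp (- (t - s))"
  using prob_not_rings_in[OF assms] prob_compl[of "{\<omega>\<in>space M. rings_in (\<lambda>j. X j \<omega>) s t}"]
  by (simp add: set_diff_eq conj_commute cong: conj_cong)

text \<open>Serves the lower bounds outside the critical regime, where the first ring of a clock is
  counted so that the events of different blocks are disjoint.\<close>

lemma prob_first_ring:
  assumes "0 \<le> s" "s \<le> t"
  shows "prob {\<omega>\<in>space M. s < X 0 \<omega> \<and> X 0 \<omega> \<le> t} = exp (- s) - exp (- t)"
proof -
  have "{\<omega>\<in>space M. s < X 0 \<omega> \<and> X 0 \<omega> \<le> t} = {\<omega>\<in>space M. s < X 0 \<omega>} - {\<omega>\<in>space M. t < X 0 \<omega>}"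
    by auto
  then show ?thesis
    using assms exponential_gt[OF X, of s 0] exponential_gt[OF X, of t 0]
    by (simp add: finite_measure_Diff subset_iff)
qed

end

text \<open>Conditionally on the value of Y, the law of X has a density and gives this single point
  no mass.\<close>

lemma exponential_no_tie:
  assumes ind: "indep_var borel X borel Y"
    and X: "distributed M lborel X (exponential_density 1)"
  shows "AE \<omega> in M. X \<omega> \<noteq> Y \<omega>"
proof -
  have rv [measurable]: "Y \<in> borel_measurable M" "X \<in> borel_measurable M"
    using indep_var_rv1[OF ind] indep_var_rv2[OF ind] by auto
  interpret DX: prob_space "distr M borel X" by (rule prob_space_distr) simp
  interpret DY: prob_space "distr M borel Y" by (rule prob_space_distr) simp
  interpret D: pair_sigma_finite "distr M borel X" "distr M borel Y" ..
  let ?A = "{z. fst z = snd z} :: (real \<times> real) set"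
  have "Measurable.pred (borel \<Otimes>\<^sub>M borel) (\<lambda>z :: real \<times> real. fst z = snd z)" by measurable
  then have A: "?A \<in> sets (borel \<Otimes>\<^sub>M borel)" by (simp add: pred_def space_pair_measure)
  have "emeasure M {\<omega>\<in>space M. X \<omega> = Y \<omega>}
      = emeasure (distr M (borel \<Otimes>\<^sub>M borel) (\<lambda>\<omega>. (X \<omega>, Y \<omega>))) ?A"
    using A by (subst emeasure_distr) (auto intro!: arg_cong[where f="emeasure M"])
  also have "distr M (borel \<Otimes>\<^sub>M borel) (\<lambda>\<omega>. (X \<omega>, Y \<omega>)) = distr M borel X \<Otimes>\<^sub>M distr M borel Y"
    using ind by (simp add: indep_var_distribution_eq)
  also have "emeasure (distr M borel X \<Otimes>\<^sub>M distr M borel Y) ?A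
      = (\<integral>\<^sup>+y. emeasure (distr M borel X) ((\<lambda>x. (x, y)) -` ?A) \<partial>distr M borel Y)"
    using A by (intro D.emeasure_pair_measure_alt2) simp
  also have "\<dots> = (\<integral>\<^sup>+y. 0 \<partial>distr M borel Y)"
  proof (rule nn_integral_cong)
    fix y :: real
    have "emeasure (distr M borel X) ((\<lambda>x. (x, y)) -` ?A) = emeasure (distr M lborel X) {y}"
      by (subst (1 2) emeasure_distr) (auto intro!: arg_cong[where f="emeasure M"])
    also have "distr M lborel X = density lborel (exponential_density 1)"
      using distributed_distr_eq_density[OF X] by simp
    also have "emeasure \<dots> {y} = 0"
      by (subst emeasure_density) (auto simp: nn_integral_cmult_indicator intro!: nn_integral_null_set)
    finally show "emeasure (distr M borel X) ((\<lambda>x. (x, y)) -` ?A) = 0" .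
  qed
  finally show ?thesis by (subst AE_iff_measurable[OF _ refl]) auto
qed

end

section \<open>The random input at a single node\<close>

definition edge_count :: "(nat \<Rightarrow> bool) \<Rightarrow> nat \<Rightarrow> real" where
  "edge_count e N = (\<Sum>i=1..N. of_bool (e i))"

lemma of_int_edges: "real_of_int (edges e N) = edge_count e N"
  by (simp add: edges_def edge_count_def)

lemma edge_count_mono: "N \<le> N' \<Longrightarrow> edge_count e N \<le> edge_count e N'"
  unfolding edge_count_def by (intro sum_mono2) auto

lemma edge_count_nonneg: "edge_count e N \<ge> 0"
  unfolding edge_count_def by (intro sum_nonneg) auto

lemma edge_count_eq_card: "edge_count e N = real (card {i\<in>{1..N}. e i})"
  by (simp add: edge_count_def Int_def)

lemma card_edges_le: "card {i\<in>{1..N}. e i} \<le> N"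
  by (rule order_trans[OF card_mono[of "{1..N}"]]) auto


definition bin_pmf :: "nat \<Rightarrow> real \<Rightarrow> nat \<Rightarrow> real" where
  "bin_pmf N p k = real (N choose k) * p ^ k * (1 - p) ^ (N - k)"

definition bin_tail :: "nat \<Rightarrow> real \<Rightarrow> nat \<Rightarrow> real" where
  "bin_tail N p k = (\<Sum>i=k..N. bin_pmf N p i)"

text \<open>The probability that a Bin(N,p) variable exceeds an independent Bin(N',p) variable by at
  least r. Since i starts at r, the natural subtraction \<open>i - r\<close> is exact.\<close>

definition bin_diff :: "nat \<Rightarrow> nat \<Rightarrow> real \<Rightarrow> nat \<Rightarrow> real" where
  "bin_diff N N' p r = (\<Sum>i=r..N. bin_pmf N p i * (\<Sum>j=0..i - r. bin_pmf N' p j))"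

lemma bin_pmf_Suc:
  "bin_pmf (Suc N) p (Suc k) = p * bin_pmf N p k + (1 - p) * bin_pmf N p (Suc k)"
proof (cases "Suc k \<le> N")
  case True
  then have "N - k = Suc (N - Suc k)" by simp
  then show ?thesis by (simp add: bin_pmf_def algebra_simps)
next
  case False
  then show ?thesis by (simp add: bin_pmf_def algebra_simps)
qed

lemma (in prob_space) indep_vars_group:
  assumes "indep_vars (\<lambda>_. borel) R I" "\<And>j. j \<in> J \<Longrightarrow> K j \<subseteq> I" "disjoint_family_on K J"
    and "\<And>j. j \<in> J \<Longrightarrow> g j \<in> borel_measurable (PiM (K j) (\<lambda>_. borel))"
  shows "indep_vars (\<lambda>_. borel) (\<lambda>j \<omega>. g j (restrict (\<lambda>i. R i \<omega>) (K j))) J"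
  using indep_vars_compose2[OF indep_vars_restrict[OF assms(1-3)], of g "\<lambda>_. borel"] assms(4)
  by simp

text \<open>Measurability of a condition on all degrees and waiting times of one node. Degrees are
  indexed by pairs of a colour and a number of nodes, so that they form one random element of a
  product space.\<close>

definition node_pred :: "((color \<Rightarrow> nat \<Rightarrow> real) \<Rightarrow> (nat \<Rightarrow> real) \<Rightarrow> bool) \<Rightarrow> bool" where
  "node_pred \<Phi> \<longleftrightarrow> Measurable.pred
     (PiM (UNIV :: (color \<times> nat) set) (\<lambda>_. borel) \<Otimes>\<^sub>M PiM (UNIV :: nat set) (\<lambda>_. borel))
     (\<lambda>z. \<Phi> (\<lambda>S N. fst z (S, N)) (snd z))"

abbreviation edge_pred :: "((nat \<Rightarrow> real) \<Rightarrow> bool) \<Rightarrow> bool" where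
  "edge_pred F \<equiv> Measurable.pred (PiM (UNIV :: nat set) (\<lambda>_. borel)) F"

lemma edge_pred_ring [measurable]: "edge_pred (\<lambda>w. rings_in w s t)"
  unfolding rings_in_def by measurable

lemma of_bool_eq_one_measurable:
  "f \<in> borel_measurable N \<Longrightarrow> (\<lambda>x. of_bool (f x = (1::real)) :: real) \<in> borel_measurable N"
  using measurable_compose[of f N borel "indicator {1} :: real \<Rightarrow> real" borel]
  by (simp add: indicator_def[abs_def])

section \<open>Independence and degree distributions at one node\<close>

locale inputs = prob_space M for M :: "'w measure" +
  fixes p :: "nat \<Rightarrow> real" and W :: "nat \<Rightarrow> nat" and X :: "nat \<Rightarrow> nat \<Rightarrow> nat \<Rightarrow> 'w \<Rightarrow> real"
    and E :: "nat \<Rightarrow> color \<Rightarrow> nat \<Rightarrow> nat \<Rightarrow> 'w \<Rightarrow> bool" and L :: "nat \<Rightarrow> nat \<Rightarrow> 'w \<Rightarrow> real"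
  assumes input: "random_input M p W X E L"
begin

lemma ind_sources: "indep_vars (\<lambda>_. borel) (source_var X E L) (sources W)"
  using input by (simp add: random_input_def)

lemma wait_distr: "v < W n \<Longrightarrow> distributed M lborel (X n v j) (exponential_density 1)"
  using input by (simp add: random_input_def)

lemma edge_measurable:
  assumes "v < W n" "1 \<le> i"
  shows "E n S v i \<in> M \<rightarrow>\<^sub>M count_space UNIV"
  using input assms by (simp add: random_input_def)

lemma edge_prob:
  assumes v: "v < W n" "1 \<le> i" and p: "0 \<le> p n" "p n \<le> 1"
  shows "prob {\<omega>\<in>space M. E n S v i \<omega>} = p n"
proof -
  note [measurable] = edge_measurable[OF v]
  have "prob {\<omega>\<in>space M. E n S v i \<omega>} = measure (distr M (count_space UNIV) (E n S v i)) {True}"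
    by (subst measure_distr) (auto intro!: arg_cong[where f=prob])
  also have "distr M (count_space UNIV) (E n S v i) = measure_pmf (bernoulli_pmf (p n))"
    using input v by (simp add: random_input_def)
  also have "measure \<dots> {True} = p n"
    using p by (simp add: measure_pmf_single)
  finally show ?thesis .
qed

definition deg_at :: "nat \<Rightarrow> nat \<Rightarrow> 'w \<Rightarrow> color \<Rightarrow> nat \<Rightarrow> real" where
  "deg_at n v \<omega> S N = edge_count (\<lambda>i. E n S v i \<omega>) N"

text \<open>Three blocks of sources per node: \<open>None\<close> stands for its clock,
  \<open>Some S\<close> for its edges to colour \<open>S\<close>. Blocks with different labels are
  disjoint, which yields independence between nodes and inside a node.\<close>

definition part :: "nat \<Rightarrow> nat \<Rightarrow> color option \<Rightarrow> source set" where
  "part n v c = (case c of None \<Rightarrow> range (Wait n v) | Some S \<Rightarrow> Edge n S v ` {1..})"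

lemma part_sources: "v < W n \<Longrightarrow> part n v c \<subseteq> sources W"
  by (auto simp: part_def sources_def split: option.split)

lemma part_disjoint: "(v, c) \<noteq> (v', c') \<Longrightarrow> part n v c \<inter> part n v' c' = {}"
  by (auto simp: part_def split: option.splits)

text \<open>Each event is a function of the sources of its own node, and different nodes own
  disjoint sets of sources.\<close>

lemma node_events_indep:
  assumes \<Phi>: "node_pred \<Phi>"
  shows "indep_vars (\<lambda>_. borel) (\<lambda>v \<omega>. of_bool (\<Phi> (deg_at n v \<omega>) (\<lambda>j. X n v j \<omega>)) :: real) {..<W n}"
proof -
  let ?K = "\<lambda>v. \<Union>c. part n v c"
  \<comment> \<open>Reconstructs the degrees and waiting times from raw sources; edges arrive as
    reals 0 or 1 and are read off by comparison with 1.\<close>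
  define dec where "dec v x = ((\<lambda>(S, N). \<Sum>i=1..N. of_bool (x (Edge n S v i) = (1::real))) :: color \<times> nat \<Rightarrow> real,
      \<lambda>j. x (Wait n v j) :: real)" for v x
  define g where "g v x = (of_bool (\<Phi> (\<lambda>S N. fst (dec v x) (S, N)) (snd (dec v x))) :: real)" for v x
  have mem: "Edge n S v i \<in> ?K v" if "1 \<le> i" for S v i
    using that by (intro UN_I[of "Some S"]) (auto simp: part_def)
  have memW: "Wait n v j \<in> ?K v" for v j
    by (intro UN_I[of None]) (auto simp: part_def)
  have [measurable]: "(\<lambda>x. x (Wait n v j)) \<in> borel_measurable (PiM (?K v) (\<lambda>_. borel :: real measure))"
    for v j by (intro measurable_component_singleton memW)
  have g: "g v \<in> borel_measurable (PiM (?K v) (\<lambda>_. borel))" for v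
  proof -
    have "dec v \<in> PiM (?K v) (\<lambda>_. borel) \<rightarrow>\<^sub>M
        PiM (UNIV :: (color \<times> nat) set) (\<lambda>_. borel) \<Otimes>\<^sub>M PiM (UNIV :: nat set) (\<lambda>_. borel)"
      unfolding dec_def
    proof (intro measurable_Pair measurable_abs_UNIV)
      fix z :: "color \<times> nat"
      obtain S N where z: "z = (S, N)" by (cases z)
      show "(\<lambda>x. (case z of (S, N) \<Rightarrow> \<Sum>i = 1..N. of_bool (x (Edge n S v i) = (1::real))) :: real)
          \<in> borel_measurable (PiM (?K v) (\<lambda>_. borel))"
        unfolding z prod.case
      proof (rule borel_measurable_sum)
        fix i assume "i \<in> {1..N}"
        then have "(\<lambda>x. x (Edge n S v i)) \<in> borel_measurable (PiM (?K v) (\<lambda>_. borel :: real measure))"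
          by (intro measurable_component_singleton mem) auto
        then show "(\<lambda>x. of_bool (x (Edge n S v i) = (1::real)) :: real) \<in> borel_measurable (PiM (?K v) (\<lambda>_. borel))"
          by (rule of_bool_eq_one_measurable)
      qed
    qed measurable
    then have "Measurable.pred (PiM (?K v) (\<lambda>_. borel)) (\<lambda>x. \<Phi> (\<lambda>S N. fst (dec v x) (S, N)) (snd (dec v x)))"
      using \<Phi> unfolding node_pred_def by (rule measurable_compose)
    then show ?thesis unfolding g_def by measurable
  qed
  have ind: "indep_vars (\<lambda>_. borel) (\<lambda>v \<omega>. g v (restrict (\<lambda>i. source_var X E L i \<omega>) (?K v))) {..<W n}"
  proof (rule indep_vars_group[OF ind_sources])
    show "disjoint_family_on ?K {..<W n}"
      unfolding disjoint_family_on_def using part_disjoint[of _ _ _ _ n] by blast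
  qed (use part_sources g in auto)
  have eq: "g v (restrict (\<lambda>i. source_var X E L i \<omega>) (?K v))
      = of_bool (\<Phi> (deg_at n v \<omega>) (\<lambda>j. X n v j \<omega>))" for v \<omega>
  proof -
    have "fst (dec v (restrict (\<lambda>i. source_var X E L i \<omega>) (?K v))) (S, N) = deg_at n v \<omega> S N" for S N
      unfolding dec_def deg_at_def edge_count_def fst_conv prod.case
    proof (intro sum.cong refl)
      fix i assume "i \<in> {1..N}"
      then have "restrict (\<lambda>i. source_var X E L i \<omega>) (?K v) (Edge n S v i) = of_bool (E n S v i \<omega>)"
        by (subst restrict_apply'[OF mem]) auto
      then show "of_bool (restrict (\<lambda>i. source_var X E L i \<omega>) (?K v) (Edge n S v i) = (1::real))
          = (of_bool (E n S v i \<omega>) :: real)" by (simp only:) simp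
    qed
    moreover have "snd (dec v (restrict (\<lambda>i. source_var X E L i \<omega>) (?K v))) = (\<lambda>j. X n v j \<omega>)"
      unfolding dec_def snd_conv restrict_apply'[OF memW] by simp
    ultimately show ?thesis by (simp add: g_def)
  qed
  show ?thesis using ind unfolding eq .
qed

lemma node_pred_sets:
  assumes "node_pred \<Phi>" "v < W n"
  shows "{\<omega>\<in>space M. \<Phi> (deg_at n v \<omega>) (\<lambda>j. X n v j \<omega>)} \<in> sets M"
proof -
  have "(\<lambda>\<omega>. of_bool (\<Phi> (deg_at n v \<omega>) (\<lambda>j. X n v j \<omega>)) :: real) \<in> borel_measurable M"
    using node_events_indep[OF assms(1), of n] assms(2) by (auto simp: indep_vars_def)
  from measurable_sets[OF this, of "{1}"] show ?thesis
    by (simp add: vimage_def Int_def conj_commute)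
qed

text \<open>The edges to the two colours and the clock of a node use three disjoint blocks of
  sources.\<close>

lemma node_prob_prod:
  assumes v: "v < W n" and F: "\<And>S. edge_pred (F S)" and G: "edge_pred G"
  shows "prob {\<omega>\<in>space M. F S (deg_at n v \<omega> S) \<and> F (other S) (deg_at n v \<omega> (other S)) \<and> G (\<lambda>j. X n v j \<omega>)}
    = prob {\<omega>\<in>space M. F S (deg_at n v \<omega> S)} * prob {\<omega>\<in>space M. F (other S) (deg_at n v \<omega> (other S))}
      * prob {\<omega>\<in>space M. G (\<lambda>j. X n v j \<omega>)}"
proof -
  define ev where "ev c \<omega> = (case c of None \<Rightarrow> G (\<lambda>j. X n v j \<omega>) | Some S \<Rightarrow> F S (deg_at n v \<omega> S))"
    for c \<omega>
  define g where "g c x = (of_bool (case c of None \<Rightarrow> G (\<lambda>j. x (Wait n v j))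
      | Some S \<Rightarrow> F S (\<lambda>N. \<Sum>i=1..N. of_bool (x (Edge n S v i) = (1::real)))) :: real)" for c x
  have [measurable]: "(\<lambda>x. x (Wait n v j)) \<in> borel_measurable (PiM (part n v None) (\<lambda>_. borel :: real measure))"
    for j by (intro measurable_component_singleton) (auto simp: part_def)
  have g: "g c \<in> borel_measurable (PiM (part n v c) (\<lambda>_. borel))" for c
  proof (cases c)
    case None
    have "Measurable.pred (PiM (part n v None) (\<lambda>_. borel)) (\<lambda>x. G (\<lambda>j. x (Wait n v j)))"
      by (rule measurable_compose[OF _ G]) (rule measurable_abs_UNIV, measurable)
    then show ?thesis unfolding None g_def option.case by measurable
  next
    case (Some S)
    have "Measurable.pred (PiM (part n v (Some S)) (\<lambda>_. borel))
        (\<lambda>x. F S (\<lambda>N. \<Sum>i=1..N. of_bool (x (Edge n S v i) = (1::real))))"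
    proof (rule measurable_compose[OF _ F], rule measurable_abs_UNIV, rule borel_measurable_sum)
      fix N i :: nat assume "i \<in> {1..N}"
      then have "(\<lambda>x. x (Edge n S v i)) \<in> borel_measurable (PiM (part n v (Some S)) (\<lambda>_. borel :: real measure))"
        by (intro measurable_component_singleton) (auto simp: part_def)
      then show "(\<lambda>x. of_bool (x (Edge n S v i) = (1::real)) :: real) \<in> borel_measurable (PiM (part n v (Some S)) (\<lambda>_. borel))"
        by (rule of_bool_eq_one_measurable)
    qed
    then show ?thesis unfolding Some g_def option.case by measurable
  qed
  have ind: "indep_vars (\<lambda>_. borel) (\<lambda>c \<omega>. g c (restrict (\<lambda>i. source_var X E L i \<omega>) (part n v c))) UNIV"
  proof (rule indep_vars_group[OF ind_sources])
    show "disjoint_family_on (part n v) UNIV"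
      unfolding disjoint_family_on_def using part_disjoint[of v _ v _ n] by blast
  qed (use part_sources[OF v] g in auto)
  have eq: "g c (restrict (\<lambda>i. source_var X E L i \<omega>) (part n v c)) = of_bool (ev c \<omega>)" for c \<omega>
  proof (cases c)
    case None
    then show ?thesis by (simp add: g_def ev_def part_def)
  next
    case (Some S)
    have "(\<lambda>N. \<Sum>i=1..N. of_bool (restrict (\<lambda>i. source_var X E L i \<omega>) (part n v c) (Edge n S v i) = (1::real)))
        = (deg_at n v \<omega> S :: nat \<Rightarrow> real)"
      unfolding deg_at_def edge_count_def Some
      by (intro ext sum.cong refl) (simp add: part_def)
    then show ?thesis using Some by (simp only: g_def ev_def option.case)
  qed
  have ind: "indep_vars (\<lambda>_. borel) (\<lambda>c \<omega>. of_bool (ev c \<omega>) :: real) UNIV"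
    using ind unfolding eq .
  have "prob (\<Inter>c\<in>{Some S, Some (other S), None}. (\<lambda>\<omega>. of_bool (ev c \<omega>) :: real) -` {1} \<inter> space M)
      = (\<Prod>c\<in>{Some S, Some (other S), None}. prob ((\<lambda>\<omega>. of_bool (ev c \<omega>) :: real) -` {1} \<inter> space M))"
    by (rule indep_varsD[OF ind]) auto
  moreover have "(\<lambda>\<omega>. of_bool (ev c \<omega>) :: real) -` {1} \<inter> space M = {\<omega>\<in>space M. ev c \<omega>}" for c by auto
  ultimately have "prob (\<Inter>c\<in>{Some S, Some (other S), None}. {\<omega>\<in>space M. ev c \<omega>})
      = (\<Prod>c\<in>{Some S, Some (other S), None}. prob {\<omega>\<in>space M. ev c \<omega>})"
    by simp
  moreover have "(\<Inter>c\<in>{Some S, Some (other S), None}. {\<omega>\<in>space M. ev c \<omega>})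
      = {\<omega>\<in>space M. F S (deg_at n v \<omega> S) \<and> F (other S) (deg_at n v \<omega> (other S)) \<and> G (\<lambda>j. X n v j \<omega>)}"
    by (auto simp: ev_def)
  ultimately show ?thesis by (simp add: ev_def)
qed

lemma wait_indep:
  assumes v: "v < W n"
  shows "indep_vars (\<lambda>_. borel) (X n v) UNIV"
proof -
  have "indep_vars (\<lambda>_. borel) (\<lambda>j \<omega>. (\<lambda>x. x (Wait n v j)) (restrict (\<lambda>i. source_var X E L i \<omega>) {Wait n v j})) UNIV"
    by (rule indep_vars_group[OF ind_sources])
      (use v in \<open>auto simp: sources_def disjoint_family_on_def intro!: measurable_component_singleton\<close>)
  then show ?thesis by simp
qed

lemma deg_at_measurable:
  assumes v: "v < W n"
  shows "(\<lambda>\<omega>. deg_at n v \<omega> S N) \<in> borel_measurable M"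
proof -
  have [measurable]: "Measurable.pred M (E n S v i)" if "i \<in> {1..N}" for i
    using edge_measurable[OF v] that by auto
  show ?thesis unfolding deg_at_def edge_count_def by measurable
qed

text \<open>Adding one independent edge reproduces the recursion \<open>bin_pmf_Suc\<close>.\<close>

lemma deg_at_pmf:
  assumes v: "v < W n" and p: "0 \<le> p n" "p n \<le> 1"
  shows "prob {\<omega>\<in>space M. deg_at n v \<omega> S N = real k} = bin_pmf N (p n) k"
proof (induction N arbitrary: k)
  case 0
  then show ?case by (cases k) (auto simp: deg_at_def edge_count_def bin_pmf_def prob_space)
next
  case (Suc N)
  note IH = Suc.IH
  let ?e = "\<lambda>\<omega>. of_bool (E n S v (Suc N) \<omega>) :: real"
  note [measurable] = deg_at_measurable[OF v]
  have [measurable]: "Measurable.pred M (E n S v (Suc N))"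
    using edge_measurable[OF v] by simp
  have "indep_vars (\<lambda>_. borel) (\<lambda>i \<omega>. (\<lambda>x. x (Edge n S v i)) (restrict (\<lambda>i. source_var X E L i \<omega>) {Edge n S v i}))
      (insert (Suc N) {1..N})"
    by (rule indep_vars_group[OF ind_sources])
      (use v in \<open>auto simp: sources_def disjoint_family_on_def intro!: measurable_component_singleton\<close>)
  then have "indep_vars (\<lambda>_. borel) (\<lambda>i \<omega>. of_bool (E n S v i \<omega>) :: real) (insert (Suc N) {1..N})"
    by simp
  then have ind: "indep_var borel ?e borel (\<lambda>\<omega>. deg_at n v \<omega> S N)"
    unfolding deg_at_def edge_count_def by (intro indep_vars_sum) auto
  have Suc_deg: "deg_at n v \<omega> S (Suc N) = deg_at n v \<omega> S N + ?e \<omega>" for \<omega>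
    by (simp add: deg_at_def edge_count_def)
  have e1: "prob {\<omega>\<in>space M. ?e \<omega> \<in> {1}} = p n" using edge_prob[OF v _ p, of "Suc N" S] by simp
  have e0: "prob {\<omega>\<in>space M. ?e \<omega> \<in> {0}} = 1 - p n"
    using edge_prob[OF v _ p, of "Suc N" S] prob_compl[of "{\<omega>\<in>space M. E n S v (Suc N) \<omega>}"]
    by (simp add: set_diff_eq cong: conj_cong)
  have i1: "prob {\<omega>\<in>space M. ?e \<omega> \<in> {1} \<and> deg_at n v \<omega> S N \<in> {x}} = p n * prob {\<omega>\<in>space M. deg_at n v \<omega> S N = x}" for x
    using prob_indep_random_variable[OF ind, of "{1}" "{x}"] e1 by simp
  have i0: "prob {\<omega>\<in>space M. ?e \<omega> \<in> {0} \<and> deg_at n v \<omega> S N \<in> {x}} = (1 - p n) * prob {\<omega>\<in>space M. deg_at n v \<omega> S N = x}" for x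
    using prob_indep_random_variable[OF ind, of "{0}" "{x}"] e0 by simp
  show ?case
  proof (cases k)
    case 0
    have "{\<omega>\<in>space M. deg_at n v \<omega> S (Suc N) = real k} = {\<omega>\<in>space M. ?e \<omega> \<in> {0} \<and> deg_at n v \<omega> S N \<in> {0}}"
      unfolding Suc_deg 0 using edge_count_nonneg by (auto simp: deg_at_def)
        (smt (verit) edge_count_nonneg)+
    then show ?thesis using i0[of 0] IH[of 0] by (simp add: 0 bin_pmf_def)
  next
    case k: (Suc k')
    have split: "{\<omega>\<in>space M. deg_at n v \<omega> S (Suc N) = real k}
      = {\<omega>\<in>space M. ?e \<omega> \<in> {1} \<and> deg_at n v \<omega> S N \<in> {real k'}} \<union> {\<omega>\<in>space M. ?e \<omega> \<in> {0} \<and> deg_at n v \<omega> S N \<in> {real k}}"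
      unfolding Suc_deg k by auto
    have "prob {\<omega>\<in>space M. deg_at n v \<omega> S (Suc N) = real k} = prob {\<omega>\<in>space M. ?e \<omega> \<in> {1} \<and> deg_at n v \<omega> S N \<in> {real k'}}
        + prob {\<omega>\<in>space M. ?e \<omega> \<in> {0} \<and> deg_at n v \<omega> S N \<in> {real k}}"
      unfolding split
    proof (rule finite_measure_Union)
      show "{\<omega>\<in>space M. ?e \<omega> \<in> {1} \<and> deg_at n v \<omega> S N \<in> {real k'}} \<in> sets M"
        unfolding singleton_iff by measurable
      show "{\<omega>\<in>space M. ?e \<omega> \<in> {0} \<and> deg_at n v \<omega> S N \<in> {real k}} \<in> sets M"
        unfolding singleton_iff by measurable
      show "{\<omega>\<in>space M. ?e \<omega> \<in> {1} \<and> deg_at n v \<omega> S N \<in> {real k'}}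
          \<inter> {\<omega>\<in>space M. ?e \<omega> \<in> {0} \<and> deg_at n v \<omega> S N \<in> {real k}} = {}"
        by (rule equals0I) (simp only: Int_iff mem_Collect_eq singleton_iff, metis zero_neq_one)
    qed
    then have "prob {\<omega>\<in>space M. deg_at n v \<omega> S (Suc N) = real k}
        = p n * bin_pmf N (p n) k' + (1 - p n) * bin_pmf N (p n) k"
      unfolding i1 i0 IH .
    then show ?thesis unfolding k bin_pmf_Suc .
  qed
qed

lemma deg_at_cases: "\<exists>i\<le>N. deg_at n v \<omega> S N = real i"
  unfolding deg_at_def edge_count_eq_card by (rule exI, rule conjI[OF card_edges_le refl])

lemma deg_at_nonneg: "0 \<le> deg_at n v \<omega> S N"
  unfolding deg_at_def by (rule edge_count_nonneg)

lemma prob_split_deg: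
  assumes v: "v < W n" and A: "{\<omega>\<in>space M. A \<omega>} \<in> sets M"
  shows "prob {\<omega>\<in>space M. A \<omega>} = (\<Sum>i\<le>N. prob {\<omega>\<in>space M. deg_at n v \<omega> S N = real i \<and> A \<omega>})"
proof -
  note [measurable] = deg_at_measurable[OF v] 
  have [measurable]: "Measurable.pred M A" using A by (simp add: pred_def)
  have "prob {\<omega>\<in>space M. A \<omega>} = prob (\<Union>i\<in>{..N}. {\<omega>\<in>space M. deg_at n v \<omega> S N = real i \<and> A \<omega>})"
    using deg_at_cases[of N n v _ S] by (intro arg_cong[where f=prob]) (auto simp: Bex_def)
  also have "\<dots> = (\<Sum>i\<in>{..N}. prob {\<omega>\<in>space M. deg_at n v \<omega> S N = real i \<and> A \<omega>})"
    by (rule finite_measure_finite_Union) (auto simp: disjoint_family_on_def)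
  finally show ?thesis .
qed

lemma deg_at_tail:
  assumes v: "v < W n" and p: "0 \<le> p n" "p n \<le> 1"
  shows "prob {\<omega>\<in>space M. deg_at n v \<omega> S N \<ge> real k} = bin_tail N (p n) k"
proof -
  note [measurable] = deg_at_measurable[OF v]
  have "prob {\<omega>\<in>space M. deg_at n v \<omega> S N \<ge> real k}
      = (\<Sum>i\<le>N. prob {\<omega>\<in>space M. deg_at n v \<omega> S N = real i \<and> deg_at n v \<omega> S N \<ge> real k})"
    by (rule prob_split_deg[OF v]) measurable
  also have "\<dots> = (\<Sum>i\<le>N. if k \<le> i then bin_pmf N (p n) i else 0)"
  proof (intro sum.cong refl)
    fix i
    have "{\<omega>\<in>space M. deg_at n v \<omega> S N = real i \<and> deg_at n v \<omega> S N \<ge> real k}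
        = (if k \<le> i then {\<omega>\<in>space M. deg_at n v \<omega> S N = real i} else {})" by auto
    then show "prob {\<omega>\<in>space M. deg_at n v \<omega> S N = real i \<and> deg_at n v \<omega> S N \<ge> real k}
        = (if k \<le> i then bin_pmf N (p n) i else 0)"
      using deg_at_pmf[OF v p] by simp
  qed
  also have "\<dots> = bin_tail N (p n) k"
    unfolding bin_tail_def by (rule sum.mono_neutral_cong_right) auto
  finally show ?thesis .
qed

lemma deg_at_le:
  assumes v: "v < W n" and p: "0 \<le> p n" "p n \<le> 1"
  shows "prob {\<omega>\<in>space M. deg_at n v \<omega> S N \<le> real k} = (\<Sum>j=0..k. bin_pmf N (p n) j)"
proof -
  note [measurable] = deg_at_measurable[OF v]
  have "{\<omega>\<in>space M. deg_at n v \<omega> S N \<le> real k} = (\<Union>j\<in>{0..k}. {\<omega>\<in>space M. deg_at n v \<omega> S N = real j})"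
    using deg_at_cases[of N n v _ S] by force
  then have "prob {\<omega>\<in>space M. deg_at n v \<omega> S N \<le> real k}
      = prob (\<Union>j\<in>{0..k}. {\<omega>\<in>space M. deg_at n v \<omega> S N = real j})" by simp
  also have "\<dots> = (\<Sum>j\<in>{0..k}. prob {\<omega>\<in>space M. deg_at n v \<omega> S N = real j})"
    by (rule finite_measure_finite_Union) (auto simp: disjoint_family_on_def)
  finally show ?thesis using deg_at_pmf[OF v p] by simp
qed

text \<open>Once the degree towards \<open>S\<close> is fixed to i, the condition on the difference
  becomes a bound on the other degree, so everything factors by independence, including the clock
  event G.\<close>

lemma deg_at_diff:
  assumes v: "v < W n" and p: "0 \<le> p n" "p n \<le> 1" and G: "edge_pred G"
  shows "prob {\<omega>\<in>space M. deg_at n v \<omega> S N - deg_at n v \<omega> (other S) N' \<ge> real r \<and> G (\<lambda>j. X n v j \<omega>)}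
    = bin_diff N N' (p n) r * prob {\<omega>\<in>space M. G (\<lambda>j. X n v j \<omega>)}"
proof -
  note [measurable] = deg_at_measurable[OF v]
  have [measurable]: "(\<lambda>\<omega> j. X n v j \<omega>) \<in> M \<rightarrow>\<^sub>M PiM UNIV (\<lambda>_. borel)"
    using distributed_measurable[OF wait_distr[OF v]] by (intro measurable_abs_UNIV) simp
  have [measurable]: "Measurable.pred M (\<lambda>\<omega>. G (\<lambda>j. X n v j \<omega>))"
    by (rule measurable_compose[OF _ G]) measurable
  let ?A = "\<lambda>\<omega>. deg_at n v \<omega> S N - deg_at n v \<omega> (other S) N' \<ge> real r \<and> G (\<lambda>j. X n v j \<omega>)"
  have "prob {\<omega>\<in>space M. ?A \<omega>} = (\<Sum>i\<le>N. prob {\<omega>\<in>space M. deg_at n v \<omega> S N = real i \<and> ?A \<omega>})"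
    by (rule prob_split_deg[OF v]) measurable
  also have "\<dots> = (\<Sum>i\<le>N. if r \<le> i then bin_pmf N (p n) i * (\<Sum>j=0..i - r. bin_pmf N' (p n) j)
      * prob {\<omega>\<in>space M. G (\<lambda>j. X n v j \<omega>)} else 0)"
  proof (intro sum.cong refl)
    fix i
    show "prob {\<omega>\<in>space M. deg_at n v \<omega> S N = real i \<and> ?A \<omega>}
      = (if r \<le> i then bin_pmf N (p n) i * (\<Sum>j=0..i - r. bin_pmf N' (p n) j)
          * prob {\<omega>\<in>space M. G (\<lambda>j. X n v j \<omega>)} else 0)"
    proof (cases "r \<le> i")
      case True
      define F where "F S' d = (if S' = S then d N = real i else d N' \<le> real (i - r))" for S' and d :: "nat \<Rightarrow> real"
      have F: "edge_pred (F S')" for S' unfolding F_def by (cases "S' = S"; simp; measurable)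
      have "{\<omega>\<in>space M. deg_at n v \<omega> S N = real i \<and> ?A \<omega>}
        = {\<omega>\<in>space M. F S (deg_at n v \<omega> S) \<and> F (other S) (deg_at n v \<omega> (other S)) \<and> G (\<lambda>j. X n v j \<omega>)}"
        using True by (auto simp: F_def of_nat_diff)
      then show ?thesis
        using node_prob_prod[where F=F and S=S, OF v F G] deg_at_pmf[OF v p]
          deg_at_le[OF v p, where S="other S" and N=N' and k="i - r"] True by (simp add: F_def of_nat_diff)
    next
      case False
      then have "{\<omega>\<in>space M. deg_at n v \<omega> S N = real i \<and> ?A \<omega>} = {}"
        using deg_at_nonneg[of n v _ "other S" N'] by (auto simp: not_le) (smt (verit) of_nat_less_iff)
      then have "prob {\<omega>\<in>space M. deg_at n v \<omega> S N = real i \<and> ?A \<omega>} = 0"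
        by (simp only: measure_empty)
      then show ?thesis using False by (simp only: if_False)
    qed
  qed
  also have "\<dots> = bin_diff N N' (p n) r * prob {\<omega>\<in>space M. G (\<lambda>j. X n v j \<omega>)}"
    unfolding bin_diff_def sum_distrib_right by (rule sum.mono_neutral_cong_right) auto
  finally show ?thesis .
qed

lemma prob_deg_change:
  assumes v: "v < W n" and p: "0 \<le> p n" "p n \<le> 1"
  shows "prob {\<omega>\<in>space M. deg_at n v \<omega> S N \<noteq> deg_at n v \<omega> S N'} \<le> p n * \<bar>real N - real N'\<bar>"
proof -
  note [measurable] = deg_at_measurable[OF v]
  have *: "prob {\<omega>\<in>space M. deg_at n v \<omega> S N \<noteq> deg_at n v \<omega> S N'} \<le> p n * (real N' - real N)"
    if "N \<le> N'" for N N'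
  proof -
    have [measurable]: "Measurable.pred M (E n S v i)" if "i \<in> {N<..N'}" for i
      using edge_measurable[OF v] that by simp
    have ne: "{\<omega>\<in>space M. deg_at n v \<omega> S N \<noteq> deg_at n v \<omega> S N'} \<subseteq> (\<Union>i\<in>{N<..N'}. {\<omega>\<in>space M. E n S v i \<omega>})"
    proof
      fix \<omega> assume a: "\<omega> \<in> {\<omega>\<in>space M. deg_at n v \<omega> S N \<noteq> deg_at n v \<omega> S N'}"
      show "\<omega> \<in> (\<Union>i\<in>{N<..N'}. {\<omega>\<in>space M. E n S v i \<omega>})"
      proof (rule ccontr)
        assume b: "\<not> ?thesis"
        have "deg_at n v \<omega> S N = deg_at n v \<omega> S N'"
          unfolding deg_at_def edge_count_def
          by (rule sum.mono_neutral_left) (use that a b in auto)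
        then show False using a by simp
      qed
    qed
    have "prob {\<omega>\<in>space M. deg_at n v \<omega> S N \<noteq> deg_at n v \<omega> S N'} \<le> prob (\<Union>i\<in>{N<..N'}. {\<omega>\<in>space M. E n S v i \<omega>})"
      by (rule finite_measure_mono[OF ne]) (auto intro!: sets.finite_UN)
    also have "\<dots> \<le> (\<Sum>i\<in>{N<..N'}. prob {\<omega>\<in>space M. E n S v i \<omega>})"
      by (rule finite_measure_subadditive_finite) auto
    also have "\<dots> = p n * (real N' - real N)"
      using that by (simp add: edge_prob[OF v _ p] of_nat_diff)
    finally show ?thesis .
  qed
  have sym: "{\<omega>\<in>space M. deg_at n v \<omega> S N \<noteq> deg_at n v \<omega> S N'} = {\<omega>\<in>space M. deg_at n v \<omega> S N' \<noteq> deg_at n v \<omega> S N}"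
    by auto
  show ?thesis
  proof (cases "N \<le> N'")
    case True then show ?thesis using *[of N N'] by simp
  next
    case False then show ?thesis using *[of N' N] by (simp add: sym)
  qed
qed

text \<open>A coupling: both values are probabilities of events at the same node, and these differ
  only if an edge is present among the nodes counted in one case but not in the other, at a cost of
  p per node. In the limit this yields Lipschitz rates for q = 1/p without differentiating the
  double series.\<close>

lemma bin_diff_lipschitz:
  assumes v: "0 < W n" and p: "0 \<le> p n" "p n \<le> 1"
  shows "\<bar>bin_diff N N' (p n) r - bin_diff K K' (p n) r\<bar>
    \<le> p n * (\<bar>real N - real K\<bar> + \<bar>real N' - real K'\<bar>)"
proof -
  note [measurable] = deg_at_measurable[OF v]
  let ?A = "\<lambda>N N'. {\<omega>\<in>space M. deg_at n 0 \<omega> Red N - deg_at n 0 \<omega> Black N' \<ge> real r}"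
  have eq: "prob (?A N N') = bin_diff N N' (p n) r" for N N'
    using deg_at_diff[OF v p, where G="\<lambda>_. True" and S=Red and N=N and N'=N' and r=r] by (simp add: prob_space)
  let ?C = "{\<omega>\<in>space M. deg_at n 0 \<omega> Red N \<noteq> deg_at n 0 \<omega> Red K}"
  let ?D = "{\<omega>\<in>space M. deg_at n 0 \<omega> Black N' \<noteq> deg_at n 0 \<omega> Black K'}"
  have CD: "prob (?C \<union> ?D) \<le> p n * (\<bar>real N - real K\<bar> + \<bar>real N' - real K'\<bar>)"
  proof -
    have "prob (?C \<union> ?D) \<le> prob ?C + prob ?D" by (rule measure_Un_le) measurable
    then show ?thesis using prob_deg_change[OF v p, where S=Red and N=N and N'=K]
        prob_deg_change[OF v p, where S=Black and N=N' and N'=K']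
      by (simp add: distrib_left)
  qed
  have "prob (?A N N') \<le> prob (?A K K' \<union> (?C \<union> ?D))"
    by (rule finite_measure_mono) auto
  also have "\<dots> \<le> prob (?A K K') + prob (?C \<union> ?D)" by (rule measure_Un_le) measurable
  finally have 1: "prob (?A N N') \<le> prob (?A K K') + prob (?C \<union> ?D)" .
  have "prob (?A K K') \<le> prob (?A N N' \<union> (?C \<union> ?D))"
    by (rule finite_measure_mono) auto
  also have "\<dots> \<le> prob (?A N N') + prob (?C \<union> ?D)" by (rule measure_Un_le) measurable
  finally have 2: "prob (?A K K') \<le> prob (?A N N') + prob (?C \<union> ?D)" .
  show ?thesis using 1 2 CD unfolding eq by linarith
qed

lemma AE_good_clocks:
  "AE \<omega> in M. \<forall>n. bootstrap.good_clocks (W n) (\<lambda>v j. X n v j \<omega>)"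
proof -
  have 1: "AE \<omega> in M. \<forall>j. 0 < X n v j \<omega>" if "v < W n" for n v
    by (rule AE_waiting_pos[OF wait_distr[OF that] wait_indep[OF that]])
  have 2: "AE \<omega> in M. \<forall>s. \<exists>j. s < (\<Sum>i<j. X n v i \<omega>)" if "v < W n" for n v
    by (rule AE_waiting_unbounded[OF wait_distr[OF that] wait_indep[OF that]])
  have 3: "AE \<omega> in M. (\<Sum>i\<le>j. X n v i \<omega>) \<noteq> (\<Sum>i\<le>k. X n w i \<omega>)"
    if v: "v < W n" "w < W n" "v \<noteq> w" for n v w j k
  proof -
    \<comment> \<open>The first waiting time of \<open>v\<close> is separated from everything else
      in the tie equation; it is independent of the rest and has a density.\<close>
    let ?B = "Wait n v ` {1..j} \<union> Wait n w ` {..k}"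
    have [measurable]: "(\<lambda>x. x s) \<in> borel_measurable (PiM ?B (\<lambda>_. borel :: real measure))" if "s \<in> ?B" for s
      using that by (rule measurable_component_singleton)
    have m1: "(\<lambda>x. (\<Sum>i\<le>k. x (Wait n w i)) - (\<Sum>i=1..j. x (Wait n v i)))
        \<in> borel_measurable (PiM ?B (\<lambda>_. borel :: real measure))"
      by (intro borel_measurable_diff borel_measurable_sum measurable_component_singleton) auto
    have "indep_var borel ((\<lambda>x. x (Wait n v 0)) \<circ> (\<lambda>\<omega>. restrict (\<lambda>i. source_var X E L i \<omega>) {Wait n v 0}))
        borel ((\<lambda>x. (\<Sum>i\<le>k. x (Wait n w i)) - (\<Sum>i=1..j. x (Wait n v i))) \<circ> (\<lambda>\<omega>. restrict (\<lambda>i. source_var X E L i \<omega>) ?B))"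
      by (rule indep_var_compose[OF indep_var_restrict[OF ind_sources] _ m1])
        (use v in \<open>auto simp: sources_def intro!: measurable_component_singleton\<close>)
    also have "(\<lambda>x. x (Wait n v 0)) \<circ> (\<lambda>\<omega>. restrict (\<lambda>i. source_var X E L i \<omega>) {Wait n v 0}) = X n v 0"
      by (simp add: fun_eq_iff)
    also have "(\<lambda>x. (\<Sum>i\<le>k. x (Wait n w i)) - (\<Sum>i=1..j. x (Wait n v i))) \<circ> (\<lambda>\<omega>. restrict (\<lambda>i. source_var X E L i \<omega>) ?B)
        = (\<lambda>\<omega>. (\<Sum>i\<le>k. X n w i \<omega>) - (\<Sum>i=1..j. X n v i \<omega>))"
      by (auto simp: fun_eq_iff)
    finally have "AE \<omega> in M. X n v 0 \<omega> \<noteq> (\<Sum>i\<le>k. X n w i \<omega>) - (\<Sum>i=1..j. X n v i \<omega>)"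
      by (rule exponential_no_tie[OF _ wait_distr[OF v(1)]])
    moreover have *: "(\<Sum>i\<le>j. X n v i \<omega>) = X n v 0 \<omega> + (\<Sum>i=1..j. X n v i \<omega>)" for \<omega>
      by (simp add: atMost_atLeast0 sum.atLeast_Suc_atMost)
    ultimately show ?thesis by (auto elim: eventually_mono)
  qed
  have "AE \<omega> in M. \<forall>n v w j k. v < W n \<longrightarrow> (\<forall>j. 0 < X n v j \<omega>) \<and> (\<forall>s. \<exists>j. s < (\<Sum>i<j. X n v i \<omega>)) \<and>
      (w < W n \<longrightarrow> v \<noteq> w \<longrightarrow> (\<Sum>i\<le>j. X n v i \<omega>) \<noteq> (\<Sum>i\<le>k. X n w i \<omega>))"
    unfolding AE_all_countable
  proof (intro allI)
    fix n v w j k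
    show "AE \<omega> in M. v < W n \<longrightarrow> (\<forall>j. 0 < X n v j \<omega>) \<and> (\<forall>s. \<exists>j. s < (\<Sum>i<j. X n v i \<omega>)) \<and>
      (w < W n \<longrightarrow> v \<noteq> w \<longrightarrow> (\<Sum>i\<le>j. X n v i \<omega>) \<noteq> (\<Sum>i\<le>k. X n w i \<omega>))"
    proof (cases "v < W n")
      case v: True
      show ?thesis
      proof (cases "w < W n \<and> v \<noteq> w")
        case True
        then show ?thesis using 1[OF v] 2[OF v] 3[OF v, of w j k] by (auto elim!: eventually_elim2)
      next
        case False
        then show ?thesis using 1[OF v] 2[OF v] by (auto elim!: eventually_elim2)
      qed
    qed simp
  qed
  then show ?thesis
  proof eventually_elim
    case (elim \<omega>)
    show ?case
    proof
      fix n
      have "\<exists>j. t < (\<Sum>i\<le>j. X n v i \<omega>)" if v: "v < W n" for v t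
      proof -
        obtain j where "t < (\<Sum>i<j. X n v i \<omega>)" using elim v by blast
        also have "\<dots> \<le> (\<Sum>i\<le>j. X n v i \<omega>)"
          using elim v by (intro sum_mono2) (auto intro: less_imp_le)
        finally show ?thesis by blast
      qed
      then show "bootstrap.good_clocks (W n) (\<lambda>v j. X n v j \<omega>)"
        unfolding bootstrap.good_clocks_def bootstrap.ring_time_def using elim by blast
    qed
  qed
qed

end

section \<open>Asymptotics of binomial probabilities\<close>

lemma bin_pmf_nonneg: "0 \<le> p \<Longrightarrow> p \<le> 1 \<Longrightarrow> 0 \<le> bin_pmf N p k"
  by (simp add: bin_pmf_def)

lemma bin_pmf_eq_0: "N < k \<Longrightarrow> bin_pmf N p k = 0"
  by (simp add: bin_pmf_def)

lemma bin_pmf_mgf: "(\<Sum>i\<le>N. bin_pmf N p i * z ^ i) = (p * z + (1 - p)) ^ N"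
  unfolding binomial_ring bin_pmf_def by (intro sum.cong refl) (simp add: power_mult_distrib)

lemma bin_pmf_sum: "(\<Sum>i\<le>N. bin_pmf N p i) = 1"
  using bin_pmf_mgf[of N p 1] by simp

lemma bin_pmf_sum_le:
  assumes "0 \<le> p" "p \<le> 1" "finite A"
  shows "(\<Sum>i\<in>A. bin_pmf N p i) \<le> 1"
proof -
  have "(\<Sum>i\<in>A. bin_pmf N p i) = (\<Sum>i\<in>A \<inter> {..N}. bin_pmf N p i)"
    using assms(3) by (intro sum.mono_neutral_right) (auto simp: bin_pmf_eq_0 not_le)
  also have "\<dots> \<le> (\<Sum>i\<le>N. bin_pmf N p i)"
    using assms by (intro sum_mono2) (auto simp: bin_pmf_nonneg)
  finally show ?thesis by (simp add: bin_pmf_sum)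
qed

lemma choose_prod: "real (N choose k) * p ^ k = (\<Prod>i<k. (real N - real i) * p) / fact k"
proof -
  have "real (N choose k) = (\<Prod>i<k. real N - real i) / fact k"
    unfolding binomial_gbinomial gbinomial_prod_rev by (simp add: atLeast0LessThan)
  then show ?thesis by (simp add: prod.distrib)
qed

lemma bin_pmf_le:
  assumes "0 \<le> p" "p \<le> 1"
  shows "bin_pmf N p k \<le> (real N * p) ^ k / fact k"
proof -
  have "real (N choose k) * fact k \<le> real N ^ k"
    using of_nat_mono[OF binomial_fact_pow[of N k], where 'a=real] by simp
  then have "real (N choose k) \<le> real N ^ k / fact k" by (simp add: field_simps)
  then have "real (N choose k) * p ^ k \<le> real N ^ k / fact k * p ^ k"
    using assms by (intro mult_right_mono) auto
  then have "real (N choose k) * p ^ k * (1 - p) ^ (N - k) \<le> real N ^ k / fact k * p ^ k * 1"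
    by (rule mult_mono) (use assms in \<open>auto intro: power_le_one\<close>)
  then show ?thesis by (simp add: bin_pmf_def power_mult_distrib)
qed

text \<open>A union bound over the r-subsets of trials. In binomial coefficients: (N choose i) is at
  most (N choose i)(i choose r) = (N choose r)(N-r choose i-r), and the remaining Bin(N-r,p)
  probabilities sum to 1.\<close>

lemma bin_tail_le:
  assumes p: "0 \<le> p" "p \<le> 1"
  shows "bin_tail N p r \<le> real (N choose r) * p ^ r"
proof (cases "r \<le> N")
  case True
  have "bin_tail N p r \<le> (\<Sum>i=r..N. real (N choose r) * p ^ r * bin_pmf (N - r) p (i - r))"
    unfolding bin_tail_def
  proof (rule sum_mono)
    fix i assume i: "i \<in> {r..N}"
    have "(N choose i) \<le> (N choose i) * (i choose r)" using i by (simp add: Suc_leI)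
    also have "\<dots> = (N choose r) * ((N - r) choose (i - r))" using i by (intro choose_mult) auto
    finally have "real (N choose i) \<le> real (N choose r) * real ((N - r) choose (i - r))"
      by (metis of_nat_le_iff of_nat_mult)
    then have "real (N choose i) * (p ^ i * (1 - p) ^ (N - i))
        \<le> real (N choose r) * real ((N - r) choose (i - r)) * (p ^ i * (1 - p) ^ (N - i))"
      using p by (intro mult_right_mono) auto
    moreover have "p ^ i = p ^ r * p ^ (i - r)" using i by (simp flip: power_add)
    moreover have "N - i = N - r - (i - r)" using i by simp
    ultimately show "bin_pmf N p i \<le> real (N choose r) * p ^ r * bin_pmf (N - r) p (i - r)"
      by (simp add: bin_pmf_def mult_ac)
  qed
  also have "\<dots> = real (N choose r) * p ^ r * (\<Sum>i=r..N. bin_pmf (N - r) p (i - r))"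
    by (simp add: sum_distrib_left)
  also have "(\<Sum>i=r..N. bin_pmf (N - r) p (i - r)) = (\<Sum>i\<le>N - r. bin_pmf (N - r) p i)"
    using True by (intro sum.reindex_bij_witness[of _ "\<lambda>i. i + r" "\<lambda>i. i - r"]) auto
  finally show ?thesis by (simp add: bin_pmf_sum)
next
  case False
  then show ?thesis using p by (simp add: bin_tail_def)
qed

lemma bin_tail_ge:
  assumes "0 \<le> p" "p \<le> 1"
  shows "bin_pmf N p r \<le> bin_tail N p r"
proof (cases "r \<le> N")
  case True
  then show ?thesis unfolding bin_tail_def using assms
    by (intro member_le_sum) (auto simp: bin_pmf_nonneg)
qed (simp add: bin_tail_def bin_pmf_eq_0)

lemma bin_diff_le_tail:
  assumes "0 \<le> p" "p \<le> 1"
  shows "bin_diff N N' p r \<le> bin_tail N p r"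
  unfolding bin_diff_def bin_tail_def
  by (intro sum_mono mult_left_le bin_pmf_sum_le bin_pmf_nonneg assms) auto

text \<open>Keeps only the event that the second variable vanishes.\<close>

lemma bin_diff_ge_tail:
  assumes "0 \<le> p" "p \<le> 1"
  shows "(1 - p) ^ N' * bin_tail N p r \<le> bin_diff N N' p r"
  unfolding bin_diff_def bin_tail_def
proof (subst sum_distrib_left, rule sum_mono)
  fix i
  have "(1 - p) ^ N' = bin_pmf N' p 0" by (simp add: bin_pmf_def)
  also have "\<dots> \<le> (\<Sum>j=0..i - r. bin_pmf N' p j)"
    using assms by (intro member_le_sum) (auto simp: bin_pmf_nonneg)
  finally show "(1 - p) ^ N' * bin_pmf N p i \<le> bin_pmf N p i * (\<Sum>j=0..i - r. bin_pmf N' p j)"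
    using assms by (subst mult.commute) (intro mult_left_mono bin_pmf_nonneg)
qed

lemma bin_diff_nonneg: "0 \<le> p \<Longrightarrow> p \<le> 1 \<Longrightarrow> 0 \<le> bin_diff N N' p r"
  unfolding bin_diff_def by (intro sum_nonneg mult_nonneg_nonneg bin_pmf_nonneg)

lemma one_minus_power_ge:
  assumes "0 \<le> p" "p \<le> (1::real)"
  shows "1 - real N * p \<le> (1 - p) ^ N"
  using Bernoulli_inequality[of "-p" N] assms by simp

text \<open>\<open>w\<close> is the scale of the mean N p; it becomes q p in the sparse regimes,
  where p / w = 1/q tends to 0. The tail is asymptotic to (N choose r) p^r: the union bound gives
  the upper estimate and the single value r the lower one.\<close>

lemma tendsto_bin_tail:
  fixes p w :: "nat \<Rightarrow> real" and N :: "nat \<Rightarrow> nat"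
  assumes p: "\<forall>\<^sub>F n in sequentially. 0 < p n \<and> p n < 1" and w: "\<forall>\<^sub>F n in sequentially. 0 < w n"
    and w0: "w \<longlonglongrightarrow> 0" and pw: "(\<lambda>n. p n / w n) \<longlonglongrightarrow> 0"
    and N: "(\<lambda>n. real (N n) * p n / w n) \<longlonglongrightarrow> y"
  shows "(\<lambda>n. real (N n) * p n) \<longlonglongrightarrow> 0"
    and "(\<lambda>n. (1 - p n) ^ N n) \<longlonglongrightarrow> 1"
    and "(\<lambda>n. bin_tail (N n) (p n) r / w n ^ r) \<longlonglongrightarrow> y ^ r / fact r"
proof -
  have "(\<lambda>n. real (N n) * p n / w n * w n) \<longlonglongrightarrow> y * 0" by (intro tendsto_mult N w0)
  then have "(\<lambda>n. real (N n) * p n / w n * w n) \<longlonglongrightarrow> 0" by simp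
  then show Np: "(\<lambda>n. real (N n) * p n) \<longlonglongrightarrow> 0"
    by (rule Lim_transform_eventually) (rule eventually_mono[OF w], simp)
  show one: "(\<lambda>n. (1 - p n) ^ N n) \<longlonglongrightarrow> 1"
  proof (rule tendsto_sandwich)
    show "\<forall>\<^sub>F n in sequentially. 1 - real (N n) * p n \<le> (1 - p n) ^ N n"
      using p by eventually_elim (rule one_minus_power_ge, auto)
    show "\<forall>\<^sub>F n in sequentially. (1 - p n) ^ N n \<le> 1"
      using p by eventually_elim (rule power_le_one, auto)
    show "(\<lambda>n. 1 - real (N n) * p n) \<longlonglongrightarrow> 1" using tendsto_diff[OF tendsto_const Np, of 1] by simp
  qed simp
  define u where "u n = (\<Prod>i<r. real (N n) * p n / w n - real i * (p n / w n)) / fact r" for n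
  have "u \<longlonglongrightarrow> (\<Prod>i<r. y - real i * 0) / fact r"
    unfolding u_def by (intro tendsto_intros N pw) auto
  then have u: "u \<longlonglongrightarrow> y ^ r / fact r" by simp
  have ueq: "\<forall>\<^sub>F n in sequentially. real (N n choose r) * p n ^ r / w n ^ r = u n"
    using w
  proof eventually_elim
    case (elim n)
    have "u n = (\<Prod>i<r. ((real (N n) - real i) * p n) / w n) / fact r"
      unfolding u_def using elim by (simp add: diff_divide_distrib left_diff_distrib)
    also have "\<dots> = (\<Prod>i<r. (real (N n) - real i) * p n) / fact r / w n ^ r"
      by (simp add: prod_dividef)
    finally show ?case by (simp add: choose_prod)
  qed
  show "(\<lambda>n. bin_tail (N n) (p n) r / w n ^ r) \<longlonglongrightarrow> y ^ r / fact r"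
  proof (rule tendsto_sandwich)
    show "\<forall>\<^sub>F n in sequentially. bin_tail (N n) (p n) r / w n ^ r \<le> u n"
      using p w ueq
    proof eventually_elim
      case (elim n)
      then have "bin_tail (N n) (p n) r / w n ^ r \<le> real (N n choose r) * p n ^ r / w n ^ r"
        by (intro divide_right_mono bin_tail_le) auto
      then show ?case using elim by simp
    qed
    show "\<forall>\<^sub>F n in sequentially. u n * (1 - p n) ^ N n \<le> bin_tail (N n) (p n) r / w n ^ r"
      using p w ueq
    proof eventually_elim
      case (elim n)
      have "real (N n choose r) * p n ^ r * (1 - p n) ^ N n \<le> bin_pmf (N n) (p n) r"
        unfolding bin_pmf_def using elim by (intro mult_left_mono power_decreasing) auto
      also have "\<dots> \<le> bin_tail (N n) (p n) r" using elim by (intro bin_tail_ge) auto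
      finally have "real (N n choose r) * p n ^ r * (1 - p n) ^ N n / w n ^ r \<le> bin_tail (N n) (p n) r / w n ^ r"
        using elim by (intro divide_right_mono) auto
      then show ?case unfolding elim(3)[symmetric] by (simp only: times_divide_eq_left)
    qed
    show "(\<lambda>n. u n * (1 - p n) ^ N n) \<longlonglongrightarrow> y ^ r / fact r"
      using tendsto_mult[OF u one] by simp
  qed (rule u)
qed

text \<open>With vanishing mean degrees the competing colour costs only the factor (1-p)^N', which
  tends to 1, so the difference behaves like the tail of the own degree.\<close>

lemma tendsto_bin_diff_sparse:
  fixes p w :: "nat \<Rightarrow> real" and N N' :: "nat \<Rightarrow> nat"
  assumes p: "\<forall>\<^sub>F n in sequentially. 0 < p n \<and> p n < 1" and w: "\<forall>\<^sub>F n in sequentially. 0 < w n"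
    and w0: "w \<longlonglongrightarrow> 0" and pw: "(\<lambda>n. p n / w n) \<longlonglongrightarrow> 0"
    and N: "(\<lambda>n. real (N n) * p n / w n) \<longlonglongrightarrow> y" and N': "(\<lambda>n. real (N' n) * p n / w n) \<longlonglongrightarrow> y'"
  shows "(\<lambda>n. bin_diff (N n) (N' n) (p n) r / w n ^ r) \<longlonglongrightarrow> y ^ r / fact r"
proof (rule tendsto_sandwich)
  show "\<forall>\<^sub>F n in sequentially. bin_diff (N n) (N' n) (p n) r / w n ^ r \<le> bin_tail (N n) (p n) r / w n ^ r"
    using p w by eventually_elim (intro divide_right_mono bin_diff_le_tail, auto)
  show "\<forall>\<^sub>F n in sequentially. (1 - p n) ^ N' n * (bin_tail (N n) (p n) r / w n ^ r)
      \<le> bin_diff (N n) (N' n) (p n) r / w n ^ r"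
    using p w
  proof eventually_elim
    case (elim n)
    then have "(1 - p n) ^ N' n * bin_tail (N n) (p n) r / w n ^ r \<le> bin_diff (N n) (N' n) (p n) r / w n ^ r"
      by (intro divide_right_mono bin_diff_ge_tail) auto
    then show ?case by simp
  qed
  show "(\<lambda>n. bin_tail (N n) (p n) r / w n ^ r) \<longlonglongrightarrow> y ^ r / fact r"
    by (rule tendsto_bin_tail(3)[OF p w w0 pw N])
  show "(\<lambda>n. (1 - p n) ^ N' n * (bin_tail (N n) (p n) r / w n ^ r)) \<longlonglongrightarrow> y ^ r / fact r"
    using tendsto_mult[OF tendsto_bin_tail(2)[OF p w w0 pw N'] tendsto_bin_tail(3)[OF p w w0 pw N, of r]] by simp
qed

section \<open>Poisson limits\<close>

lemma ln_one_minus_over: "((\<lambda>x::real. ln (1 - x) / x) \<longlongrightarrow> -1) (at 0)"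
proof -
  have "((\<lambda>x::real. ln (1 - x)) has_real_derivative -1) (at 0)"
    by (auto intro!: derivative_eq_intros)
  then show ?thesis unfolding DERIV_def by simp
qed

lemma tendsto_bin_pmf:
  fixes p :: "nat \<Rightarrow> real" and N :: "nat \<Rightarrow> nat"
  assumes p: "\<forall>\<^sub>F n in sequentially. 0 < p n \<and> p n < 1"
    and p0: "p \<longlonglongrightarrow> 0" and N: "(\<lambda>n. real (N n) * p n) \<longlonglongrightarrow> y"
  shows "(\<lambda>n. bin_pmf (N n) (p n) k) \<longlonglongrightarrow> exp (- y) * y ^ k / fact k"
proof -
  have "filterlim p (at 0) sequentially"
    using p0 p by (auto simp: filterlim_at elim: eventually_mono)
  then have "(\<lambda>n. ln (1 - p n) / p n) \<longlonglongrightarrow> -1"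
    by (rule filterlim_compose[OF ln_one_minus_over])
  then have "(\<lambda>n. exp (real (N n) * p n * (ln (1 - p n) / p n))) \<longlonglongrightarrow> exp (y * -1)"
    by (intro tendsto_intros N)
  moreover have "(\<lambda>n. (\<Prod>i<k. real (N n) * p n - real i * p n) / fact k / (1 - p n) ^ k)
      \<longlonglongrightarrow> (\<Prod>i<k. y - real i * 0) / fact k / (1 - 0) ^ k"
    by (intro tendsto_intros N p0) auto
  ultimately have "(\<lambda>n. (\<Prod>i<k. real (N n) * p n - real i * p n) / fact k / (1 - p n) ^ k
      * exp (real (N n) * p n * (ln (1 - p n) / p n))) \<longlonglongrightarrow> y ^ k / fact k * exp (- y)"
    by (auto dest: tendsto_mult)
  then have "(\<lambda>n. bin_pmf (N n) (p n) k) \<longlonglongrightarrow> y ^ k / fact k * exp (- y)"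
  proof (rule Lim_transform_eventually)
    show "\<forall>\<^sub>F n in sequentially. (\<Prod>i<k. real (N n) * p n - real i * p n) / fact k / (1 - p n) ^ k
      * exp (real (N n) * p n * (ln (1 - p n) / p n)) = bin_pmf (N n) (p n) k"
      using p
    proof eventually_elim
      case (elim n)
      have e: "exp (real (N n) * p n * (ln (1 - p n) / p n)) = (1 - p n) ^ N n"
        using elim by (simp add: exp_of_nat_mult)
      have c: "(\<Prod>i<k. real (N n) * p n - real i * p n) / fact k = real (N n choose k) * p n ^ k"
        by (simp add: choose_prod left_diff_distrib)
      show ?case
      proof (cases "k \<le> N n")
        case True
        then show ?thesis unfolding e c bin_pmf_def using elim by (simp add: power_diff)
      next
        case False
        then show ?thesis unfolding e c by (simp add: bin_pmf_def binomial_eq_0)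
      qed
    qed
  qed
  then show ?thesis by (simp add: mult.commute)
qed

text \<open>Termwise Poisson limits together with Tannery's theorem. The majorant (y+1)^k / k! comes
  from \<open>bin_pmf_le\<close> and the fact that N p is eventually below y + 1; the inner sums are
  probabilities, hence at most 1.\<close>

lemma tendsto_bin_diff_poisson:
  fixes p :: "nat \<Rightarrow> real" and N N' :: "nat \<Rightarrow> nat"
  assumes p: "\<forall>\<^sub>F n in sequentially. 0 < p n \<and> p n < 1" and p0: "p \<longlonglongrightarrow> 0"
    and N: "(\<lambda>n. real (N n) * p n) \<longlonglongrightarrow> y" and N': "(\<lambda>n. real (N' n) * p n) \<longlonglongrightarrow> y'"
  shows "(\<lambda>n. bin_diff (N n) (N' n) (p n) r)
    \<longlonglongrightarrow> (\<Sum>\<^sub>\<infinity>i\<in>{r..}. \<Sum>j=0..i - r. y ^ i / fact i * (y' ^ j / fact j) * exp (- (y + y')))"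
proof -
  define a where "a k n = (if r \<le> k then bin_pmf (N n) (p n) k * (\<Sum>j=0..k - r. bin_pmf (N' n) (p n) j) else 0)" for k n
  define b where "b k = (if r \<le> k then exp (- y) * y ^ k / fact k * (\<Sum>j=0..k - r. exp (- y') * y' ^ j / fact j) else 0)" for k
  have lim: "(\<lambda>n. a k n) \<longlonglongrightarrow> b k" for k
  proof -
    have "(\<lambda>n. bin_pmf (N n) (p n) k * (\<Sum>j=0..k - r. bin_pmf (N' n) (p n) j))
        \<longlonglongrightarrow> exp (- y) * y ^ k / fact k * (\<Sum>j=0..k - r. exp (- y') * y' ^ j / fact j)"
      by (intro tendsto_mult tendsto_sum tendsto_bin_pmf[OF p p0] N N')
    then show ?thesis by (auto simp: a_def b_def)
  qed
  have "\<forall>\<^sub>F n in sequentially. real (N n) * p n < y + 1"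
    using order_tendstoD(2)[OF N, of "y + 1"] by simp
  then have bound: "\<forall>\<^sub>F n in sequentially. \<forall>k. norm (a k n) \<le> (y + 1) ^ k / fact k"
    using p
  proof eventually_elim
    case (elim n)
    show ?case
    proof
      fix k
      have pr: "0 \<le> p n" "p n \<le> 1" using elim by auto
      have s: "0 \<le> (\<Sum>j=0..k - r. bin_pmf (N' n) (p n) j)" "(\<Sum>j=0..k - r. bin_pmf (N' n) (p n) j) \<le> 1"
        by (auto intro!: sum_nonneg bin_pmf_nonneg bin_pmf_sum_le pr)
      have "norm (a k n) \<le> bin_pmf (N n) (p n) k"
        using s bin_pmf_nonneg[OF pr, of "N n" k] by (auto simp: a_def abs_mult intro: mult_left_le)
      also have "\<dots> \<le> (real (N n) * p n) ^ k / fact k" by (rule bin_pmf_le[OF pr])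
      also have "\<dots> \<le> (y + 1) ^ k / fact k"
        using elim by (intro divide_right_mono power_mono) auto
      finally show "norm (a k n) \<le> (y + 1) ^ k / fact k" .
    qed
  qed
  have "\<forall>\<^sub>F (k, n) in at_top \<times>\<^sub>F sequentially. norm (a k n) \<le> (y + 1) ^ k / fact k"
    using eventually_prodI[OF always_eventually bound, of "\<lambda>_. True" at_top] by (auto elim!: eventually_mono)
  moreover have "summable (\<lambda>k. (y + 1) ^ k / fact k)"
    using summable_exp[of "y + 1"] by (simp add: field_simps)
  ultimately have T: "summable (\<lambda>k. norm (b k)) \<and> (\<lambda>n. suminf (\<lambda>k. a k n)) \<longlonglongrightarrow> suminf b"
    using tannerys_theorem[of a b sequentially "\<lambda>k. (y + 1) ^ k / fact k"] lim by auto
  have "suminf (\<lambda>k. a k n) = bin_diff (N n) (N' n) (p n) r" for n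
  proof -
    have "suminf (\<lambda>k. a k n) = (\<Sum>k\<in>{r..N n}. a k n)"
      by (rule suminf_finite) (auto simp: a_def bin_pmf_eq_0 not_le)
    then show ?thesis by (simp add: a_def bin_diff_def)
  qed
  then have "(\<lambda>n. bin_diff (N n) (N' n) (p n) r) \<longlonglongrightarrow> suminf b" using T by simp
  moreover have "(\<Sum>\<^sub>\<infinity>i\<in>{r..}. \<Sum>j=0..i - r. y ^ i / fact i * (y' ^ j / fact j) * exp (- (y + y'))) = suminf b"
  proof -
    have e: "exp (- (y + y')) = exp (- y) * exp (- y')" by (simp add: exp_add[symmetric])
    have "(b has_sum suminf b) UNIV"
      using T summable_norm_cancel summable_sums by (intro norm_summable_imp_has_sum) blast+
    then have "infsum b UNIV = suminf b" by (rule infsumI)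
    moreover have "(\<Sum>\<^sub>\<infinity>i\<in>{r..}. \<Sum>j=0..i - r. y ^ i / fact i * (y' ^ j / fact j) * exp (- (y + y'))) = infsum b UNIV"
      unfolding e by (rule infsum_cong_neutral) (auto simp: b_def sum_distrib_left mult_ac intro!: sum.cong)
    ultimately show ?thesis by simp
  qed
  ultimately show ?thesis by simp
qed

section \<open>Exponential bounds for differences of binomial variables\<close>

lemma bin_diff_double_sum:
  "bin_diff N N' p r = (\<Sum>i\<le>N. \<Sum>j\<le>N'. bin_pmf N p i * bin_pmf N' p j * of_bool (j + r \<le> i))"
proof -
  have "(\<Sum>j\<le>N'. bin_pmf N p i * bin_pmf N' p j * of_bool (j + r \<le> i))
      = (if r \<le> i then bin_pmf N p i * (\<Sum>j=0..i - r. bin_pmf N' p j) else 0)" for i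
  proof (cases "r \<le> i")
    case True
    have "(\<Sum>j\<le>N'. bin_pmf N p i * bin_pmf N' p j * of_bool (j + r \<le> i))
        = (\<Sum>j\<in>{0..i - r}. bin_pmf N p i * bin_pmf N' p j)"
      using True by (intro sum.mono_neutral_cong) (auto simp: bin_pmf_eq_0)
    then show ?thesis using True by (simp add: sum_distrib_left)
  qed auto
  then show ?thesis unfolding bin_diff_def
    by (simp del: sum_mult_of_bool_eq) (rule sum.mono_neutral_cong_left, auto)
qed

lemma bin_mgf_le:
  assumes "0 \<le> p" "p \<le> 1"
  shows "(\<Sum>i\<le>N. bin_pmf N p i * exp s ^ i) \<le> exp (real N * p * (exp s - 1))"
proof -
  have "(\<Sum>i\<le>N. bin_pmf N p i * exp s ^ i) = (1 + p * (exp s - 1)) ^ N"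
    unfolding bin_pmf_mgf by (simp add: algebra_simps)
  also have "\<dots> \<le> exp (p * (exp s - 1)) ^ N"
  proof (rule power_mono)
    have "0 \<le> p * exp s + (1 - p)" using assms by (intro add_nonneg_nonneg) auto
    then show "0 \<le> 1 + p * (exp s - 1)" by (simp add: algebra_simps)
  qed (rule exp_ge_add_one_self)
  also have "\<dots> = exp (real N * p * (exp s - 1))" by (simp add: exp_of_nat_mult[symmetric] mult_ac)
  finally show ?thesis .
qed

lemma bin_double_exponential:
  assumes p: "0 \<le> p" "p \<le> 1" and s: "0 \<le> s" "s \<le> 1"
  shows "(\<Sum>i\<le>N. \<Sum>j\<le>N'. bin_pmf N p i * bin_pmf N' p j * (exp s ^ i * exp (- s) ^ j))
    \<le> exp (s * ((real N - real N') * p) + s\<^sup>2 * ((real N + real N') * p))"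
proof -
  have "(\<Sum>i\<le>N. \<Sum>j\<le>N'. bin_pmf N p i * bin_pmf N' p j * (exp s ^ i * exp (- s) ^ j))
      = (\<Sum>i\<le>N. bin_pmf N p i * exp s ^ i) * (\<Sum>j\<le>N'. bin_pmf N' p j * exp (- s) ^ j)"
    by (simp add: sum_product mult_ac)
  also have "\<dots> \<le> exp (real N * p * (exp s - 1)) * exp (real N' * p * (exp (- s) - 1))"
    by (intro mult_mono bin_mgf_le p sum_nonneg mult_nonneg_nonneg bin_pmf_nonneg) auto
  also have "\<dots> = exp (real N * p * (exp s - 1) + real N' * p * (exp (- s) - 1))" by (simp add: exp_add)
  also have "\<dots> \<le> exp (real N * p * (s + s\<^sup>2) + real N' * p * (- s + s\<^sup>2))"
  proof -
    have "exp s - 1 \<le> s + s\<^sup>2" using exp_bound[of s] s by simp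
    moreover have "exp (- s) - 1 \<le> - s + s\<^sup>2"
    proof -
      have "inverse (exp s) \<le> inverse (1 + s)"
        using s exp_ge_add_one_self[of s] by (intro le_imp_inverse_le) auto
      also have "\<dots> \<le> 1 - s + s\<^sup>2"
      proof -
        have "1 \<le> (1 - s + s\<^sup>2) * (1 + s)" using s by (simp add: algebra_simps power2_eq_square)
        then show ?thesis using s by (simp add: field_simps)
      qed
      finally show ?thesis by (simp add: exp_minus)
    qed
    ultimately show ?thesis using p
      by (intro exp_le_cancel_iff[THEN iffD2] add_mono mult_left_mono) auto
  qed
  also have "real N * p * (s + s\<^sup>2) + real N' * p * (- s + s\<^sup>2)
      = s * ((real N - real N') * p) + s\<^sup>2 * ((real N + real N') * p)"
    by (simp add: algebra_simps)
  finally show ?thesis .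
qed

text \<open>A Chernoff bound for the difference: the indicator of j + r \<le> i is at most exp(s(i -
  j)), that of its complement at most exp(s(r + j - i)). The quadratic term in s stems from exp(s) -
  1 \<le> s + s^2 and its counterpart for -s.\<close>

lemma bin_diff_exponential:
  assumes p: "0 \<le> p" "p \<le> 1" and s: "0 \<le> s" "s \<le> 1"
  shows "bin_diff N N' p r \<le> exp (s * ((real N - real N') * p) + s\<^sup>2 * ((real N + real N') * p))"
    and "1 - bin_diff N N' p r \<le> exp (s * real r)
      * exp (s * ((real N' - real N) * p) + s\<^sup>2 * ((real N + real N') * p))"
proof -
  have nn: "0 \<le> bin_pmf N p i * bin_pmf N' p j" for i j by (intro mult_nonneg_nonneg bin_pmf_nonneg p)
  have "bin_diff N N' p r \<le> (\<Sum>i\<le>N. \<Sum>j\<le>N'. bin_pmf N p i * bin_pmf N' p j * (exp s ^ i * exp (- s) ^ j))"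
    unfolding bin_diff_double_sum
  proof (intro sum_mono mult_left_mono nn)
    fix i j
    have "exp s ^ i * exp (- s) ^ j = exp (s * (real i - real j))"
      by (simp add: exp_of_nat_mult[symmetric] exp_add[symmetric] algebra_simps)
    then show "of_bool (j + r \<le> i) \<le> exp s ^ i * exp (- s) ^ j" using s by simp
  qed
  then show "bin_diff N N' p r \<le> exp (s * ((real N - real N') * p) + s\<^sup>2 * ((real N + real N') * p))"
    using bin_double_exponential[OF p s, of N N'] by linarith
  have "(\<Sum>i\<le>N. \<Sum>j\<le>N'. bin_pmf N p i * bin_pmf N' p j) = 1"
    by (simp add: sum_product[symmetric] bin_pmf_sum)
  then have "1 - bin_diff N N' p r = (\<Sum>i\<le>N. \<Sum>j\<le>N'. bin_pmf N p i * bin_pmf N' p j * (1 - of_bool (j + r \<le> i)))"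
    unfolding bin_diff_double_sum right_diff_distrib sum_subtractf by simp
  also have "\<dots> \<le> (\<Sum>i\<le>N. \<Sum>j\<le>N'. bin_pmf N p i * bin_pmf N' p j * (exp (s * real r) * (exp s ^ j * exp (- s) ^ i)))"
  proof (intro sum_mono mult_left_mono nn)
    fix i j
    have "exp (s * real r) * (exp s ^ j * exp (- s) ^ i) = exp (s * (real r + real j - real i))"
      by (simp add: exp_of_nat_mult[symmetric] exp_add[symmetric] algebra_simps)
    then show "1 - of_bool (j + r \<le> i) \<le> exp (s * real r) * (exp s ^ j * exp (- s) ^ i)" using s by simp
  qed
  also have "\<dots> = exp (s * real r) * (\<Sum>j\<le>N'. \<Sum>i\<le>N. bin_pmf N' p j * bin_pmf N p i * (exp s ^ j * exp (- s) ^ i))"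
    by (subst sum.swap) (simp add: sum_distrib_left mult_ac)
  also have "\<dots> \<le> exp (s * real r) * exp (s * ((real N' - real N) * p) + s\<^sup>2 * ((real N' + real N) * p))"
    by (intro mult_left_mono bin_double_exponential p s) auto
  finally show "1 - bin_diff N N' p r \<le> exp (s * real r)
      * exp (s * ((real N' - real N) * p) + s\<^sup>2 * ((real N + real N') * p))"
    by (simp add: add.commute)
qed

lemma exp_neg_scaled_tendsto_0:
  fixes w f :: "nat \<Rightarrow> real"
  assumes w: "filterlim w at_top sequentially" and f: "(\<lambda>n. f n / w n) \<longlonglongrightarrow> c" "c < 0"
  shows "(\<lambda>n. exp (f n)) \<longlonglongrightarrow> 0"
proof -
  have "filterlim (\<lambda>n. f n / w n * w n) at_bot sequentially"
    by (rule filterlim_tendsto_neg_mult_at_bot[OF f w])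
  moreover have "\<forall>\<^sub>F n in sequentially. f n / w n * w n = f n"
    using filterlim_at_top_dense[THEN iffD1, OF w, rule_format, of 0] by eventually_elim simp
  ultimately have "filterlim f at_bot sequentially"
    by (simp add: filterlim_cong[OF refl refl])
  then show ?thesis by (rule filterlim_compose[OF exp_at_bot])
qed

text \<open>Here mean degrees diverge like \<open>w\<close>. Divided by \<open>w\<close>, the
  exponent of the Chernoff bound tends to s(a - b) + s^2(a + b), which is negative for small s > 0
  if a < b; so the colour with the larger mean wins.\<close>

lemma tendsto_bin_diff_dense:
  fixes p w :: "nat \<Rightarrow> real" and N N' :: "nat \<Rightarrow> nat"
  assumes p: "\<forall>\<^sub>F n in sequentially. 0 < p n \<and> p n < 1" and w: "filterlim w at_top sequentially"
    and N: "(\<lambda>n. real (N n) * p n / w n) \<longlonglongrightarrow> y" and N': "(\<lambda>n. real (N' n) * p n / w n) \<longlonglongrightarrow> y'"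
    and y: "0 \<le> y" "0 \<le> y'"
  shows "y < y' \<Longrightarrow> (\<lambda>n. bin_diff (N n) (N' n) (p n) r) \<longlonglongrightarrow> 0"
    and "y' < y \<Longrightarrow> (\<lambda>n. bin_diff (N n) (N' n) (p n) r) \<longlonglongrightarrow> 1"
proof -
  have lim: "(\<lambda>n. (s * ((real (A n) - real (B n)) * p n) + s\<^sup>2 * ((real (A n) + real (B n)) * p n)) / w n)
      \<longlonglongrightarrow> s * (a - b) + s\<^sup>2 * (a + b)"
    if "(\<lambda>n. real (A n) * p n / w n) \<longlonglongrightarrow> a" "(\<lambda>n. real (B n) * p n / w n) \<longlonglongrightarrow> b" for A B s a b
  proof -
    have "(\<lambda>n. s * (real (A n) * p n / w n - real (B n) * p n / w n)
        + s\<^sup>2 * (real (A n) * p n / w n + real (B n) * p n / w n)) \<longlonglongrightarrow> s * (a - b) + s\<^sup>2 * (a + b)"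
      by (intro tendsto_intros that)
    then show ?thesis by (simp add: add_divide_distrib diff_divide_distrib algebra_simps)
  qed
  have neg: "\<exists>s. 0 \<le> s \<and> s \<le> 1 \<and> s * (a - b) + s\<^sup>2 * (a + b) < 0"
    if ab: "0 \<le> a" "a < b" for a b :: real
  proof -
    \<comment> \<open>Chosen such that the quadratic term is at most half of the linear one.\<close>
    define s where "s = min 1 ((b - a) / (2 * (a + b)))"
    have s: "0 < s" "s \<le> 1" "s \<le> (b - a) / (2 * (a + b))" using ab by (auto simp: s_def)
    then have "s * (a + b) \<le> (b - a) / 2" using ab by (simp add: field_simps)
    then have "s * (s * (a + b)) \<le> s * ((b - a) / 2)" using s by (intro mult_left_mono) auto
    moreover have "s * (a - b) + s\<^sup>2 * (a + b) = s * (s * (a + b)) - s * ((b - a) / 2) - s * (b - a) / 2"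
      by (simp add: power2_eq_square field_simps)
    ultimately have "s * (a - b) + s\<^sup>2 * (a + b) \<le> - (s * (b - a) / 2)" by linarith
    also have "\<dots> < 0" using s ab by simp
    finally show ?thesis using s by (intro exI[of _ s]) auto
  qed
  show "(\<lambda>n. bin_diff (N n) (N' n) (p n) r) \<longlonglongrightarrow> 0" if less: "y < y'"
  proof -
    obtain s where s: "0 \<le> s" "s \<le> 1" "s * (y - y') + s\<^sup>2 * (y + y') < 0" using neg[OF y(1) less] by blast
    show ?thesis
    proof (rule tendsto_sandwich[OF _ _ tendsto_const exp_neg_scaled_tendsto_0[OF w lim[OF N N'] s(3)]])
      show "\<forall>\<^sub>F n in sequentially. 0 \<le> bin_diff (N n) (N' n) (p n) r"
        using p by eventually_elim (rule bin_diff_nonneg, auto)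
      show "\<forall>\<^sub>F n in sequentially. bin_diff (N n) (N' n) (p n) r
        \<le> exp (s * ((real (N n) - real (N' n)) * p n) + s\<^sup>2 * ((real (N n) + real (N' n)) * p n))"
        using p by eventually_elim (rule bin_diff_exponential(1), use s in auto)
    qed
  qed
  show "(\<lambda>n. bin_diff (N n) (N' n) (p n) r) \<longlonglongrightarrow> 1" if less: "y' < y"
  proof -
    obtain s where s: "0 \<le> s" "s \<le> 1" "s * (y' - y) + s\<^sup>2 * (y' + y) < 0" using neg[OF y(2) less] by blast
    have "(\<lambda>n. exp (s * real r) * exp (s * ((real (N' n) - real (N n)) * p n) + s\<^sup>2 * ((real (N' n) + real (N n)) * p n)))
        \<longlonglongrightarrow> exp (s * real r) * 0"
      by (intro tendsto_intros exp_neg_scaled_tendsto_0[OF w lim[OF N' N] s(3)])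
    then have "(\<lambda>n. 1 - exp (s * real r) * exp (s * ((real (N' n) - real (N n)) * p n) + s\<^sup>2 * ((real (N' n) + real (N n)) * p n)))
        \<longlonglongrightarrow> 1 - exp (s * real r) * 0" by (intro tendsto_diff tendsto_const)
    then have lower: "(\<lambda>n. 1 - exp (s * real r) * exp (s * ((real (N' n) - real (N n)) * p n) + s\<^sup>2 * ((real (N n) + real (N' n)) * p n)))
        \<longlonglongrightarrow> 1" by (simp add: add.commute)
    show ?thesis
    proof (rule tendsto_sandwich[OF _ _ lower tendsto_const])
      show "\<forall>\<^sub>F n in sequentially. bin_diff (N n) (N' n) (p n) r \<le> 1"
        using p
      proof eventually_elim
        case (elim n)
        have "bin_diff (N n) (N' n) (p n) r \<le> bin_tail (N n) (p n) r" using elim by (intro bin_diff_le_tail) auto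
        also have "\<dots> \<le> 1" unfolding bin_tail_def using elim by (intro bin_pmf_sum_le) auto
        finally show ?case .
      qed
      show "\<forall>\<^sub>F n in sequentially. 1 - exp (s * real r)
        * exp (s * ((real (N' n) - real (N n)) * p n) + s\<^sup>2 * ((real (N n) + real (N' n)) * p n))
        \<le> bin_diff (N n) (N' n) (p n) r"
        using p
      proof eventually_elim
        case (elim n)
        then show ?case using bin_diff_exponential(2)[of "p n" s "N n" "N' n" r] s by simp
      qed
    qed
  qed
qed

section \<open>The four regimes\<close>

lemma tendsto_zero_of_power:
  fixes f :: "nat \<Rightarrow> real"
  assumes "0 < k" "\<forall>\<^sub>F n in sequentially. 0 \<le> f n" "(\<lambda>n. f n ^ k) \<longlonglongrightarrow> 0"
  shows "f \<longlonglongrightarrow> 0"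
proof -
  have "(\<lambda>n. root k (f n ^ k)) \<longlonglongrightarrow> root k 0" by (intro tendsto_intros assms)
  then have "(\<lambda>n. root k (f n ^ k)) \<longlonglongrightarrow> 0" by simp
  then show ?thesis
    by (rule Lim_transform_eventually)
      (use assms(2) in eventually_elim, use assms(1) in \<open>simp add: real_root_power_cancel\<close>)
qed

text \<open>\<open>beta\<close> before the coloured nodes are subtracted, as a function of the two
  counts with the own colour first. The subtraction, present only for q = g, is encoded by the
  coefficient \<open>damping\<close>.\<close>

definition own_rate :: "regime \<Rightarrow> nat \<Rightarrow> (color \<Rightarrow> real) \<Rightarrow> color \<Rightarrow> real \<Rightarrow> real \<Rightarrow> real" where
  "own_rate reg r \<alpha> S x y = (case reg of
      At_crit \<Rightarrow> 1 / real r * (1 - 1 / real r) ^ (r - 1) * (x + \<alpha> S) ^ r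
    | _ \<Rightarrow> beta reg r \<alpha> S (\<lambda>T. if T = S then x else y))"

definition damping :: "regime \<Rightarrow> real" where
  "damping reg = (case reg of At_crit \<Rightarrow> 1 | _ \<Rightarrow> 0)"

lemma beta_eq: "beta reg r \<alpha> S z = own_rate reg r \<alpha> S (z S) (z (other S)) - damping reg * z S"
proof -
  have "(\<lambda>T. if T = S then z S else z (other S)) = z"
    by (rule ext) (metis color_cases2)
  then show ?thesis by (cases reg) (auto simp: own_rate_def damping_def)
qed

text \<open>In the last regime the rates are discontinuous where both colours are equally strong.\<close>

definition rate_domain :: "regime \<Rightarrow> (color \<Rightarrow> real) \<Rightarrow> color \<Rightarrow> real \<Rightarrow> real \<Rightarrow> bool" where
  "rate_domain reg \<alpha> S x y \<longleftrightarrow> 0 \<le> x \<and> 0 \<le> y \<and> (reg = Above_inverse \<longrightarrow> x + \<alpha> S \<noteq> y + \<alpha> (other S))"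

section \<open>Growth of the scales p, q and \<eta>\<close>

locale regime_setup =
  fixes r :: nat and p q :: "nat \<Rightarrow> real" and a :: "color \<Rightarrow> nat \<Rightarrow> nat" and \<alpha> :: "color \<Rightarrow> real"
    and reg :: regime
  assumes r2: "r \<ge> 2"
    and p01: "\<forall>n\<ge>1. 0 < p n \<and> p n < 1"
    and p_lower: "(\<lambda>n. 1 / real n) \<in> o(p)"
    and p_upper: "p \<in> o(\<lambda>n. 1 / (real n powr (1 / real r) * ln (real n)))"
    and regime: "in_regime reg r p q"
    and seeds: "(\<lambda>n. real (a S n) / q n) \<longlonglongrightarrow> \<alpha> S"
    and \<alpha>_pos: "\<alpha> S > 0"
begin

lemma p_pos: "\<forall>\<^sub>F n in sequentially. 0 < p n \<and> p n < 1"
  using p01 by (intro eventually_sequentiallyI[of 1]) auto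

lemma np_inverse: "(\<lambda>n. 1 / (real n * p n)) \<longlonglongrightarrow> 0"
  using smalloD_tendsto[OF p_lower] by (simp add: divide_divide_eq_left)

lemma p_scaled: "(\<lambda>n. p n * (real n powr (1 / real r) * ln (real n))) \<longlonglongrightarrow> 0"
  using smalloD_tendsto[OF p_upper] by simp

lemma ln_large: "\<forall>\<^sub>F n::nat in sequentially. 1 \<le> n \<and> 1 \<le> ln (real n) \<and> 1 \<le> real n powr (1 / real r)"
  using eventually_ge_at_top[of "3::nat"]
proof eventually_elim
  case (elim n)
  have "exp 1 \<le> (3::real)" using exp_le by simp
  then have "exp 1 \<le> real n" using elim by linarith
  then have "1 \<le> ln (real n)" using elim by (subst ln_ge_iff) auto
  moreover have "1 \<le> real n powr (1 / real r)" using elim by (intro ge_one_powr_ge_zero) auto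
  ultimately show ?case using elim by simp
qed

lemma p_ln: "(\<lambda>n. p n * ln (real n)) \<longlonglongrightarrow> 0"
proof (rule tendsto_sandwich[OF _ _ tendsto_const p_scaled])
  show "\<forall>\<^sub>F n in sequentially. 0 \<le> p n * ln (real n)"
    using p_pos ln_large by eventually_elim auto
  show "\<forall>\<^sub>F n in sequentially. p n * ln (real n) \<le> p n * (real n powr (1 / real r) * ln (real n))"
    using p_pos ln_large
  proof eventually_elim
    case (elim n)
    then have "1 * ln (real n) \<le> real n powr (1 / real r) * ln (real n)" by (intro mult_right_mono) auto
    then show ?case using elim by (intro mult_left_mono) auto
  qed
qed

lemma p_tendsto: "p \<longlonglongrightarrow> 0"
proof (rule tendsto_sandwich[OF _ _ tendsto_const p_ln])
  show "\<forall>\<^sub>F n in sequentially. 0 \<le> p n" using p_pos by eventually_elim auto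
  show "\<forall>\<^sub>F n in sequentially. p n \<le> p n * ln (real n)"
    using p_pos ln_large
  proof eventually_elim
    case (elim n)
    then have "p n * 1 \<le> p n * ln (real n)" by (intro mult_left_mono) auto
    then show ?case by simp
  qed
qed

text \<open>The constant value of g^(r-1) n p^r; through this identity the real power in the
  definition of g can be avoided afterwards.\<close>

definition crit_const :: real where
  "crit_const = (1 - 1 / real r) ^ (r - 1) * fact (r - 1)"

lemma crit_const_pos: "0 < crit_const"
  using r2 by (simp add: crit_const_def)

lemma crit_props:
  assumes n: "1 \<le> n"
  shows "0 < crit r p n" "crit r p n ^ (r - 1) * (real n * p n ^ r) = crit_const"
proof -
  have pp: "0 < p n" using p01 n by auto
  define A where "A = fact (r - 1) / (real n * p n ^ r)"
  have A: "0 < A" using pp n by (simp add: A_def)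
  have c: "crit r p n = (1 - 1 / real r) * A powr (1 / (real r - 1))" by (simp add: crit_def A_def)
  show "0 < crit r p n" using A r2 by (simp add: c)
  have "(A powr (1 / (real r - 1))) ^ (r - 1) = A"
    using A r2 by (simp add: powr_power of_nat_diff)
  then have "crit r p n ^ (r - 1) = (1 - 1 / real r) ^ (r - 1) * A" by (simp add: c power_mult_distrib)
  then show "crit r p n ^ (r - 1) * (real n * p n ^ r) = crit_const"
    using pp n by (simp add: A_def crit_const_def)
qed

lemma p_power_r: "r = Suc (r - 1)" using r2 by simp

text \<open>(g p)^(r-1) equals \<open>crit_const\<close> / (n p), which vanishes because p >>
  1/n.\<close>

lemma crit_p: "(\<lambda>n. crit r p n * p n) \<longlonglongrightarrow> 0"
proof (rule tendsto_zero_of_power[of "r - 1"])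
  show "0 < r - 1" using r2 by simp
  show "\<forall>\<^sub>F n in sequentially. 0 \<le> crit r p n * p n"
    using p_pos eventually_ge_at_top[of 1] by eventually_elim (use crit_props(1) in \<open>auto intro: less_imp_le\<close>)
  have "(\<lambda>n. crit_const * (1 / (real n * p n))) \<longlonglongrightarrow> crit_const * 0"
    by (intro tendsto_intros np_inverse)
  then have "(\<lambda>n. crit_const * (1 / (real n * p n))) \<longlonglongrightarrow> 0" by simp
  then show "(\<lambda>n. (crit r p n * p n) ^ (r - 1)) \<longlonglongrightarrow> 0"
  proof (rule Lim_transform_eventually)
    show "\<forall>\<^sub>F n in sequentially. crit_const * (1 / (real n * p n)) = (crit r p n * p n) ^ (r - 1)"
      using p_pos eventually_ge_at_top[of 1]
    proof eventually_elim
      case (elim n)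
      have "p n ^ r = p n ^ (r - 1) * p n" using p_power_r by (metis power_Suc2)
      then show ?case using crit_props(2)[OF elim(2)] elim
        by (simp add: power_mult_distrib field_simps)
    qed
  qed
qed

text \<open>The (r-1)-st power is at most (p n^(1/r) ln n)^r / \<open>crit_const\<close>. This is
  the place where the upper bound on p makes g grow faster than the logarithm.\<close>

lemma crit_ln: "(\<lambda>n. ln (real n) / crit r p n) \<longlonglongrightarrow> 0"
proof (rule tendsto_zero_of_power[of "r - 1"])
  show "0 < r - 1" using r2 by simp
  show "\<forall>\<^sub>F n in sequentially. 0 \<le> ln (real n) / crit r p n"
    using ln_large
  proof eventually_elim
    case (elim n)
    then show ?case using crit_props(1)[of n] by (intro divide_nonneg_nonneg) auto
  qed
  have lim: "(\<lambda>n. (p n * (real n powr (1 / real r) * ln (real n))) ^ r / crit_const) \<longlonglongrightarrow> 0"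
  proof -
    have "(\<lambda>n. (p n * (real n powr (1 / real r) * ln (real n))) ^ r / crit_const) \<longlonglongrightarrow> 0 ^ r / crit_const"
      using crit_const_pos by (intro tendsto_intros p_scaled) auto
    then show ?thesis using r2 by (simp add: power_0_left)
  qed
  show "(\<lambda>n. (ln (real n) / crit r p n) ^ (r - 1)) \<longlonglongrightarrow> 0"
  proof (rule tendsto_sandwich[OF _ _ tendsto_const lim])
    show "\<forall>\<^sub>F n in sequentially. 0 \<le> (ln (real n) / crit r p n) ^ (r - 1)"
      using ln_large
    proof eventually_elim
      case (elim n)
      then show ?case using crit_props(1)[of n] by (intro zero_le_power divide_nonneg_nonneg) auto
    qed
    show "\<forall>\<^sub>F n in sequentially. (ln (real n) / crit r p n) ^ (r - 1)
        \<le> (p n * (real n powr (1 / real r) * ln (real n))) ^ r / crit_const"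
      using p_pos ln_large
    proof eventually_elim
      case (elim n)
      have c: "0 < crit r p n" "crit r p n ^ (r - 1) * (real n * p n ^ r) = crit_const"
        using crit_props elim by auto
      have "(real n powr (1 / real r)) ^ r = real n"
        using r2 elim by (simp add: powr_power)
      then have pr: "(p n * (real n powr (1 / real r) * ln (real n))) ^ r = real n * p n ^ r * ln (real n) ^ r"
        by (simp add: power_mult_distrib)
      have "ln (real n) ^ (r - 1) \<le> ln (real n) ^ r" using elim by (intro power_increasing) auto
      then have "ln (real n) ^ (r - 1) / crit r p n ^ (r - 1) \<le> ln (real n) ^ r / crit r p n ^ (r - 1)"
        using c by (intro divide_right_mono) auto
      also have "\<dots> = real n * p n ^ r * ln (real n) ^ r / crit_const"
        unfolding c(2)[symmetric] using c(1) elim by (simp add: field_simps)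
      finally show ?case unfolding pr by (simp add: power_divide)
    qed
  qed
qed

lemma q_pos: "\<forall>\<^sub>F n in sequentially. 0 < q n"
proof -
  have "\<forall>\<^sub>F n in sequentially. 0 < real (a Red n) / q n"
    using order_tendstoD(1)[OF seeds \<alpha>_pos] .
  then show ?thesis by eventually_elim (auto simp: zero_less_divide_iff)
qed

lemma tendsto_mult_eq:
  fixes x y z :: "nat \<Rightarrow> real"
  assumes "x \<longlonglongrightarrow> b" "y \<longlonglongrightarrow> c" "\<forall>\<^sub>F n in sequentially. x n * y n = z n"
  shows "z \<longlonglongrightarrow> b * c"
  by (rule Lim_transform_eventually[OF tendsto_mult[OF assms(1,2)] assms(3)])

text \<open>The common source of summable error probabilities. Up to 1/p it is inherited from g or
  from p ln n -> 0, and for larger q from the comparison with 1/p.\<close>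

lemma q_ln: "(\<lambda>n. ln (real n) / q n) \<longlonglongrightarrow> 0"
proof (cases reg)
  case At_crit
  then have "\<forall>\<^sub>F n in sequentially. ln (real n) / crit r p n = ln (real n) / q n"
    using regime by (intro eventually_sequentiallyI[of 1]) auto
  then show ?thesis by (rule Lim_transform_eventually[OF crit_ln])
next
  case Below_inverse
  then have "(\<lambda>n. crit r p n / q n) \<longlonglongrightarrow> 0" using regime smalloD_tendsto by auto
  moreover have "\<forall>\<^sub>F n in sequentially. ln (real n) / crit r p n * (crit r p n / q n) = ln (real n) / q n"
  proof (rule eventually_sequentiallyI[of 1])
    fix n :: nat assume "1 \<le> n"
    then show "ln (real n) / crit r p n * (crit r p n / q n) = ln (real n) / q n"
      using crit_props(1)[of n] by simp
  qed
  ultimately show ?thesis using tendsto_mult_eq[OF crit_ln] by fastforce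
next
  case At_inverse
  then have "\<forall>\<^sub>F n in sequentially. p n * ln (real n) = ln (real n) / q n"
    using regime by (intro eventually_sequentiallyI[of 1]) auto
  then show ?thesis by (rule Lim_transform_eventually[OF p_ln])
next
  case Above_inverse
  then have "(\<lambda>n. 1 / p n) \<in> o(q)" using regime by simp
  then have "(\<lambda>n. 1 / p n / q n) \<longlonglongrightarrow> 0" by (rule smalloD_tendsto)
  moreover have "\<forall>\<^sub>F n in sequentially. p n * ln (real n) * (1 / p n / q n) = ln (real n) / q n"
    using p_pos by eventually_elim simp
  ultimately show ?thesis using tendsto_mult_eq[OF p_ln] by fastforce
qed

lemma q_top: "filterlim q at_top sequentially"
proof (rule filterlim_at_top_mono)
  show "filterlim (\<lambda>n. ln (real n)) at_top sequentially"
    by (rule filterlim_compose[OF ln_at_top filterlim_real_sequentially])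
  show "\<forall>\<^sub>F n in sequentially. ln (real n) \<le> q n"
    using order_tendstoD(2)[OF q_ln, of 1] q_pos by (auto elim: eventually_elim2 simp: divide_less_eq)
qed

lemma q_inverse: "(\<lambda>n. 1 / q n) \<longlonglongrightarrow> 0"
  using tendsto_inverse_0_at_top[OF q_top] by (simp add: inverse_eq_divide)

lemma qp_zero: "reg = At_crit \<or> reg = Below_inverse \<Longrightarrow> (\<lambda>n. q n * p n) \<longlonglongrightarrow> 0"
proof (elim disjE)
  assume "reg = At_crit"
  then have "\<forall>\<^sub>F n in sequentially. crit r p n * p n = q n * p n"
    using regime by (intro eventually_sequentiallyI[of 1]) auto
  then show ?thesis by (rule Lim_transform_eventually[OF crit_p])
next
  assume "reg = Below_inverse"
  then have "q \<in> o(\<lambda>n. 1 / p n)" using regime by simp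
  from smalloD_tendsto[OF this] show ?thesis by simp
qed

lemma q_small: "(\<lambda>n. q n / real n) \<longlonglongrightarrow> 0"
proof -
  have "\<forall>\<^sub>F n in sequentially. q n * p n * (1 / (real n * p n)) = q n / real n"
    using p_pos by eventually_elim simp
  then have small: ?thesis if "(\<lambda>n. q n * p n) \<longlonglongrightarrow> c" for c
    using tendsto_mult_eq[OF that np_inverse] by fastforce
  show ?thesis
  proof (cases reg)
    case At_inverse
    then have "\<forall>\<^sub>F n in sequentially. 1 = q n * p n"
      using regime p01 by (intro eventually_sequentiallyI[of 1]) auto
    then show ?thesis by (rule small[OF Lim_transform_eventually[OF tendsto_const]])
  next
    case Above_inverse
    then show ?thesis using regime smalloD_tendsto by auto
  qed (use qp_zero small in auto)
qed

lemma white_ratio: "(\<lambda>n. real (n_white a n) / real n) \<longlonglongrightarrow> 1"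
proof -
  have s: "(\<lambda>n. real (a S n) / real n) \<longlonglongrightarrow> 0" for S
  proof -
    have "\<forall>\<^sub>F n in sequentially. real (a S n) / q n * (q n / real n) = real (a S n) / real n"
      using q_pos by eventually_elim simp
    then show ?thesis using tendsto_mult_eq[OF seeds[of S] q_small] by fastforce
  qed
  have half: "\<forall>\<^sub>F n in sequentially. real (a S n) / real n < 1 / 2" for S
    using order_tendstoD(2)[OF s, of "1/2"] by simp
  have "(\<lambda>n. 1 - real (a Red n) / real n - real (a Black n) / real n) \<longlonglongrightarrow> 1 - 0 - 0"
    by (intro tendsto_intros s)
  moreover have "\<forall>\<^sub>F n in sequentially. 1 - real (a Red n) / real n - real (a Black n) / real n
      = real (n_white a n) / real n"
    using half[of Red] half[of Black] eventually_ge_at_top[of 1]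
  proof eventually_elim
    case (elim n)
    then have "real (a Red n) < real n / 2" "real (a Black n) < real n / 2" by (auto simp: divide_less_eq)
    then have "a Red n + a Black n \<le> n" by linarith
    then show ?case using elim by (simp add: n_white_def of_nat_diff diff_divide_distrib add_divide_distrib)
  qed
  ultimately show ?thesis using Lim_transform_eventually by fastforce
qed

lemma white_pos: "\<forall>\<^sub>F n in sequentially. 0 < n_white a n"
  using order_tendstoD(1)[OF white_ratio, of "1/2"] by (auto elim!: eventually_mono intro: gr0I)

section \<open>Limits of the normalised rates\<close>

definition scaled_count :: "nat \<Rightarrow> real \<Rightarrow> nat" where
  "scaled_count n x = nat \<lfloor>q n * x\<rfloor>"

lemma scaled_count_ratio:
  assumes "0 \<le> x"
  shows "(\<lambda>n. real (scaled_count n x) / q n) \<longlonglongrightarrow> x"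
proof (rule tendsto_sandwich)
  show "\<forall>\<^sub>F n in sequentially. real (scaled_count n x) / q n \<le> x"
    using q_pos
  proof eventually_elim
    case (elim n)
    then have "real (scaled_count n x) \<le> q n * x" using assms by (simp add: scaled_count_def)
    then show ?case using elim by (simp add: divide_le_eq mult.commute)
  qed
  show "\<forall>\<^sub>F n in sequentially. x - 1 / q n \<le> real (scaled_count n x) / q n"
    using q_pos
  proof eventually_elim
    case (elim n)
    have "q n * x - 1 \<le> real (scaled_count n x)" unfolding scaled_count_def by linarith
    then have "(q n * x - 1) / q n \<le> real (scaled_count n x) / q n"
      using elim by (intro divide_right_mono) auto
    then show ?case using elim by (simp add: diff_divide_distrib)
  qed
  show "(\<lambda>n. x - 1 / q n) \<longlonglongrightarrow> x" using tendsto_diff[OF tendsto_const q_inverse, of x] by simp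
qed simp

lemma scaled_count_mono: "0 < q n \<Longrightarrow> x \<le> y \<Longrightarrow> scaled_count n x \<le> scaled_count n y"
  unfolding scaled_count_def by (intro nat_mono floor_mono mult_left_mono) auto

abbreviation total :: "color \<Rightarrow> real \<Rightarrow> nat \<Rightarrow> nat" where
  "total S x n \<equiv> scaled_count n x + a S n"

lemma total_ratio:
  assumes "0 \<le> x"
  shows "(\<lambda>n. real (total S x n) / q n) \<longlonglongrightarrow> x + \<alpha> S"
  using tendsto_add[OF scaled_count_ratio[OF assms] seeds[of S]] by (simp add: add_divide_distrib)

lemma total_p_ratio:
  assumes "0 \<le> x"
  shows "(\<lambda>n. real (total S x n) * p n / (q n * p n)) \<longlonglongrightarrow> x + \<alpha> S"
  by (rule Lim_transform_eventually[OF total_ratio[OF assms]])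
    (use p_pos in eventually_elim, auto)

lemma qp_pos: "\<forall>\<^sub>F n in sequentially. 0 < q n * p n"
  using q_pos p_pos by eventually_elim auto

lemma p_over_qp: "(\<lambda>n. p n / (q n * p n)) \<longlonglongrightarrow> 0"
  by (rule Lim_transform_eventually[OF q_inverse]) (use p_pos in eventually_elim, auto)

lemma total_sparse:
  assumes "reg = At_crit \<or> reg = Below_inverse" "0 \<le> x"
  shows "(\<lambda>n. (1 - p n) ^ total S x n) \<longlonglongrightarrow> 1"
    "(\<lambda>n. bin_tail (total S x n) (p n) r / (q n * p n) ^ r) \<longlonglongrightarrow> (x + \<alpha> S) ^ r / fact r"
  using tendsto_bin_tail(2,3)[OF p_pos qp_pos qp_zero[OF assms(1)] p_over_qp total_p_ratio[OF assms(2)]]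
  by auto

text \<open>Below 1/p, \<eta> equals \<open>crit_const\<close> (q/g)^(r-1); in the two remaining
  regimes \<eta> = n/q. Macroscopic times divided by \<eta> thus tend to 0.\<close>

lemma eta_top:
  assumes "reg \<noteq> At_crit"
  shows "filterlim (eta reg r p q) at_top sequentially"
proof (cases reg)
  case Below_inverse
  have inf: "filterlim (\<lambda>n. q n / crit r p n) at_top sequentially"
  proof -
    have "(\<lambda>n. crit r p n / q n) \<longlonglongrightarrow> 0" using regime smalloD_tendsto Below_inverse by auto
    moreover have "\<forall>\<^sub>F n in sequentially. 0 < crit r p n / q n"
      using q_pos eventually_ge_at_top[of 1] by eventually_elim (use crit_props(1) in auto)
    ultimately have "filterlim (\<lambda>n. inverse (crit r p n / q n)) at_top sequentially"
      by (rule filterlim_inverse_at_top)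
    then show ?thesis by (simp add: inverse_eq_divide)
  qed
  have "filterlim (\<lambda>n. crit_const * (q n / crit r p n) ^ (r - 1)) at_top sequentially"
    using r2 crit_const_pos
    by (intro filterlim_tendsto_pos_mult_at_top[OF tendsto_const] filterlim_pow_at_top inf) auto
  moreover have "\<forall>\<^sub>F n in sequentially. crit_const * (q n / crit r p n) ^ (r - 1) = eta reg r p q n"
    using q_pos eventually_ge_at_top[of 1]
  proof eventually_elim
    case (elim n)
    have "q n ^ r = q n ^ (r - 1) * q n" using p_power_r by (metis power_Suc2)
    then show ?case
      using crit_props[OF elim(2)] elim unfolding Below_inverse crit_props(2)[OF elim(2), symmetric]
      by (simp add: power_mult_distrib power_divide field_simps)
  qed
  ultimately show ?thesis by (simp add: filterlim_cong[OF refl refl])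
next
  case At_crit
  then show ?thesis using assms by simp
next
  case At_inverse
  have "filterlim (\<lambda>n. inverse (q n / real n)) at_top sequentially"
  proof (rule filterlim_inverse_at_top[OF q_small])
    show "\<forall>\<^sub>F n in sequentially. 0 < q n / real n"
      using q_pos eventually_ge_at_top[of 1] by eventually_elim simp
  qed
  moreover have "eta reg r p q = (\<lambda>n. inverse (q n / real n))"
    using At_inverse by (simp add: fun_eq_iff inverse_eq_divide)
  ultimately show ?thesis by simp
next
  case Above_inverse
  have "filterlim (\<lambda>n. inverse (q n / real n)) at_top sequentially"
  proof (rule filterlim_inverse_at_top[OF q_small])
    show "\<forall>\<^sub>F n in sequentially. 0 < q n / real n"
      using q_pos eventually_ge_at_top[of 1] by eventually_elim simp
  qed
  moreover have "eta reg r p q = (\<lambda>n. inverse (q n / real n))"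
    using Above_inverse by (simp add: fun_eq_iff inverse_eq_divide)
  ultimately show ?thesis by simp
qed

text \<open>For q = g, \<open>crit_const\<close> equals q^(r-1) n p^r, so the expected number of
  nodes with r edges, divided by q, tends to \<open>crit_const\<close> (x + \<alpha>)^r / r!; the
  coefficient matches since r! = r (r-1)!.\<close>

lemma crit_rate:
  assumes "reg = At_crit" "0 \<le> x"
  shows "(\<lambda>n. real (n_white a n) * bin_tail (total S x n) (p n) r / q n) \<longlonglongrightarrow> own_rate reg r \<alpha> S x y"
proof -
  have "(\<lambda>n. real (n_white a n) / real n * (bin_tail (total S x n) (p n) r / (q n * p n) ^ r) * crit_const)
      \<longlonglongrightarrow> 1 * ((x + \<alpha> S) ^ r / fact r) * crit_const"
    by (intro tendsto_intros white_ratio total_sparse) (use assms in auto)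
  also have "1 * ((x + \<alpha> S) ^ r / fact r) * crit_const = own_rate reg r \<alpha> S x y"
  proof -
    have "fact r = real r * fact (r - 1)" using r2 by (simp add: fact_reduce)
    then show ?thesis using assms r2 by (simp add: own_rate_def crit_const_def field_simps)
  qed
  finally show ?thesis
  proof (rule Lim_transform_eventually)
    show "\<forall>\<^sub>F n in sequentially. real (n_white a n) / real n * (bin_tail (total S x n) (p n) r / (q n * p n) ^ r) * crit_const
        = real (n_white a n) * bin_tail (total S x n) (p n) r / q n"
      using q_pos p_pos eventually_ge_at_top[of 1]
    proof eventually_elim
      case (elim n)
      have c: "crit_const = q n ^ (r - 1) * (real n * p n ^ r)"
        using crit_props(2)[OF elim(3)] regime assms elim by simp
      have "q n ^ r = q n ^ (r - 1) * q n" using p_power_r by (metis power_Suc2)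
      then show ?case unfolding c using elim by (simp add: power_mult_distrib field_simps)
    qed
  qed
qed

lemma noncrit_rate:
  assumes reg: "reg \<noteq> At_crit" and dom: "rate_domain reg \<alpha> S x y"
  shows "(\<lambda>n. real (n_white a n) * bin_diff (total S x n) (total (other S) y n) (p n) r / (q n * eta reg r p q n))
    \<longlonglongrightarrow> own_rate reg r \<alpha> S x y"
proof -
  have xy: "0 \<le> x" "0 \<le> y" using dom by (auto simp: rate_domain_def)
  let ?D = "\<lambda>n. bin_diff (total S x n) (total (other S) y n) (p n) r"
  \<comment> \<open>\<open>w\<close> is (q p)^r below 1/p and 1 in the other two regimes; in each
    case q \<eta> = n w.\<close>
  have finish: "(\<lambda>n. real (n_white a n) * ?D n / (q n * eta reg r p q n)) \<longlonglongrightarrow> L"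
    if "(\<lambda>n. ?D n / w n) \<longlonglongrightarrow> L" "\<forall>\<^sub>F n in sequentially. q n * eta reg r p q n = real n * w n" for w L
  proof -
    have "\<forall>\<^sub>F n in sequentially. real (n_white a n) / real n * (?D n / w n)
        = real (n_white a n) * ?D n / (q n * eta reg r p q n)"
      using that(2) by eventually_elim simp
    from tendsto_mult_eq[OF white_ratio that(1) this] show ?thesis by simp
  qed
  show ?thesis
  proof (cases reg)
    case At_crit
    then show ?thesis using reg by simp
  next
    case Below_inverse
    have "(\<lambda>n. ?D n / (q n * p n) ^ r) \<longlonglongrightarrow> (x + \<alpha> S) ^ r / fact r"
      by (rule tendsto_bin_diff_sparse[OF p_pos qp_pos qp_zero p_over_qp total_p_ratio[OF xy(1)] total_p_ratio[OF xy(2)]])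
        (use Below_inverse in simp)
    then have "(\<lambda>n. real (n_white a n) * ?D n / (q n * eta reg r p q n)) \<longlonglongrightarrow> (x + \<alpha> S) ^ r / fact r"
      by (rule finish) (use q_pos Below_inverse in \<open>auto elim!: eventually_mono\<close>)
    then show ?thesis using Below_inverse by (simp add: own_rate_def)
  next
    case At_inverse
    have N: "(\<lambda>n. real (total S x n) * p n) \<longlonglongrightarrow> x + \<alpha> S" if "0 \<le> x" for x S
    proof (rule Lim_transform_eventually[OF total_ratio[OF that, of S]])
      show "\<forall>\<^sub>F n in sequentially. real (total S x n) / q n = real (total S x n) * p n"
        using regime At_inverse by (intro eventually_sequentiallyI[of 1]) auto
    qed
    have "(\<lambda>n. ?D n / 1) \<longlonglongrightarrow> (\<Sum>\<^sub>\<infinity>i\<in>{r..}. \<Sum>j=0..i - r. (x + \<alpha> S) ^ i / fact i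
        * ((y + \<alpha> (other S)) ^ j / fact j) * exp (- ((x + \<alpha> S) + (y + \<alpha> (other S)))))"
      unfolding div_by_1
      by (rule tendsto_bin_diff_poisson[OF p_pos p_tendsto N[OF xy(1)] N[OF xy(2)]])
    then have "(\<lambda>n. real (n_white a n) * ?D n / (q n * eta reg r p q n)) \<longlonglongrightarrow>
        (\<Sum>\<^sub>\<infinity>i\<in>{r..}. \<Sum>j=0..i - r. (x + \<alpha> S) ^ i / fact i
        * ((y + \<alpha> (other S)) ^ j / fact j) * exp (- ((x + \<alpha> S) + (y + \<alpha> (other S)))))"
      by (rule finish) (use q_pos At_inverse in \<open>auto elim!: eventually_mono\<close>)
    also have "(\<Sum>\<^sub>\<infinity>i\<in>{r..}. \<Sum>j=0..i - r. (x + \<alpha> S) ^ i / fact i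
        * ((y + \<alpha> (other S)) ^ j / fact j) * exp (- ((x + \<alpha> S) + (y + \<alpha> (other S))))) = own_rate reg r \<alpha> S x y"
      using At_inverse by (cases S) (simp_all add: own_rate_def algebra_simps)
    finally show ?thesis .
  next
    case Above_inverse
    have top: "filterlim (\<lambda>n. q n * p n) at_top sequentially"
    proof -
      have "(\<lambda>n. 1 / p n) \<in> o(q)" using regime Above_inverse by simp
      then have "(\<lambda>n. 1 / p n / q n) \<longlonglongrightarrow> 0" by (rule smalloD_tendsto)
      then have "filterlim (\<lambda>n. inverse (1 / p n / q n)) at_top sequentially"
        using q_pos p_pos by (intro filterlim_inverse_at_top) (auto elim: eventually_elim2)
      then show ?thesis by (simp add: inverse_eq_divide mult.commute)
    qed
    have ne: "x + \<alpha> S \<noteq> y + \<alpha> (other S)" using dom Above_inverse by (simp add: rate_domain_def)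
    have pos: "0 \<le> x + \<alpha> S" "0 \<le> y + \<alpha> (other S)" using xy \<alpha>_pos[of S] \<alpha>_pos[of "other S"] by auto
    note dense = tendsto_bin_diff_dense[OF p_pos top total_p_ratio[OF xy(1), of S] total_p_ratio[OF xy(2), of "other S"] pos, of r]
    have "(\<lambda>n. ?D n / 1) \<longlonglongrightarrow> (if y + \<alpha> (other S) < x + \<alpha> S then 1 else 0)"
      using dense ne by (auto simp: not_less)
    then have "(\<lambda>n. real (n_white a n) * ?D n / (q n * eta reg r p q n)) \<longlonglongrightarrow>
        (if y + \<alpha> (other S) < x + \<alpha> S then 1 else 0)"
      by (rule finish) (use q_pos Above_inverse in \<open>auto elim!: eventually_mono\<close>)
    also have "(if y + \<alpha> (other S) < x + \<alpha> S then 1 else 0) = own_rate reg r \<alpha> S x y"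
    proof -
      \<comment> \<open>A tie, for which \<open>beta\<close> would be 1 for both colours, is
        excluded by \<open>rate_domain\<close>.\<close>
      have "(y + \<alpha> (other S) < x + \<alpha> S) \<longleftrightarrow> 1 / 2 \<le> (x + \<alpha> S) / (x + \<alpha> S + (y + \<alpha> (other S)))"
        using pos ne xy \<alpha>_pos[of S] by (auto simp: field_simps)
      then show ?thesis using Above_inverse by (cases S) (simp_all add: own_rate_def add_ac)
    qed
    finally show ?thesis .
  qed
qed

end

locale process_setup = regime_setup + inputs M p "n_white a" X E L
  for M X E L
begin

text \<open>The limit of the coupling bound: as p = 1/q, the cost p per node turns differences of
  counts into differences of the scaled counts, with constant 1.\<close>

lemma at_inverse_lipschitz:
  assumes reg: "reg = At_inverse" and nn: "0 \<le> x" "0 \<le> y" "0 \<le> x'" "0 \<le> y'"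
  shows "\<bar>own_rate reg r \<alpha> S x y - own_rate reg r \<alpha> S x' y'\<bar> \<le> \<bar>x - x'\<bar> + \<bar>y - y'\<bar>"
proof -
  let ?D = "\<lambda>x y n. bin_diff (total S x n) (total (other S) y n) (p n) r"
  have dom: "rate_domain reg \<alpha> S x y" "rate_domain reg \<alpha> S x' y'" using nn reg by (auto simp: rate_domain_def)
  have lim: "(\<lambda>n. real (n_white a n) / real n * ?D x y n) \<longlonglongrightarrow> own_rate reg r \<alpha> S x y"
    if "0 \<le> x" "0 \<le> y" for x y
  proof (rule Lim_transform_eventually)
    show "(\<lambda>n. real (n_white a n) * ?D x y n / (q n * eta reg r p q n)) \<longlonglongrightarrow> own_rate reg r \<alpha> S x y"
      by (rule noncrit_rate) (use that reg in \<open>auto simp: rate_domain_def\<close>)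
    show "\<forall>\<^sub>F n in sequentially. real (n_white a n) * ?D x y n / (q n * eta reg r p q n) = real (n_white a n) / real n * ?D x y n"
      using q_pos by eventually_elim (use reg in simp)
  qed
  have left: "(\<lambda>n. \<bar>real (n_white a n) / real n * ?D x y n - real (n_white a n) / real n * ?D x' y' n\<bar>)
      \<longlonglongrightarrow> \<bar>own_rate reg r \<alpha> S x y - own_rate reg r \<alpha> S x' y'\<bar>"
    by (intro tendsto_intros lim nn)
  have right: "(\<lambda>n. real (n_white a n) / real n * (\<bar>real (scaled_count n x) / q n - real (scaled_count n x') / q n\<bar>
      + \<bar>real (scaled_count n y) / q n - real (scaled_count n y') / q n\<bar>)) \<longlonglongrightarrow> 1 * (\<bar>x - x'\<bar> + \<bar>y - y'\<bar>)"
    by (intro tendsto_intros white_ratio scaled_count_ratio nn)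
  have "\<bar>own_rate reg r \<alpha> S x y - own_rate reg r \<alpha> S x' y'\<bar> \<le> 1 * (\<bar>x - x'\<bar> + \<bar>y - y'\<bar>)"
  proof (rule tendsto_le[OF _ right left])
    show "\<forall>\<^sub>F n in sequentially. \<bar>real (n_white a n) / real n * ?D x y n - real (n_white a n) / real n * ?D x' y' n\<bar>
      \<le> real (n_white a n) / real n * (\<bar>real (scaled_count n x) / q n - real (scaled_count n x') / q n\<bar>
      + \<bar>real (scaled_count n y) / q n - real (scaled_count n y') / q n\<bar>)"
      using q_pos p_pos white_pos eventually_ge_at_top[of 1]
    proof eventually_elim
      case (elim n)
      have pq: "p n = 1 / q n" using regime reg elim by simp
      have "\<bar>?D x y n - ?D x' y' n\<bar> \<le> p n * (\<bar>real (total S x n) - real (total S x' n)\<bar>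
          + \<bar>real (total (other S) y n) - real (total (other S) y' n)\<bar>)"
        by (rule bin_diff_lipschitz) (use elim in auto)
      also have "\<dots> = \<bar>real (scaled_count n x) / q n - real (scaled_count n x') / q n\<bar>
          + \<bar>real (scaled_count n y) / q n - real (scaled_count n y') / q n\<bar>"
        unfolding pq using elim by (simp add: diff_divide_distrib[symmetric] abs_divide add_divide_distrib)
      finally have "real (n_white a n) / real n * \<bar>?D x y n - ?D x' y' n\<bar> \<le> real (n_white a n) / real n *
          (\<bar>real (scaled_count n x) / q n - real (scaled_count n x') / q n\<bar>
          + \<bar>real (scaled_count n y) / q n - real (scaled_count n y') / q n\<bar>)"
        by (intro mult_left_mono) auto
      then show ?case unfolding right_diff_distrib[symmetric] abs_mult by simp
    qed
  qed simp
  then show ?thesis by simp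
qed

end

section \<open>Discrete barriers around a trajectory\<close>

definition primitive_exp :: "real \<Rightarrow> real \<Rightarrow> real" where
  "primitive_exp d t = (if d = 0 then t else exp (d * t) / d)"

lemma primitive_exp_deriv: "(primitive_exp d has_real_derivative exp (d * t)) (at t within A)"
  unfolding primitive_exp_def by (cases "d = 0") (auto intro!: derivative_eq_intros)

lemma primitive_exp_mono: "s \<le> t \<Longrightarrow> primitive_exp d s \<le> primitive_exp d t"
  by (rule DERIV_nonneg_imp_nondecreasing[of s t "primitive_exp d"])
    (auto intro!: exI primitive_exp_deriv[of _ _ UNIV, simplified])

lemma primitive_exp_diff_le:
  assumes "0 \<le> d" "s \<le> t"
  shows "primitive_exp d t - primitive_exp d s \<le> exp (d * t) * (t - s)"
proof (cases "d = 0")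
  case False
  then have d: "0 < d" using assms by simp
  have "1 + (- (d * (t - s))) \<le> exp (- (d * (t - s)))" by (rule exp_ge_add_one_self)
  then have "1 - exp (- (d * (t - s))) \<le> d * (t - s)" by simp
  then have "exp (d * t) * (1 - exp (- (d * (t - s)))) \<le> exp (d * t) * (d * (t - s))"
    by (intro mult_left_mono) auto
  also have "exp (d * t) * (1 - exp (- (d * (t - s)))) = exp (d * t) - exp (d * s)"
    by (simp add: right_diff_distrib exp_add[symmetric] algebra_simps)
  finally have "exp (d * t) - exp (d * s) \<le> d * (exp (d * t) * (t - s))" by (simp add: mult_ac)
  then show ?thesis using d False
    by (simp add: primitive_exp_def diff_divide_distrib[symmetric] divide_le_eq mult_ac)
qed (simp add: primitive_exp_def)

lemma mono_of_deriv_within: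
  fixes f :: "real \<Rightarrow> real"
  assumes der: "\<And>x. x \<in> {a..b} \<Longrightarrow> (f has_real_derivative f' x) (at x within {a..b})"
    and nn: "\<And>x. x \<in> {a..b} \<Longrightarrow> 0 \<le> f' x" and xy: "a \<le> x" "x \<le> y" "y \<le> b"
  shows "f x \<le> f y"
proof (rule DERIV_nonneg_imp_increasing_open[OF xy(2)])
  fix z assume z: "x < z" "z < y"
  then have "at z within {a..b} = at z" using xy by (intro at_within_Icc_at) auto
  then show "\<exists>y. (f has_real_derivative y) (at z) \<and> 0 \<le> y"
    using der[of z] nn[of z] z xy by auto
next
  have "continuous_on {a..b} f" by (rule DERIV_continuous_on[OF der])
  then show "continuous_on {x..y} f" by (rule continuous_on_subset) (use xy in auto)
qed

text \<open>
  \<open>lam S x y\<close> is the normalised rate at which nodes become susceptible for colour \<open>S\<close> when the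
  counts of \<open>S\<close> and of the other colour are \<open>x\<close> and \<open>y\<close>; \<open>d\<close> is 1 if the coloured nodes have to be
  subtracted, and 0 if they are negligible.
\<close>

locale trajectory =
  fixes f :: "color \<Rightarrow> real \<Rightarrow> real" and \<tau> h :: "real \<Rightarrow> real"
    and lam :: "color \<Rightarrow> real \<Rightarrow> real \<Rightarrow> real" and d \<kappa> :: real
    and G :: "color \<Rightarrow> real \<Rightarrow> real \<Rightarrow> bool"
  assumes \<kappa>: "0 < \<kappa>" and d: "0 \<le> d" and \<tau>0: "\<tau> 0 = 0" and f0: "f S 0 = 0"
    and h: "x \<in> {0..\<kappa>} \<Longrightarrow> 0 < h x"
    and \<tau>': "x \<in> {0..\<kappa>} \<Longrightarrow> (\<tau> has_real_derivative h x) (at x within {0..\<kappa>})"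
    and f': "x \<in> {0..\<kappa>} \<Longrightarrow>
      (f S has_real_derivative (lam S (f S x) (f (other S) x) - d * f S x) * h x) (at x within {0..\<kappa>})"
    and f'_nonneg: "x \<in> {0..\<kappa>} \<Longrightarrow> 0 \<le> lam S (f S x) (f (other S) x) - d * f S x"
    and f'_pos: "d \<noteq> 0 \<Longrightarrow> \<exists>c>0. \<forall>S. \<forall>x\<in>{0..\<kappa>}. c \<le> lam S (f S x) (f (other S) x) - d * f S x"
    and nbhd: "\<exists>\<epsilon>0>0. \<exists>K\<ge>0. \<forall>S. \<forall>z\<in>{0..\<kappa>}. \<forall>x\<ge>0. \<forall>y\<ge>0.
      \<bar>x - f S z\<bar> \<le> \<epsilon>0 \<longrightarrow> \<bar>y - f (other S) z\<bar> \<le> \<epsilon>0 \<longrightarrow> G S x y \<and>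
      \<bar>lam S x y - lam S (f S z) (f (other S) z)\<bar> \<le> K * (\<bar>x - f S z\<bar> + \<bar>y - f (other S) z\<bar>)"
begin

lemma f_mono: "0 \<le> x \<Longrightarrow> x \<le> y \<Longrightarrow> y \<le> \<kappa> \<Longrightarrow> f S x \<le> f S y"
  by (rule mono_of_deriv_within[OF f']) (auto intro!: mult_nonneg_nonneg f'_nonneg less_imp_le[OF h])

lemma \<tau>_mono: "0 \<le> x \<Longrightarrow> x \<le> y \<Longrightarrow> y \<le> \<kappa> \<Longrightarrow> \<tau> x \<le> \<tau> y"
  by (rule mono_of_deriv_within[OF \<tau>']) (auto intro!: less_imp_le[OF h])

lemma f_nonneg: "0 \<le> x \<Longrightarrow> x \<le> \<kappa> \<Longrightarrow> 0 \<le> f S x"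
  using f_mono[of 0 x S] f0 by simp

text \<open>Comparison with constant rates on one block, after removing the damping by the factor \<open>exp (d * \<tau> x)\<close>.\<close>

lemma block_comparison:
  assumes ab: "0 \<le> a" "a \<le> b" "b \<le> \<kappa>"
  shows "(\<And>x. x \<in> {a..b} \<Longrightarrow> m \<le> lam S (f S x) (f (other S) x)) \<Longrightarrow>
      exp (d * \<tau> a) * f S a + m * (primitive_exp d (\<tau> b) - primitive_exp d (\<tau> a)) \<le> exp (d * \<tau> b) * f S b"
    and "(\<And>x. x \<in> {a..b} \<Longrightarrow> lam S (f S x) (f (other S) x) \<le> m) \<Longrightarrow>
      exp (d * \<tau> b) * f S b \<le> exp (d * \<tau> a) * f S a + m * (primitive_exp d (\<tau> b) - primitive_exp d (\<tau> a))"
proof -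
  define F where "F x = exp (d * \<tau> x) * f S x - m * primitive_exp d (\<tau> x)" for x
  have sub: "{a..b} \<subseteq> {0..\<kappa>}" using ab by auto
  have F': "(F has_real_derivative exp (d * \<tau> x) * h x * (lam S (f S x) (f (other S) x) - m)) (at x within {a..b})"
    if x: "x \<in> {a..b}" for x
  proof -
    have x\<kappa>: "x \<in> {0..\<kappa>}" using x sub by auto
    note D = DERIV_subset[OF \<tau>'[OF x\<kappa>] sub] DERIV_subset[OF f'[OF x\<kappa>] sub]
    have P: "((\<lambda>x. primitive_exp d (\<tau> x)) has_real_derivative exp (d * \<tau> x) * h x) (at x within {a..b})"
      by (rule DERIV_chain'[OF D(1) primitive_exp_deriv])
    show ?thesis
      unfolding F_def
      by (rule derivative_eq_intros D P refl)+ (simp add: algebra_simps)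
  qed
  { assume m: "\<And>x. x \<in> {a..b} \<Longrightarrow> m \<le> lam S (f S x) (f (other S) x)"
    have "F a \<le> F b"
      by (rule mono_of_deriv_within[OF F']) (use ab sub m h in \<open>auto intro!: mult_nonneg_nonneg less_imp_le[OF h]\<close>)
    then show "exp (d * \<tau> a) * f S a + m * (primitive_exp d (\<tau> b) - primitive_exp d (\<tau> a)) \<le> exp (d * \<tau> b) * f S b"
      by (simp add: F_def algebra_simps) }
  { assume m: "\<And>x. x \<in> {a..b} \<Longrightarrow> lam S (f S x) (f (other S) x) \<le> m"
    have "- F a \<le> - F b"
      by (rule mono_of_deriv_within[OF DERIV_minus[OF F']])
        (use ab sub m h in \<open>auto intro!: mult_nonneg_nonpos mult_nonneg_nonneg less_imp_le[OF h]\<close>)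
    then show "exp (d * \<tau> b) * f S b \<le> exp (d * \<tau> a) * f S a + m * (primitive_exp d (\<tau> b) - primitive_exp d (\<tau> a))"
      by (simp add: F_def algebra_simps) }
qed

text \<open>The weight of block j in the variation of constants formula for x' = lam - d x at time
  t_i, namely exp(-d t_i) times the integral of exp(d s) over the block. For d = 0 it is the length
  of the block.\<close>

definition weight :: "(nat \<Rightarrow> real) \<Rightarrow> nat \<Rightarrow> nat \<Rightarrow> real" where
  "weight t i j = exp (- d * t i) * (primitive_exp d (t (Suc j)) - primitive_exp d (t j))"

text \<open>The barriers are f \<plusminus> R on a fine mesh, with R = \<rho> exp(c t). Replacing
  the solution by the barriers changes a rate by a multiple of R, and the growth of R pays for this
  as in Gronwall's lemma. The invariant in the proof uses only three quarters of the margin; the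
  remaining quarter makes the inequalities strict, as the later deviation bounds require.\<close>

lemma barriers_exist:
  assumes "0 < \<epsilon>"
  obtains m t u l where "0 < m" "t 0 = 0" "\<And>i. i < m \<Longrightarrow> t i \<le> t (Suc i)" "t m = \<tau> \<kappa>"
    "\<And>S i. i \<le> m \<Longrightarrow> 0 < u S i" "\<And>S i. i \<le> m \<Longrightarrow> 0 \<le> l S i" "\<And>S. l S 0 = 0"
    "\<And>S i. i < m \<Longrightarrow> u S i \<le> u S (Suc i)"
    "\<And>S i. d \<noteq> 0 \<Longrightarrow> i < m \<Longrightarrow> l S i \<le> l S (Suc i)"
    "\<And>S. u S m \<le> f S \<kappa> + \<epsilon>" "\<And>S. f S \<kappa> - \<epsilon> \<le> l S m"
    "\<And>S i. i < m \<Longrightarrow> G S (u S (Suc i)) (l (other S) i)"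
    "\<And>S i. i < m \<Longrightarrow> G S (l S i) (u (other S) (Suc i))"
    "\<And>S i. i < m \<Longrightarrow> (\<Sum>j\<le>i. lam S (u S (Suc j)) (l (other S) j) * weight t (Suc i) j) < u S (Suc i)"
    "\<And>S i. i < m \<Longrightarrow> l S (Suc i) = 0 \<or>
      l S (Suc i) < (\<Sum>j\<le>i. lam S (l S j) (u (other S) (Suc j)) * weight t (Suc i) j)"
proof -
  obtain \<epsilon>0 K where \<epsilon>0: "0 < \<epsilon>0" and K: "0 \<le> K"
    and nb: "\<And>S z x y. z \<in> {0..\<kappa>} \<Longrightarrow> 0 \<le> x \<Longrightarrow> 0 \<le> y \<Longrightarrow> \<bar>x - f S z\<bar> \<le> \<epsilon>0 \<Longrightarrow>
      \<bar>y - f (other S) z\<bar> \<le> \<epsilon>0 \<Longrightarrow> G S x y \<and>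
      \<bar>lam S x y - lam S (f S z) (f (other S) z)\<bar> \<le> K * (\<bar>x - f S z\<bar> + \<bar>y - f (other S) z\<bar>)"
    using nbhd by metis
  obtain c0 where c0: "0 < c0"
    "\<And>S x. d \<noteq> 0 \<Longrightarrow> x \<in> {0..\<kappa>} \<Longrightarrow> c0 \<le> lam S (f S x) (f (other S) x) - d * f S x"
    using f'_pos by (cases "d = 0") (auto intro: that[of 1])
  \<comment> \<open>The rate error in a block is at most 3 K R, while three quarters of the margin
    grow at rate 3/4 c R.\<close>
  define c where "c = 4 * K"
  have c: "0 \<le> c" using K by (simp add: c_def)
  \<comment> \<open>Up to the final time the margin stays below \<epsilon>, inside the neighbourhood
    with Lipschitz rates, and below c0/(c+1); the last bound makes the lower barriers monotone when
    d is not 0.\<close>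
  define \<rho> where "\<rho> = min (min \<epsilon> (\<epsilon>0 / 2)) (c0 / (c + 1)) / exp (c * \<tau> \<kappa>)"
  have \<rho>: "0 < \<rho>" using assms \<epsilon>0 c0 c by (simp add: \<rho>_def)
  have \<rho>max: "\<rho> * exp (c * \<tau> \<kappa>) = min (min \<epsilon> (\<epsilon>0 / 2)) (c0 / (c + 1))" by (simp add: \<rho>_def)
  \<comment> \<open>The factor 6 gives 3 \<open>osc0\<close> \<le> \<rho>/2 \<le> R/2.\<close>
  define osc0 where "osc0 = min (\<rho> / 6) (\<epsilon>0 / 2)"
  have osc0: "0 < osc0" "osc0 \<le> \<rho> / 6" "osc0 \<le> \<epsilon>0 / 2" using \<rho> \<epsilon>0 by (auto simp: osc0_def)
  \<comment> \<open>Maximal duration of a block, such that R grows by at most the factor 5/4 in it.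
    Then 2 R(i+1) + 3 \<open>osc0\<close> \<le> (5/2 + 1/2) R(i).\<close>
  define \<xi> where "\<xi> = ln (5 / 4) / (c + 1)"
  have \<xi>: "0 < \<xi>" "exp (c * \<xi>) \<le> 5 / 4"
  proof -
    show "0 < \<xi>" using c by (simp add: \<xi>_def)
    have "c * \<xi> \<le> ln (5 / 4)" using c by (simp add: \<xi>_def divide_le_eq algebra_simps)
    then show "exp (c * \<xi>) \<le> 5 / 4" by (metis exp_le_cancel_iff exp_ln zero_less_divide_iff zero_less_numeral)
  qed
  have uc: "\<exists>\<delta>>0. \<forall>x\<in>{0..\<kappa>}. \<forall>y\<in>{0..\<kappa>}. \<bar>y - x\<bar> < \<delta> \<longrightarrow> \<bar>g y - g x\<bar> < e"
    if "continuous_on {0..\<kappa>} g" "0 < e" for g :: "real \<Rightarrow> real" and e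
  proof -
    have "uniformly_continuous_on {0..\<kappa>} g" by (rule compact_uniformly_continuous[OF that(1) compact_Icc])
    then show ?thesis using that(2) unfolding uniformly_continuous_on_def dist_real_def by blast
  qed
  have cf: "continuous_on {0..\<kappa>} (f S)" for S by (rule DERIV_continuous_on[OF f'])
  have c\<tau>: "continuous_on {0..\<kappa>} \<tau>" by (rule DERIV_continuous_on[OF \<tau>'])
  obtain \<delta>R where \<delta>R: "0 < \<delta>R" "\<And>x y. x \<in> {0..\<kappa>} \<Longrightarrow> y \<in> {0..\<kappa>} \<Longrightarrow> \<bar>y - x\<bar> < \<delta>R \<Longrightarrow> \<bar>f Red y - f Red x\<bar> < osc0"
    using uc[OF cf osc0(1), of Red] by metis
  obtain \<delta>B where \<delta>B: "0 < \<delta>B" "\<And>x y. x \<in> {0..\<kappa>} \<Longrightarrow> y \<in> {0..\<kappa>} \<Longrightarrow> \<bar>y - x\<bar> < \<delta>B \<Longrightarrow> \<bar>f Black y - f Black x\<bar> < osc0"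
    using uc[OF cf osc0(1), of Black] by metis
  obtain \<delta>T where \<delta>T: "0 < \<delta>T" "\<And>x y. x \<in> {0..\<kappa>} \<Longrightarrow> y \<in> {0..\<kappa>} \<Longrightarrow> \<bar>y - x\<bar> < \<delta>T \<Longrightarrow> \<bar>\<tau> y - \<tau> x\<bar> < \<xi>"
    using uc[OF c\<tau> \<xi>(1)] by metis
  define \<delta> where "\<delta> = min \<delta>R (min \<delta>B \<delta>T)"
  have \<delta>: "0 < \<delta>" using \<delta>R \<delta>B \<delta>T by (simp add: \<delta>_def)
  obtain m :: nat where m: "\<kappa> / \<delta> < real m" using reals_Archimedean2 by blast
  have m0: "0 < m" using m \<kappa> \<delta> by (metis divide_pos_pos less_trans of_nat_0_less_iff)
  have mesh: "\<kappa> / real m < \<delta>" using m m0 \<delta> by (simp add: field_simps)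
  define x where "x i = \<kappa> * real i / real m" for i
  have xI: "x i \<in> {0..\<kappa>}" if "i \<le> m" for i
    using that \<kappa> m0 by (simp add: x_def field_simps)
  have xS: "x i \<le> x (Suc i)" "x (Suc i) - x i < \<delta>" for i
    using mesh \<kappa> m0 by (auto simp: x_def field_simps)
  define t where "t i = \<tau> (x i)" for i
  have t_mono: "t i \<le> t (Suc i)" if "i < m" for i
    unfolding t_def using that xI[of i] xI[of "Suc i"] xS[of i] by (intro \<tau>_mono) auto
  have t_le: "t i \<le> \<tau> \<kappa>" if "i \<le> m" for i
    unfolding t_def using xI[OF that] by (intro \<tau>_mono) auto
  have osc: "\<bar>f S y - f S (x i)\<bar> \<le> osc0" if "i < m" "x i \<le> y" "y \<le> x (Suc i)" for S y i
  proof -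
    have "y \<in> {0..\<kappa>}" "\<bar>y - x i\<bar> < \<delta>" using that xI[of i] xI[of "Suc i"] xS[of i] by auto
    then show ?thesis using \<delta>R(2)[of "x i" y] \<delta>B(2)[of "x i" y] xI[of i] that(1)
      by (cases S) (auto simp: \<delta>_def less_imp_le)
  qed
  have t_step: "t (Suc i) - t i \<le> \<xi>" if "i < m" for i
    unfolding t_def using \<delta>T(2)[of "x i" "x (Suc i)"] xI[of i] xI[of "Suc i"] xS[of i] that
    by (auto simp: \<delta>_def)
  define R where "R i = \<rho> * exp (c * t i)" for i
  have R_pos: "\<rho> \<le> R i" "0 < R i" if "i \<le> m" for i
  proof -
    have "0 \<le> t i" unfolding t_def using \<tau>_mono[of 0 "x i"] xI[OF that] \<tau>0 by auto
    then have "1 \<le> exp (c * t i)" using c by simp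
    then show "\<rho> \<le> R i" using \<rho> by (simp add: R_def)
    then show "0 < R i" using \<rho> by simp
  qed
  have R_max: "R i \<le> min (min \<epsilon> (\<epsilon>0 / 2)) (c0 / (c + 1))" if "i \<le> m" for i
    unfolding \<rho>max[symmetric] R_def using \<rho> c t_le[OF that] by (intro mult_left_mono) (auto intro: mult_left_mono)
  have R_mono: "R i \<le> R (Suc i)" if "i < m" for i
    unfolding R_def using \<rho> c t_mono[OF that] by (intro mult_left_mono) (auto intro: mult_left_mono)
  have R_grow: "R i + c * (t (Suc i) - t i) * R i \<le> R (Suc i)" if "i < m" for i
  proof -
    have "1 + c * (t (Suc i) - t i) \<le> exp (c * (t (Suc i) - t i))" by (rule exp_ge_add_one_self)
    then have "R i * (1 + c * (t (Suc i) - t i)) \<le> R i * exp (c * (t (Suc i) - t i))"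
      using R_pos(2)[of i] that by (intro mult_left_mono) auto
    also have "\<dots> = R (Suc i)" by (simp add: R_def exp_add[symmetric] algebra_simps)
    finally show ?thesis by (simp add: algebra_simps)
  qed
  have R_ratio: "R (Suc i) \<le> 5 / 4 * R i" if "i < m" for i
  proof -
    have "R (Suc i) = R i * exp (c * (t (Suc i) - t i))" by (simp add: R_def exp_add[symmetric] algebra_simps)
    also have "\<dots> \<le> R i * exp (c * \<xi>)"
      using R_pos(2)[of i] that t_step[OF that] c by (intro mult_left_mono) (auto intro: mult_left_mono)
    also have "\<dots> \<le> R i * (5 / 4)" using R_pos(2)[of i] that \<xi> by (intro mult_left_mono) auto
    finally show ?thesis by simp
  qed
  define u where "u S i = f S (x i) + R i" for S i
  \<comment> \<open>The truncation keeps the barrier in the domain of the rates and makes it 0 at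
    the start.\<close>
  define l where "l S i = max 0 (f S (x i) - R i)" for S i
  have fx: "0 \<le> f S (x i)" if "i \<le> m" for S i using f_nonneg xI[OF that] by auto
  have fxS: "f S (x i) \<le> f S (x (Suc i))" if "i < m" for S i
    using f_mono xI[of i] xI[of "Suc i"] xS[of i] that by auto
  have uS: "\<bar>u S (Suc i) - f S (x i)\<bar> \<le> R (Suc i) + osc0" if "i < m" for S i
    using osc[of i "x (Suc i)" S] xS[of i] R_pos(2)[of "Suc i"] that by (simp add: u_def)
  have ll: "\<bar>l S i - f S (x i)\<bar> \<le> R i" if "i \<le> m" for S i
    using fx[OF that, of S] R_pos(2)[OF that] by (auto simp: l_def)
  have nonneg: "0 \<le> u S i" "0 \<le> l S i" if "i \<le> m" for S i
    using fx[OF that, of S] R_pos(2)[OF that] by (auto simp: u_def l_def)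
  have small: "R i + osc0 \<le> \<epsilon>0" "R i \<le> \<epsilon>0" if "i \<le> m" for i
    using R_max[OF that] osc0 \<epsilon>0 by auto
  define Lm where "Lm S i = lam S (f S (x i)) (f (other S) (x i))" for S i
  have nbU: "G S (u S (Suc i)) (l (other S) i) \<and>
      \<bar>lam S (u S (Suc i)) (l (other S) i) - Lm S i\<bar> \<le> K * (R (Suc i) + osc0 + R i)" if i: "i < m" for S i
  proof -
    have im: "i \<le> m" "Suc i \<le> m" using i by auto
    have *: "G S (u S (Suc i)) (l (other S) i) \<and> \<bar>lam S (u S (Suc i)) (l (other S) i) - Lm S i\<bar>
      \<le> K * (\<bar>u S (Suc i) - f S (x i)\<bar> + \<bar>l (other S) i - f (other S) (x i)\<bar>)"
      unfolding Lm_def using nonneg[OF im(2), of S] nonneg[OF im(1), of "other S"] small[OF im(1)] small[OF im(2)]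
        uS[OF i, of S] ll[OF im(1), of "other S"] xI[OF im(1)]
      by (intro nb) (auto intro: order_trans)
    have "K * (\<bar>u S (Suc i) - f S (x i)\<bar> + \<bar>l (other S) i - f (other S) (x i)\<bar>) \<le> K * (R (Suc i) + osc0 + R i)"
      using uS[OF i, of S] ll[OF im(1), of "other S"] K by (intro mult_left_mono) auto
    then show ?thesis using * by linarith
  qed
  have nbL: "G S (l S i) (u (other S) (Suc i)) \<and>
      \<bar>lam S (l S i) (u (other S) (Suc i)) - Lm S i\<bar> \<le> K * (R (Suc i) + osc0 + R i)" if i: "i < m" for S i
  proof -
    have im: "i \<le> m" "Suc i \<le> m" using i by auto
    have *: "G S (l S i) (u (other S) (Suc i)) \<and> \<bar>lam S (l S i) (u (other S) (Suc i)) - Lm S i\<bar>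
      \<le> K * (\<bar>l S i - f S (x i)\<bar> + \<bar>u (other S) (Suc i) - f (other S) (x i)\<bar>)"
      unfolding Lm_def using nonneg[OF im(2), of "other S"] nonneg[OF im(1), of S] small[OF im(1)] small[OF im(2)]
        uS[OF i, of "other S"] ll[OF im(1), of S] xI[OF im(1)]
      by (intro nb) (auto intro: order_trans)
    have "K * (\<bar>l S i - f S (x i)\<bar> + \<bar>u (other S) (Suc i) - f (other S) (x i)\<bar>) \<le> K * (R (Suc i) + osc0 + R i)"
      using uS[OF i, of "other S"] ll[OF im(1), of S] K by (intro mult_left_mono) auto
    then show ?thesis using * by linarith
  qed
  have nbf: "\<bar>lam S (f S y) (f (other S) y) - Lm S i\<bar> \<le> K * (2 * osc0)"
    if i: "i < m" and y: "y \<in> {x i..x (Suc i)}" for S i y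
  proof -
    have y\<kappa>: "0 \<le> y" "y \<le> \<kappa>" using y xI[of i] xI[of "Suc i"] i by auto
    have os: "\<bar>f S y - f S (x i)\<bar> \<le> osc0" for S using osc[OF i] y by auto
    have "\<bar>lam S (f S y) (f (other S) y) - Lm S i\<bar> \<le> K * (\<bar>f S y - f S (x i)\<bar> + \<bar>f (other S) y - f (other S) (x i)\<bar>)"
      unfolding Lm_def using nb[of "x i" "f S y" "f (other S) y" S] f_nonneg[OF y\<kappa>] os[of S] os[of "other S"] osc0 \<epsilon>0 xI[of i] i
      by auto
    also have "\<dots> \<le> K * (2 * osc0)" using os[of S] os[of "other S"] K by (intro mult_left_mono) auto
    finally show ?thesis .
  qed
  define P where "P i = primitive_exp d (t (Suc i)) - primitive_exp d (t i)" for i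
  have P: "0 \<le> P i" "P i \<le> exp (d * t (Suc i)) * (t (Suc i) - t i)" if "i < m" for i
    using primitive_exp_mono[OF t_mono[OF that]] primitive_exp_diff_le[OF d t_mono[OF that]] by (auto simp: P_def)
  \<comment> \<open>One step of the Gronwall argument, in the variables multiplied by exp(d t) in
    which the damping has disappeared.\<close>
  have step_err: "3 / 4 * (exp (d * t i) * R i) + K * (2 * R (Suc i) + 3 * osc0) * P i
      \<le> 3 / 4 * (exp (d * t (Suc i)) * R (Suc i))" if i: "i < m" for i
  proof -
    have Ri: "\<rho> \<le> R i" "0 < R i" using R_pos[of i] i by auto
    have \<Delta>: "0 \<le> t (Suc i) - t i" using t_mono[OF i] by simp
    have e: "exp (d * t i) \<le> exp (d * t (Suc i))" using t_mono[OF i] d by (simp add: mult_left_mono)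
    have "2 * R (Suc i) + 3 * osc0 \<le> 3 * R i" using R_ratio[OF i] osc0 Ri by simp
    then have "K * (2 * R (Suc i) + 3 * osc0) * P i \<le> K * (3 * R i) * (exp (d * t (Suc i)) * (t (Suc i) - t i))"
      using P[OF i] K Ri osc0(1) R_pos(2)[of "Suc i"] i by (intro mult_mono) auto
    also have "\<dots> = 3 / 4 * exp (d * t (Suc i)) * (c * (t (Suc i) - t i) * R i)" by (simp add: c_def)
    also have "\<dots> \<le> 3 / 4 * exp (d * t (Suc i)) * (R (Suc i) - R i)"
      using R_grow[OF i] by (intro mult_left_mono) auto
    also have "\<dots> = 3 / 4 * (exp (d * t (Suc i)) * R (Suc i)) - 3 / 4 * (exp (d * t (Suc i)) * R i)"
      by (simp only: right_diff_distrib mult.assoc)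
    finally have "K * (2 * R (Suc i) + 3 * osc0) * P i
        \<le> 3 / 4 * (exp (d * t (Suc i)) * R (Suc i)) - 3 / 4 * (exp (d * t (Suc i)) * R i)" .
    moreover have "exp (d * t i) * R i \<le> exp (d * t (Suc i)) * R i"
      by (rule mult_right_mono[OF e]) (use Ri in simp)
    ultimately show ?thesis by linarith
  qed
  have Kerr: "K * (R (Suc i) + osc0 + R i) + K * (2 * osc0) \<le> K * (2 * R (Suc i) + 3 * osc0)" if "i < m" for i
    unfolding distrib_left[symmetric] using R_mono[OF that] K by (intro mult_left_mono) auto
  have upper: "(\<Sum>j<i. lam S (u S (Suc j)) (l (other S) j) * P j)
      \<le> exp (d * t i) * f S (x i) + 3 / 4 * (exp (d * t i) * R i)" if "i \<le> m" for S i
    using that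
  proof (induction i)
    case 0
    then show ?case using f0 R_pos(2)[of 0] by (simp add: x_def)
  next
    case (Suc i)
    then have i: "i < m" by simp
    \<comment> \<open>A lower bound for the rate along the solution throughout the block. The rate
      at the barriers exceeds it by at most the error that \<open>step_err\<close> absorbs.\<close>
    define \<mu> where "\<mu> = Lm S i - K * (2 * osc0)"
    have "exp (d * t i) * f S (x i) + \<mu> * P i \<le> exp (d * t (Suc i)) * f S (x (Suc i))"
      unfolding t_def P_def
    proof (rule block_comparison(1))
      fix y assume "y \<in> {x i..x (Suc i)}"
      then show "\<mu> \<le> lam S (f S y) (f (other S) y)" using nbf[OF i, of y S] by (simp add: \<mu>_def abs_le_iff)
    qed (use xI[of i] xI[of "Suc i"] xS[of i] i in auto)
    moreover have "lam S (u S (Suc i)) (l (other S) i) \<le> \<mu> + K * (2 * R (Suc i) + 3 * osc0)"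
      using nbU[OF i, of S] Kerr[OF i] by (simp add: \<mu>_def abs_le_iff)
    then have "lam S (u S (Suc i)) (l (other S) i) * P i \<le> \<mu> * P i + K * (2 * R (Suc i) + 3 * osc0) * P i"
      using P(1)[OF i] by (metis distrib_right mult_right_mono)
    moreover note Suc.IH[OF less_imp_le[OF i]] step_err[OF i]
    ultimately show ?case unfolding sum.lessThan_Suc by linarith
  qed
  have lower: "exp (d * t i) * f S (x i) - 3 / 4 * (exp (d * t i) * R i)
      \<le> (\<Sum>j<i. lam S (l S j) (u (other S) (Suc j)) * P j)" if "i \<le> m" for S i
    using that
  proof (induction i)
    case 0
    then show ?case using f0 R_pos(2)[of 0] by (simp add: x_def)
  next
    case (Suc i)
    then have i: "i < m" by simp
    define \<mu> where "\<mu> = Lm S i + K * (2 * osc0)"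
    have "exp (d * t (Suc i)) * f S (x (Suc i)) \<le> exp (d * t i) * f S (x i) + \<mu> * P i"
      unfolding t_def P_def
    proof (rule block_comparison(2))
      fix y assume "y \<in> {x i..x (Suc i)}"
      then show "lam S (f S y) (f (other S) y) \<le> \<mu>" using nbf[OF i, of y S] by (simp add: \<mu>_def abs_le_iff)
    qed (use xI[of i] xI[of "Suc i"] xS[of i] i in auto)
    moreover have "\<mu> - K * (2 * R (Suc i) + 3 * osc0) \<le> lam S (l S i) (u (other S) (Suc i))"
      using nbL[OF i, of S] Kerr[OF i] by (simp add: \<mu>_def abs_le_iff)
    then have "\<mu> * P i - K * (2 * R (Suc i) + 3 * osc0) * P i \<le> lam S (l S i) (u (other S) (Suc i)) * P i"
      using P(1)[OF i] by (metis left_diff_distrib mult_right_mono)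
    moreover note Suc.IH[OF less_imp_le[OF i]] step_err[OF i]
    ultimately show ?case unfolding sum.lessThan_Suc by linarith
  qed
  have wt: "(\<Sum>j\<le>i. g j * weight t (Suc i) j) = exp (- d * t (Suc i)) * (\<Sum>j<Suc i. g j * P j)" for g i
    by (simp add: weight_def P_def sum_distrib_left mult_ac lessThan_Suc_atMost)
  have e1: "exp (- d * s) * (exp (d * s) * z) = z" for s z :: real
    by (simp add: mult.assoc[symmetric] exp_add[symmetric])
  have e2: "exp (- d * s) * (exp (d * s) * z + 3 / 4 * (exp (d * s) * z')) = z + 3 / 4 * z'" for s z z' :: real
  proof -
    have "exp (d * s) * z + 3 / 4 * (exp (d * s) * z') = exp (d * s) * (z + 3 / 4 * z')"
      by (simp add: distrib_left)
    then show ?thesis by (simp only: e1)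
  qed
  have e3: "exp (- d * s) * (exp (d * s) * z - 3 / 4 * (exp (d * s) * z')) = z - 3 / 4 * z'" for s z z' :: real
    using e2[of s z "-z'"] by simp
  have xm: "x m = \<kappa>" using m0 by (simp add: x_def)
  show thesis
  proof (rule that[of m t u l])
    show "0 < m" "t 0 = 0" "t m = \<tau> \<kappa>" using m0 \<tau>0 xm by (auto simp: t_def x_def)
    show "t i \<le> t (Suc i)" if "i < m" for i by (rule t_mono[OF that])
    show "0 < u S i" if "i \<le> m" for S i
      using fx[OF that, of S] R_pos(2)[OF that] by (simp add: u_def)
    show "0 \<le> l S i" if "i \<le> m" for S i using nonneg[OF that] by auto
    show "l S 0 = 0" for S using f0[of S] R_pos(2)[of 0] by (simp add: l_def x_def)
    show "u S i \<le> u S (Suc i)" if "i < m" for S i using fxS[OF that] R_mono[OF that] by (simp add: u_def add_mono)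
    \<comment> \<open>Per unit of time f increases by at least c0, whereas R increases by at most c
      R \<le> c c0/(c+1) \<le> c0.\<close>
    show "l S i \<le> l S (Suc i)" if dn: "d \<noteq> 0" and i: "i < m" for S i
    proof -
      have "R (Suc i) - R i \<le> c0 * (t (Suc i) - t i)"
      proof -
        have "1 + (- (c * (t (Suc i) - t i))) \<le> exp (- (c * (t (Suc i) - t i)))" by (rule exp_ge_add_one_self)
        then have "R (Suc i) * (1 - c * (t (Suc i) - t i)) \<le> R (Suc i) * exp (- (c * (t (Suc i) - t i)))"
          using R_pos(2)[of "Suc i"] i by (intro mult_left_mono) auto
        also have "\<dots> = R i" by (simp add: R_def exp_add[symmetric] algebra_simps)
        finally have "R (Suc i) - R i \<le> c * R (Suc i) * (t (Suc i) - t i)" by (simp add: algebra_simps)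
        also have "c * R (Suc i) \<le> c * (c0 / (c + 1))" using R_max[of "Suc i"] i c by (intro mult_left_mono) auto
        also have "\<dots> \<le> c0" using c c0 by (simp add: field_simps)
        finally show ?thesis using t_mono[OF i] by (simp add: mult_right_mono)
      qed
      also have "c0 * (t (Suc i) - t i) \<le> f S (x (Suc i)) - f S (x i)"
      proof -
        have "f S (x i) - c0 * \<tau> (x i) \<le> f S (x (Suc i)) - c0 * \<tau> (x (Suc i))"
        proof (rule mono_of_deriv_within[where a=0 and b=\<kappa> and f="\<lambda>y. f S y - c0 * \<tau> y" and
              f'="\<lambda>y. (lam S (f S y) (f (other S) y) - d * f S y - c0) * h y"])
          fix y assume y: "y \<in> {0..\<kappa>}"
          show "((\<lambda>y. f S y - c0 * \<tau> y) has_real_derivative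
              (lam S (f S y) (f (other S) y) - d * f S y - c0) * h y) (at y within {0..\<kappa>})"
            by (rule derivative_eq_intros f'[OF y] \<tau>'[OF y] refl)+ (simp add: algebra_simps)
          show "0 \<le> (lam S (f S y) (f (other S) y) - d * f S y - c0) * h y"
            using c0(2)[OF dn y] h[OF y] by (intro mult_nonneg_nonneg) auto
        qed (use xI[of i] xI[of "Suc i"] xS[of i] i in auto)
        then show ?thesis by (simp add: t_def algebra_simps)
      qed
      finally show ?thesis by (auto simp: l_def)
    qed
    show "u S m \<le> f S \<kappa> + \<epsilon>" for S using R_max[of m] by (simp add: u_def xm)
    show "f S \<kappa> - \<epsilon> \<le> l S m" for S using R_max[of m] by (auto simp: l_def xm)
    show "G S (u S (Suc i)) (l (other S) i)" if "i < m" for S i using nbU[OF that] by blast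
    show "G S (l S i) (u (other S) (Suc i))" if "i < m" for S i using nbL[OF that] by blast
    show "(\<Sum>j\<le>i. lam S (u S (Suc j)) (l (other S) j) * weight t (Suc i) j) < u S (Suc i)" if i: "i < m" for S i
    proof -
      have "(\<Sum>j\<le>i. lam S (u S (Suc j)) (l (other S) j) * weight t (Suc i) j)
          \<le> exp (- d * t (Suc i)) * (exp (d * t (Suc i)) * f S (x (Suc i)) + 3 / 4 * (exp (d * t (Suc i)) * R (Suc i)))"
        unfolding wt using upper[of "Suc i" S] i by (intro mult_left_mono) auto
      also have "\<dots> = f S (x (Suc i)) + 3 / 4 * R (Suc i)"
        by (rule e2)
      also have "\<dots> < u S (Suc i)" using R_pos(2)[of "Suc i"] i by (simp add: u_def)
      finally show ?thesis .
    qed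
    \<comment> \<open>A truncated barrier holds trivially; the strict comparison would fail there
      when f vanishes identically.\<close>
    show "l S (Suc i) = 0 \<or> l S (Suc i) < (\<Sum>j\<le>i. lam S (l S j) (u (other S) (Suc j)) * weight t (Suc i) j)"
      if i: "i < m" for S i
    proof -
      have "exp (- d * t (Suc i)) * (exp (d * t (Suc i)) * f S (x (Suc i)) - 3 / 4 * (exp (d * t (Suc i)) * R (Suc i)))
          \<le> (\<Sum>j\<le>i. lam S (l S j) (u (other S) (Suc j)) * weight t (Suc i) j)"
        unfolding wt using lower[of "Suc i" S] i by (intro mult_left_mono) auto
      moreover have "exp (- d * t (Suc i)) * (exp (d * t (Suc i)) * f S (x (Suc i)) - 3 / 4 * (exp (d * t (Suc i)) * R (Suc i)))
          = f S (x (Suc i)) - 3 / 4 * R (Suc i)"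
        by (rule e3)
      ultimately show ?thesis using R_pos(2)[of "Suc i"] i by (auto simp: l_def max_def)
    qed
  qed
qed

end

section \<open>The process stays between the barriers\<close>

text \<open>In the critical regime \<open>K j - K (j - 1)\<close> is the probability that a node
  becomes susceptible in block j and \<open>a j\<close> that it rings between the start of block j
  and the final time. As \<open>a (Suc i)\<close> is then 0, the right-hand side is the sum with the
  weights \<open>weight\<close>.\<close>

lemma abel_summation:
  fixes K a :: "nat \<Rightarrow> real"
  shows "(\<Sum>j\<le>i. (K j - (if j = 0 then 0 else K (j - 1))) * a j)
    = (\<Sum>j\<le>i. K j * (a j - a (Suc j))) + K i * a (Suc i)"
  by (induction i) (auto simp: algebra_simps)

lemma node_pred_deg: "(\<lambda>z. fst z (S, N)) \<in> borel_measurable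
    (PiM (UNIV :: (color \<times> nat) set) (\<lambda>_. borel :: real measure) \<Otimes>\<^sub>M PiM (UNIV :: nat set) (\<lambda>_. borel :: real measure))"
  by (rule measurable_compose[OF measurable_fst measurable_component_singleton]) simp

lemma node_pred_rings: "Measurable.pred
    (PiM (UNIV :: (color \<times> nat) set) (\<lambda>_. borel :: real measure) \<Otimes>\<^sub>M PiM (UNIV :: nat set) (\<lambda>_. borel :: real measure))
    (\<lambda>z. rings_in (snd z) s t)"
  by (rule measurable_compose[OF measurable_snd edge_pred_ring])

section \<open>Almost sure bounds for numbers of nodes\<close>

context process_setup
begin

abbreviation (input) "waits n v \<omega> \<equiv> (\<lambda>j. X n v j \<omega>)"

abbreviation "node_count n \<omega> \<equiv> good_bootstrap.count r (n_white a n) (\<lambda>S. a S n) (\<lambda>v j. X n v j \<omega>)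
    (\<lambda>S v i. E n S v i \<omega>) (\<lambda>k. L n k \<omega>)"

text \<open>As q >> ln n, the terms are eventually at most n^(-2).\<close>

lemma exp_q_summable:
  assumes "0 < c"
  shows "summable (\<lambda>n. exp (- c * q n))"
proof (rule summable_comparison_test_ev)
  show "summable (\<lambda>n. inverse (real n ^ 2))" by (rule inverse_power_summable) simp
  have "\<forall>\<^sub>F n in sequentially. ln (real n) / q n < c / 2"
    using order_tendstoD(2)[OF q_ln, of "c / 2"] assms by simp
  then show "\<forall>\<^sub>F n in sequentially. norm (exp (- c * q n)) \<le> inverse (real n ^ 2)"
    using q_pos eventually_ge_at_top[of 1]
  proof eventually_elim
    case (elim n)
    then have "2 * ln (real n) \<le> c * q n" by (simp add: field_simps)
    then have "exp (- c * q n) \<le> exp (- (2 * ln (real n)))" by simp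
    also have "\<dots> = inverse (real n ^ 2)"
    proof -
      have "2 * ln (real n) = ln (real n ^ 2)" using elim by (simp add: ln_realpow)
      moreover have "exp (ln (real n ^ 2)) = real n ^ 2" using elim by (intro exp_ln) simp
      ultimately show ?thesis by (simp only: exp_minus)
    qed
    finally show ?case by simp
  qed
qed

lemma count_sets:
  assumes "node_pred \<Phi>" and P: "Measurable.pred borel P"
  shows "{\<omega>\<in>space M. P (real (card {v\<in>{..<n_white a n}. \<Phi> (deg_at n v \<omega>) (waits n v \<omega>)}))} \<in> sets M"
proof -
  let ?C = "\<lambda>\<omega>. real (card {v\<in>{..<n_white a n}. \<Phi> (deg_at n v \<omega>) (waits n v \<omega>)})"
  have "(\<lambda>\<omega>. \<Sum>v<n_white a n. of_bool (\<Phi> (deg_at n v \<omega>) (waits n v \<omega>)) :: real) \<in> borel_measurable M"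
    using node_events_indep[OF assms(1), of n] by (intro borel_measurable_sum) (auto simp: indep_vars_def)
  then have C: "?C \<in> borel_measurable M" by (simp add: Int_def)
  have "?C -` {x. P x} \<inter> space M \<in> sets M"
    using P by (intro measurable_sets[OF C]) (simp add: pred_def)
  moreover have "?C -` {x. P x} \<inter> space M = {\<omega>\<in>space M. P (?C \<omega>)}"
    by (rule set_eqI) (simp only: vimage_eq Int_iff mem_Collect_eq conj_commute)
  ultimately show ?thesis by (simp only:)
qed

text \<open>The Chernoff bound and the first Borel-Cantelli lemma. The mean is eventually at most b
  q with b strictly between its scaled limit c and u, so an excess beyond u q has a probability
  exponentially small in q.\<close>

lemma AE_count_less:
  assumes \<Phi>: "\<And>n. node_pred (\<Phi> n)"
    and P: "\<forall>\<^sub>F n in sequentially. \<forall>v<n_white a n.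
      prob {\<omega>\<in>space M. \<Phi> n (deg_at n v \<omega>) (waits n v \<omega>)} \<le> P n"
    and lim: "(\<lambda>n. real (n_white a n) * P n / q n) \<longlonglongrightarrow> c" and cu: "c < u" and u: "0 < u"
  shows "AE \<omega> in M. \<forall>\<^sub>F n in sequentially.
    real (card {v\<in>{..<n_white a n}. \<Phi> n (deg_at n v \<omega>) (waits n v \<omega>)}) < q n * u"
proof -
  let ?C = "\<lambda>n \<omega>. real (card {v\<in>{..<n_white a n}. \<Phi> n (deg_at n v \<omega>) (waits n v \<omega>)})"
  define A where "A n = {\<omega>\<in>space M. ?C n \<omega> \<ge> q n * u}" for n
  have A: "A n \<in> sets M" for n
    unfolding A_def by (rule count_sets[OF \<Phi>]) measurable
  define b where "b = max ((c + u) / 2) 0"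
  have b: "c < b" "b < u" "0 \<le> b" using cu u by (auto simp: b_def max_def field_simps)
  \<comment> \<open>This makes \<theta> b \<le> (u-b)/2, so the quadratic term of the exponent costs
    at most half of the gain \<theta>(u-b) q; the other half is \<delta> q.\<close>
  define \<theta> where "\<theta> = min 1 ((u - b) / (2 * (b + 1)))"
  have \<theta>: "0 < \<theta>" "\<theta> \<le> 1" "\<theta> \<le> (u - b) / (2 * (b + 1))" using b by (auto simp: \<theta>_def)
  define \<delta> where "\<delta> = \<theta> * (u - b) / 2"
  have \<delta>: "0 < \<delta>" using \<theta> b by (simp add: \<delta>_def)
  have bound: "\<forall>\<^sub>F n in sequentially. norm (prob (A n)) \<le> exp (- \<delta> * q n)"
    using P order_tendstoD(2)[OF lim b(1)] q_pos
  proof eventually_elim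
    case (elim n)
    have le: "(\<Sum>v<n_white a n. prob {\<omega>\<in>space M. \<Phi> n (deg_at n v \<omega>) (waits n v \<omega>)}) \<le> b * q n"
    proof -
      have "(\<Sum>v<n_white a n. prob {\<omega>\<in>space M. \<Phi> n (deg_at n v \<omega>) (waits n v \<omega>)}) \<le> (\<Sum>v<n_white a n. P n)"
        using elim by (intro sum_mono) auto
      also have "\<dots> \<le> b * q n" using elim by (simp add: divide_less_eq)
      finally show ?thesis .
    qed
    have "prob (A n) \<le> exp (- \<theta> * (q n * u) + b * q n * (\<theta> + \<theta>\<^sup>2))"
      unfolding A_def by (rule count_upper_tail[OF _ node_events_indep[OF \<Phi>] le \<theta>(1,2)]) simp
    also have "\<dots> \<le> exp (- \<delta> * q n)"
    proof -
      have "\<theta> * (2 * (b + 1)) \<le> u - b" using \<theta>(3) b by (simp add: field_simps)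
      then have "\<theta> * b \<le> (u - b) / 2" using \<theta> by (simp add: algebra_simps)
      then have "\<theta> * (\<theta> * b) \<le> \<theta> * ((u - b) / 2)" using \<theta> by (intro mult_left_mono) auto
      then have "q n * (\<theta> * (\<theta> * b)) \<le> q n * (\<theta> * ((u - b) / 2))" by (rule mult_left_mono) (use elim in auto)
      moreover have "- \<theta> * (q n * u) + b * q n * (\<theta> + \<theta>\<^sup>2) = q n * (\<theta> * (\<theta> * b)) - 2 * (q n * (\<theta> * ((u - b) / 2)))"
        by (simp add: field_simps power2_eq_square)
      moreover have "- \<delta> * q n = - (q n * (\<theta> * ((u - b) / 2)))" by (simp add: \<delta>_def)
      ultimately show ?thesis unfolding exp_le_cancel_iff by linarith
    qed
    finally show ?case by simp
  qed
  have "summable (\<lambda>n. prob (A n))"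
    by (rule summable_comparison_test_ev[OF bound exp_q_summable[OF \<delta>]])
  then have "AE \<omega> in M. \<forall>\<^sub>F n in sequentially. \<omega> \<in> space M - A n"
    using A by (intro borel_cantelli_AE1) (auto simp: emeasure_eq_measure)
  then show ?thesis
    by eventually_elim (auto simp: A_def not_le elim: eventually_mono)
qed

lemma AE_count_greater:
  assumes \<Phi>: "\<And>n. node_pred (\<Phi> n)"
    and P: "\<forall>\<^sub>F n in sequentially. \<forall>v<n_white a n.
      P n \<le> prob {\<omega>\<in>space M. \<Phi> n (deg_at n v \<omega>) (waits n v \<omega>)}"
    and lim: "(\<lambda>n. real (n_white a n) * P n / q n) \<longlonglongrightarrow> c" and cl: "l < c" and l: "0 \<le> l"
  shows "AE \<omega> in M. \<forall>\<^sub>F n in sequentially.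
    q n * l < real (card {v\<in>{..<n_white a n}. \<Phi> n (deg_at n v \<omega>) (waits n v \<omega>)})"
proof -
  let ?C = "\<lambda>n \<omega>. real (card {v\<in>{..<n_white a n}. \<Phi> n (deg_at n v \<omega>) (waits n v \<omega>)})"
  define A where "A n = {\<omega>\<in>space M. ?C n \<omega> \<le> q n * l}" for n
  have A: "A n \<in> sets M" for n
    unfolding A_def by (rule count_sets[OF \<Phi>]) measurable
  define b where "b = (c + l) / 2"
  have b: "b < c" "l < b" "0 < b" using cl l by (auto simp: b_def)
  \<comment> \<open>As for the upper tail: \<theta> b \<le> (b-l)/2, so half of the gain
    \<theta>(b-l) q survives as \<delta> q.\<close>
  define \<theta> where "\<theta> = min 1 ((b - l) / (2 * b))"
  have \<theta>: "0 < \<theta>" "\<theta> \<le> 1" "\<theta> \<le> (b - l) / (2 * b)" using b by (auto simp: \<theta>_def)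
  define \<delta> where "\<delta> = \<theta> * (b - l) / 2"
  have \<delta>: "0 < \<delta>" using \<theta> b by (simp add: \<delta>_def)
  have bound: "\<forall>\<^sub>F n in sequentially. norm (prob (A n)) \<le> exp (- \<delta> * q n)"
    using P order_tendstoD(1)[OF lim b(1)] q_pos
  proof eventually_elim
    case (elim n)
    have le: "b * q n \<le> (\<Sum>v<n_white a n. prob {\<omega>\<in>space M. \<Phi> n (deg_at n v \<omega>) (waits n v \<omega>)})"
    proof -
      have "b * q n \<le> (\<Sum>v<n_white a n. P n)" using elim by (simp add: less_divide_eq)
      also have "\<dots> \<le> (\<Sum>v<n_white a n. prob {\<omega>\<in>space M. \<Phi> n (deg_at n v \<omega>) (waits n v \<omega>)})"
        using elim by (intro sum_mono) auto
      finally show ?thesis .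
    qed
    have "prob (A n) \<le> exp (\<theta> * (q n * l) - b * q n * (\<theta> - \<theta>\<^sup>2))"
      unfolding A_def by (rule count_lower_tail[OF _ node_events_indep[OF \<Phi>] le \<theta>(1,2)]) (use b elim in auto)
    also have "\<dots> \<le> exp (- \<delta> * q n)"
    proof -
      have "\<theta> * b \<le> (b - l) / 2" using \<theta>(3) b by (simp add: field_simps)
      then have "\<theta> * (\<theta> * b) \<le> \<theta> * ((b - l) / 2)" using \<theta> by (intro mult_left_mono) auto
      then have "q n * (\<theta> * (\<theta> * b)) \<le> q n * (\<theta> * ((b - l) / 2))" by (rule mult_left_mono) (use elim in auto)
      moreover have "\<theta> * (q n * l) - b * q n * (\<theta> - \<theta>\<^sup>2) = q n * (\<theta> * (\<theta> * b)) - 2 * (q n * (\<theta> * ((b - l) / 2)))"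
        by (simp add: field_simps power2_eq_square)
      moreover have "- \<delta> * q n = - (q n * (\<theta> * ((b - l) / 2)))" by (simp add: \<delta>_def)
      ultimately show ?thesis unfolding exp_le_cancel_iff by linarith
    qed
    finally show ?case by simp
  qed
  have "summable (\<lambda>n. prob (A n))"
    by (rule summable_comparison_test_ev[OF bound exp_q_summable[OF \<delta>]])
  then have "AE \<omega> in M. \<forall>\<^sub>F n in sequentially. \<omega> \<in> space M - A n"
    using A by (intro borel_cantelli_AE1) (auto simp: emeasure_eq_measure)
  then show ?thesis
    by eventually_elim (auto simp: A_def not_le elim: eventually_mono)
qed

lemma eta_pos: "\<forall>\<^sub>F n in sequentially. 0 < eta reg r p q n"
  using q_pos p_pos eventually_ge_at_top[of 1]
  by eventually_elim (cases reg; simp)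

text \<open>The derivative of 1 - exp(-t x) at x = 0, along x = 1/\<eta>.\<close>

lemma eta_exp_limit:
  assumes reg: "reg \<noteq> At_crit"
  shows "(\<lambda>n. eta reg r p q n * (1 - exp (- (t / eta reg r p q n)))) \<longlonglongrightarrow> t"
proof -
  let ?e = "eta reg r p q"
  have "((\<lambda>x. 1 - exp (- (t * x))) has_real_derivative t) (at 0)"
    by (auto intro!: derivative_eq_intros)
  then have D: "((\<lambda>x. (1 - exp (- (t * x))) / x) \<longlongrightarrow> t) (at 0)"
    unfolding DERIV_def by simp
  have "(\<lambda>n. inverse (?e n)) \<longlonglongrightarrow> 0" by (rule tendsto_inverse_0_at_top[OF eta_top[OF reg]])
  moreover have "\<forall>\<^sub>F n in sequentially. inverse (?e n) \<noteq> 0" using eta_pos by eventually_elim auto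
  ultimately have "filterlim (\<lambda>n. inverse (?e n)) (at 0) sequentially"
    by (auto simp: filterlim_at)
  then have "(\<lambda>n. (1 - exp (- (t * inverse (?e n)))) / inverse (?e n)) \<longlonglongrightarrow> t"
    by (rule filterlim_compose[OF D])
  then show ?thesis by (simp add: divide_inverse mult.commute)
qed

lemma prob_rings_at:
  assumes v: "v < n_white a n" and st: "0 \<le> s" "s \<le> t"
  shows "prob {\<omega>\<in>space M. rings_in (waits n v \<omega>) s t} = 1 - exp (- (t - s))"
  using prob_rings_in[OF wait_distr[OF v] wait_indep[OF v] st] by simp

lemma prob_first_ring_at:
  assumes v: "v < n_white a n" and st: "0 \<le> s" "s \<le> t"
  shows "prob {\<omega>\<in>space M. s < X n v 0 \<omega> \<and> X n v 0 \<omega> \<le> t} = exp (- s) - exp (- t)"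
  using prob_first_ring[OF wait_distr[OF v] wait_indep[OF v] st] by simp

lemma AE_waits_pos:
  assumes v: "v < n_white a n"
  shows "AE \<omega> in M. \<forall>j. 0 < X n v j \<omega>"
  by (rule AE_waiting_pos[OF wait_distr[OF v] wait_indep[OF v]])

lemma prob_tail_step:
  assumes v: "v < n_white a n" and p: "0 \<le> p n" "p n \<le> 1" and NN: "N \<le> N'"
  shows "prob {\<omega>\<in>space M. real r \<le> deg_at n v \<omega> S N' \<and> deg_at n v \<omega> S N < real r}
    = bin_tail N' (p n) r - bin_tail N (p n) r"
proof -
  note [measurable] = deg_at_measurable[OF v]
  have mono: "deg_at n v \<omega> S N \<le> deg_at n v \<omega> S N'" for \<omega>
    unfolding deg_at_def using NN by (rule edge_count_mono)
  have "{\<omega>\<in>space M. real r \<le> deg_at n v \<omega> S N' \<and> deg_at n v \<omega> S N < real r}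
      = {\<omega>\<in>space M. real r \<le> deg_at n v \<omega> S N'} - {\<omega>\<in>space M. real r \<le> deg_at n v \<omega> S N}"
    by auto
  moreover have "{\<omega>\<in>space M. real r \<le> deg_at n v \<omega> S N} \<subseteq> {\<omega>\<in>space M. real r \<le> deg_at n v \<omega> S N'}"
    using mono order_trans by blast
  ultimately show ?thesis
    using deg_at_tail[OF v p] by (simp add: finite_measure_Diff)
qed

end

locale fluid = process_setup + trajectory f \<tau> h "own_rate reg r \<alpha>" "damping reg" \<kappa> "rate_domain reg \<alpha>"
  for f \<tau> h \<kappa>
begin

text \<open>The barriers of \<open>barriers_exist\<close>, with times divided by \<open>\<eta>\<close> and counts multiplied by \<open>q\<close>.\<close>

context
  fixes m :: nat and t :: "nat \<Rightarrow> real" and u l :: "color \<Rightarrow> nat \<Rightarrow> real"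
  assumes t0: "t 0 = 0" and t_step: "\<And>i. i < m \<Longrightarrow> t i \<le> t (Suc i)"
    and u_pos: "\<And>S i. i \<le> m \<Longrightarrow> 0 < u S i" and l_nonneg: "\<And>S i. i \<le> m \<Longrightarrow> 0 \<le> l S i"
    and u_step: "\<And>S i. i < m \<Longrightarrow> u S i \<le> u S (Suc i)"
    and l_step: "\<And>S i. damping reg \<noteq> 0 \<Longrightarrow> i < m \<Longrightarrow> l S i \<le> l S (Suc i)"
    and domU: "\<And>S i. i < m \<Longrightarrow> rate_domain reg \<alpha> S (u S (Suc i)) (l (other S) i)"
    and domL: "\<And>S i. i < m \<Longrightarrow> rate_domain reg \<alpha> S (l S i) (u (other S) (Suc i))"
begin

lemma u_nonneg: "i \<le> m \<Longrightarrow> 0 \<le> u S i"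
  using u_pos[of i S] by simp

definition tn :: "nat \<Rightarrow> nat \<Rightarrow> real" where
  "tn n i = t i / eta reg r p q n"

definition poss :: "nat \<Rightarrow> color \<Rightarrow> nat \<Rightarrow> (color \<Rightarrow> nat \<Rightarrow> real) \<Rightarrow> bool" where
  "poss n S j d \<longleftrightarrow> real r \<le> d S (total S (u S (Suc j)) n) - d (other S) (total (other S) (l (other S) j) n)"

definition sure :: "nat \<Rightarrow> color \<Rightarrow> nat \<Rightarrow> (color \<Rightarrow> nat \<Rightarrow> real) \<Rightarrow> bool" where
  "sure n S j d \<longleftrightarrow> real r \<le> d S (total S (l S j) n) - d (other S) (total (other S) (u (other S) (Suc j)) n)"

definition up_event :: "color \<Rightarrow> nat \<Rightarrow> nat \<Rightarrow> (color \<Rightarrow> nat \<Rightarrow> real) \<Rightarrow> (nat \<Rightarrow> real) \<Rightarrow> bool" where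
  "up_event S i n d w \<longleftrightarrow> (\<exists>j\<in>{..i}. poss n S j d \<and> rings_in w (tn n j) (tn n (Suc j)))"

definition lo_event :: "color \<Rightarrow> nat \<Rightarrow> nat \<Rightarrow> (color \<Rightarrow> nat \<Rightarrow> real) \<Rightarrow> (nat \<Rightarrow> real) \<Rightarrow> bool" where
  "lo_event S i n d w \<longleftrightarrow> (\<exists>j\<in>{..i}. sure n S j d \<and> rings_in w (tn n j) (tn n (Suc j)) \<and>
     (\<forall>j'\<in>{..j}. \<not> (poss n (other S) j' d \<and> rings_in w (tn n j') (tn n (Suc j')))))"

lemma up_event_pred: "node_pred (up_event S i n)"
  unfolding node_pred_def up_event_def poss_def
  supply [measurable] = node_pred_deg node_pred_rings
  by measurable

lemma lo_event_pred: "node_pred (lo_event S i n)"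
  unfolding node_pred_def lo_event_def poss_def sure_def
  supply [measurable] = node_pred_deg node_pred_rings
  by measurable

lemma t_mono: "i \<le> j \<Longrightarrow> j \<le> m \<Longrightarrow> t i \<le> t j"
proof (induction j)
  case (Suc j)
  then show ?case using t_step[of j] by (cases "i = Suc j") auto
qed simp

lemma u_mono: "i \<le> j \<Longrightarrow> j \<le> m \<Longrightarrow> u S i \<le> u S j"
proof (induction j)
  case (Suc j)
  then show ?case using u_step[of j S] by (cases "i = Suc j") auto
qed simp

lemma l_mono: "damping reg \<noteq> 0 \<Longrightarrow> i \<le> j \<Longrightarrow> j \<le> m \<Longrightarrow> l S i \<le> l S j"
proof (induction j)
  case (Suc j)
  then show ?case using l_step[of j S] by (cases "i = Suc j") auto
qed simp

lemma tn_mono: "0 < eta reg r p q n \<Longrightarrow> i \<le> j \<Longrightarrow> j \<le> m \<Longrightarrow> tn n i \<le> tn n j"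
  unfolding tn_def by (intro divide_right_mono t_mono) auto

lemma tn_nonneg: "0 < eta reg r p q n \<Longrightarrow> j \<le> m \<Longrightarrow> 0 \<le> tn n j"
  using tn_mono[of n 0 j] t0 by (simp add: tn_def)

section \<open>Block events outside the critical regime\<close>

lemma waits_sets:
  assumes v: "v < n_white a n" and G: "edge_pred G"
  shows "Measurable.pred M (\<lambda>\<omega>. G (waits n v \<omega>))"
proof -
  have [measurable]: "(\<lambda>\<omega>. waits n v \<omega>) \<in> M \<rightarrow>\<^sub>M PiM UNIV (\<lambda>_. borel)"
    using distributed_measurable[OF wait_distr[OF v]] by (intro measurable_abs_UNIV) simp
  show ?thesis by (rule measurable_compose[OF _ G]) measurable
qed

text \<open>A union bound over the blocks loses nothing in the limit, since every ring probability
  is of order 1/\<eta>. Edges and clock are independent, and without damping the weights are the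
  block lengths.\<close>

lemma noncrit_upper:
  assumes reg: "reg \<noteq> At_crit" and i: "i < m"
    and less: "(\<Sum>j\<le>i. own_rate reg r \<alpha> S (u S (Suc j)) (l (other S) j) * weight t (Suc i) j) < u S (Suc i)"
  shows "AE \<omega> in M. \<forall>\<^sub>F n in sequentially.
    real (card {v\<in>{..<n_white a n}. up_event S i n (deg_at n v \<omega>) (waits n v \<omega>)}) < q n * u S (Suc i)"
proof -
  let ?e = "eta reg r p q"
  let ?D = "\<lambda>n j. bin_diff (total S (u S (Suc j)) n) (total (other S) (l (other S) j) n) (p n) r"
  define P where "P n = (\<Sum>j\<le>i. ?D n j * (1 - exp (- (tn n (Suc j) - tn n j))))" for n
  have damp: "damping reg = 0" using reg by (cases reg) (auto simp: damping_def)
  have w: "weight t (Suc i) j = t (Suc j) - t j" for j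
    unfolding weight_def primitive_exp_def by (simp add: damp)
  have prob: "\<forall>\<^sub>F n in sequentially. \<forall>v<n_white a n.
      prob {\<omega>\<in>space M. up_event S i n (deg_at n v \<omega>) (waits n v \<omega>)} \<le> P n"
    using p_pos eta_pos
  proof (eventually_elim, intro allI impI)
    fix n v assume pn: "0 < p n \<and> p n < 1" and e: "0 < ?e n" and v: "v < n_white a n"
    let ?A = "\<lambda>j. {\<omega>\<in>space M. deg_at n v \<omega> S (total S (u S (Suc j)) n)
        - deg_at n v \<omega> (other S) (total (other S) (l (other S) j) n) \<ge> real r
        \<and> rings_in (waits n v \<omega>) (tn n j) (tn n (Suc j))}"
    note [measurable] = deg_at_measurable[OF v] waits_sets[OF v edge_pred_ring]
    have "prob {\<omega>\<in>space M. up_event S i n (deg_at n v \<omega>) (waits n v \<omega>)} \<le> prob (\<Union>j\<in>{..i}. ?A j)"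
      by (rule finite_measure_mono) (auto simp: up_event_def poss_def)
    also have "\<dots> \<le> (\<Sum>j\<le>i. prob (?A j))" by (rule finite_measure_subadditive_finite) auto
    also have "\<dots> = P n"
      unfolding P_def
    proof (intro sum.cong refl)
      fix j assume "j \<in> {..i}"
      then have "0 \<le> tn n j" "tn n j \<le> tn n (Suc j)" using tn_nonneg[OF e] tn_mono[OF e] i by auto
      then show "prob (?A j) = ?D n j * (1 - exp (- (tn n (Suc j) - tn n j)))"
        using deg_at_diff[where S=S and N="total S (u S (Suc j)) n" and N'="total (other S) (l (other S) j) n"
            and r=r and G="\<lambda>w. rings_in w (tn n j) (tn n (Suc j))", OF v _ _ edge_pred_ring] pn prob_rings_at[OF v] by simp
    qed
    finally show "prob {\<omega>\<in>space M. up_event S i n (deg_at n v \<omega>) (waits n v \<omega>)} \<le> P n" .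
  qed
  have "(\<lambda>n. \<Sum>j\<le>i. real (n_white a n) * ?D n j / (q n * ?e n) * (?e n * (1 - exp (- ((t (Suc j) - t j) / ?e n)))))
      \<longlonglongrightarrow> (\<Sum>j\<le>i. own_rate reg r \<alpha> S (u S (Suc j)) (l (other S) j) * (t (Suc j) - t j))"
    by (intro tendsto_sum tendsto_mult noncrit_rate eta_exp_limit reg domU) (use i in auto)
  moreover have "\<forall>\<^sub>F n in sequentially. (\<Sum>j\<le>i. real (n_white a n) * ?D n j / (q n * ?e n) * (?e n * (1 - exp (- ((t (Suc j) - t j) / ?e n)))))
      = real (n_white a n) * P n / q n"
    using eta_pos
  proof eventually_elim
    case (elim n)
    then show ?case
      by (simp add: P_def tn_def sum_distrib_left sum_divide_distrib diff_divide_distrib)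
  qed
  ultimately have lim: "(\<lambda>n. real (n_white a n) * P n / q n)
      \<longlonglongrightarrow> (\<Sum>j\<le>i. own_rate reg r \<alpha> S (u S (Suc j)) (l (other S) j) * (t (Suc j) - t j))"
    by (rule Lim_transform_eventually)
  show ?thesis by (rule AE_count_less[OF up_event_pred prob lim]) (use less u_pos i in \<open>auto simp: w\<close>)
qed

lemma sure_not_poss: "sure n S j d \<Longrightarrow> \<not> poss n (other S) j d"
  using r2 by (auto simp: sure_def poss_def)

text \<open>Counting the first ring of each clock makes the events of different blocks disjoint. It
  also settles the exclusion clause of \<open>lo_event\<close>: there is no ring in an earlier
  block, and in the same block the clause follows from \<open>sure_not_poss\<close>. Ignoring later
  rings has no effect on the limit as \<eta> tends to infinity.\<close>

lemma noncrit_lower: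
  assumes reg: "reg \<noteq> At_crit" and i: "i < m"
    and less: "l S (Suc i) < (\<Sum>j\<le>i. own_rate reg r \<alpha> S (l S j) (u (other S) (Suc j)) * weight t (Suc i) j)"
  shows "AE \<omega> in M. \<forall>\<^sub>F n in sequentially.
    q n * l S (Suc i) < real (card {v\<in>{..<n_white a n}. lo_event S i n (deg_at n v \<omega>) (waits n v \<omega>)})"
proof -
  let ?e = "eta reg r p q"
  let ?D = "\<lambda>n j. bin_diff (total S (l S j) n) (total (other S) (u (other S) (Suc j)) n) (p n) r"
  define P where "P n = (\<Sum>j\<le>i. ?D n j * (exp (- tn n j) - exp (- tn n (Suc j))))" for n
  have damp: "damping reg = 0" using reg by (cases reg) (auto simp: damping_def)
  have w: "weight t (Suc i) j = t (Suc j) - t j" for j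
    unfolding weight_def primitive_exp_def by (simp add: damp)
  have prob: "\<forall>\<^sub>F n in sequentially. \<forall>v<n_white a n.
      P n \<le> prob {\<omega>\<in>space M. lo_event S i n (deg_at n v \<omega>) (waits n v \<omega>)}"
    using p_pos eta_pos
  proof (eventually_elim, intro allI impI)
    fix n v assume pn: "0 < p n \<and> p n < 1" and e: "0 < ?e n" and v: "v < n_white a n"
    define G where "G j w \<longleftrightarrow> tn n j < w 0 \<and> w 0 \<le> tn n (Suc j)" for j and w :: "nat \<Rightarrow> real"
    have G: "edge_pred (G j)" for j unfolding G_def by measurable
    let ?A = "\<lambda>j. {\<omega>\<in>space M. deg_at n v \<omega> S (total S (l S j) n)
        - deg_at n v \<omega> (other S) (total (other S) (u (other S) (Suc j)) n) \<ge> real r \<and> G j (waits n v \<omega>)}"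
    note [measurable] = deg_at_measurable[OF v] waits_sets[OF v G]
    have disj: "disjoint_family_on ?A {..i}"
    proof -
      have "False" if "j < k" "k \<le> i" "G j w" "G k w" for j k w
        using that tn_mono[OF e, of "Suc j" k] i by (auto simp: G_def)
      then show ?thesis unfolding disjoint_family_on_def
        by (auto simp: disjoint_iff) (metis linorder_neqE_nat)
    qed
    have "P n = (\<Sum>j\<le>i. prob (?A j))"
      unfolding P_def
    proof (intro sum.cong refl)
      fix j assume "j \<in> {..i}"
      then have "0 \<le> tn n j" "tn n j \<le> tn n (Suc j)" using tn_nonneg[OF e] tn_mono[OF e] i by auto
      then show "?D n j * (exp (- tn n j) - exp (- tn n (Suc j))) = prob (?A j)"
        using deg_at_diff[where S=S and N="total S (l S j) n" and N'="total (other S) (u (other S) (Suc j)) n"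
            and r=r and G="G j", OF v _ _ G] pn prob_first_ring_at[OF v] by (simp add: G_def)
    qed
    also have "\<dots> = prob (\<Union>j\<in>{..i}. ?A j)"
      by (rule finite_measure_finite_Union[symmetric]) (use disj in auto)
    also have "\<dots> \<le> prob {\<omega>\<in>space M. lo_event S i n (deg_at n v \<omega>) (waits n v \<omega>)}"
    proof (rule finite_measure_mono_AE)
      show "{\<omega>\<in>space M. lo_event S i n (deg_at n v \<omega>) (waits n v \<omega>)} \<in> sets M"
        by (rule node_pred_sets[OF lo_event_pred v])
      show "AE \<omega> in M. \<omega> \<in> (\<Union>j\<in>{..i}. ?A j) \<longrightarrow> \<omega> \<in> {\<omega>\<in>space M. lo_event S i n (deg_at n v \<omega>) (waits n v \<omega>)}"
        using AE_waits_pos[OF v]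
      proof eventually_elim
        case (elim \<omega>)
        show ?case
        proof
          assume "\<omega> \<in> (\<Union>j\<in>{..i}. ?A j)"
          then obtain j where j: "j \<le> i" "\<omega> \<in> space M" "sure n S j (deg_at n v \<omega>)" "G j (waits n v \<omega>)"
            by (auto simp: sure_def)
          have first: "X n v 0 \<omega> \<le> (\<Sum>k\<le>x. X n v k \<omega>)" for x
            using sum_mono2[of "{..x}" "{0}" "\<lambda>k. X n v k \<omega>"] elim by (auto intro: less_imp_le)
          have ring: "rings_in (waits n v \<omega>) (tn n j) (tn n (Suc j))"
            using j(4) unfolding rings_in_def G_def by (intro exI[of _ 0]) simp
          have none: "\<not> rings_in (waits n v \<omega>) (tn n j') (tn n (Suc j'))" if "j' < j" for j'
          proof
            assume "rings_in (waits n v \<omega>) (tn n j') (tn n (Suc j'))"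
            then obtain x where "(\<Sum>k\<le>x. X n v k \<omega>) \<le> tn n (Suc j')" by (auto simp: rings_in_def)
            moreover have "tn n (Suc j') \<le> tn n j" using tn_mono[OF e, of "Suc j'" j] that j(1) i by simp
            ultimately show False using first[of x] j(4) by (simp add: G_def)
          qed
          have "lo_event S i n (deg_at n v \<omega>) (waits n v \<omega>)"
            unfolding lo_event_def
          proof (intro bexI[of _ j] conjI ballI)
            fix j' assume "j' \<in> {..j}"
            then show "\<not> (poss n (other S) j' (deg_at n v \<omega>) \<and> rings_in (waits n v \<omega>) (tn n j') (tn n (Suc j')))"
              using none[of j'] sure_not_poss[OF j(3)] by (cases "j' = j") auto
          qed (use j ring in auto)
          then show "\<omega> \<in> {\<omega>\<in>space M. lo_event S i n (deg_at n v \<omega>) (waits n v \<omega>)}" using j(2) by simp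
        qed
      qed
    qed
    finally show "P n \<le> prob {\<omega>\<in>space M. lo_event S i n (deg_at n v \<omega>) (waits n v \<omega>)}" .
  qed
  have "(\<lambda>n. \<Sum>j\<le>i. real (n_white a n) * ?D n j / (q n * ?e n)
        * (?e n * (1 - exp (- (t (Suc j) / ?e n))) - ?e n * (1 - exp (- (t j / ?e n)))))
      \<longlonglongrightarrow> (\<Sum>j\<le>i. own_rate reg r \<alpha> S (l S j) (u (other S) (Suc j)) * (t (Suc j) - t j))"
    by (intro tendsto_sum tendsto_mult tendsto_diff noncrit_rate eta_exp_limit reg domL) (use i in auto)
  moreover have "\<forall>\<^sub>F n in sequentially. (\<Sum>j\<le>i. real (n_white a n) * ?D n j / (q n * ?e n)
        * (?e n * (1 - exp (- (t (Suc j) / ?e n))) - ?e n * (1 - exp (- (t j / ?e n)))))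
      = real (n_white a n) * P n / q n"
    using eta_pos
  proof eventually_elim
    case (elim n)
    then show ?case
      by (simp add: P_def tn_def sum_distrib_left sum_divide_distrib right_diff_distrib[symmetric])
  qed
  ultimately have lim: "(\<lambda>n. real (n_white a n) * P n / q n)
      \<longlonglongrightarrow> (\<Sum>j\<le>i. own_rate reg r \<alpha> S (l S j) (u (other S) (Suc j)) * (t (Suc j) - t j))"
    by (rule Lim_transform_eventually)
  show ?thesis by (rule AE_count_greater[OF lo_event_pred prob lim]) (use less l_nonneg i in \<open>auto simp: w\<close>)
qed

section \<open>Block events in the critical regime\<close>

lemma crit_weight:
  assumes "reg = At_crit"
  shows "weight t (Suc i) j = exp (- (t (Suc i) - t (Suc j))) - exp (- (t (Suc i) - t j))"
proof -
  have d: "damping reg = 1" using assms by (simp add: damping_def)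
  have "exp (- t (Suc i)) * (exp (t (Suc j)) - exp (t j)) = exp (- t (Suc i) + t (Suc j)) - exp (- t (Suc i) + t j)"
    by (simp only: right_diff_distrib exp_add)
  then show ?thesis unfolding weight_def primitive_exp_def unfolding d by (simp add: algebra_simps)
qed

text \<open>Block 0 has no predecessor and contributes its full tail, the same convention as in
  \<open>abel_summation\<close>.\<close>

lemma prob_tail_increment:
  assumes v: "v < n_white a n" and pn: "0 \<le> p n" "p n \<le> 1" and mono: "j \<noteq> 0 \<Longrightarrow> K (j - 1) \<le> K j"
    and F: "F = (\<lambda>d. real r \<le> d (K j) \<and> (j \<noteq> 0 \<longrightarrow> d (K (j - 1)) < real r))"
  shows "prob {\<omega>\<in>space M. F (deg_at n v \<omega> S)}
    = bin_tail (K j) (p n) r - (if j = 0 then 0 else bin_tail (K (j - 1)) (p n) r)"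
  using prob_tail_step[OF v pn mono, of S] deg_at_tail[OF v pn, where S=S and N="K j" and k=r]
  by (cases "j = 0") (auto simp: F)

text \<open>Rings now have probability of order one, so a union bound over blocks would count a node
  repeatedly. Instead the edges to the other colour are dropped and the node is classified by the
  first block in which its own degree reaches r; it must ring between the start of this block and
  the final time. Abel summation, with \<open>crit_weight\<close>, turns the resulting sum into the
  one in the hypothesis.\<close>

lemma crit_upper:
  assumes reg: "reg = At_crit" and i: "i < m"
    and less: "(\<Sum>j\<le>i. own_rate reg r \<alpha> S (u S (Suc j)) (l (other S) j) * weight t (Suc i) j) < u S (Suc i)"
  shows "AE \<omega> in M. \<forall>\<^sub>F n in sequentially.
    real (card {v\<in>{..<n_white a n}. up_event S i n (deg_at n v \<omega>) (waits n v \<omega>)}) < q n * u S (Suc i)"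
proof -
  have tn: "tn n j = t j" for n j unfolding tn_def using reg by simp
  let ?K = "\<lambda>n j. total S (u S (Suc j)) n"
  let ?H = "\<lambda>n j. bin_tail (?K n j) (p n) r"
  let ?a = "\<lambda>j. 1 - exp (- (t (Suc i) - t j))"
  define P where "P n = (\<Sum>j\<le>i. (?H n j - (if j = 0 then 0 else ?H n (j - 1))) * ?a j)" for n
  have P_eq: "P n = (\<Sum>j\<le>i. ?H n j * weight t (Suc i) j)" for n
    unfolding P_def by (subst abel_summation) (simp add: crit_weight[OF reg])
  have prob: "\<forall>\<^sub>F n in sequentially. \<forall>v<n_white a n.
      prob {\<omega>\<in>space M. up_event S i n (deg_at n v \<omega>) (waits n v \<omega>)} \<le> P n"
    using p_pos q_pos
  proof (eventually_elim, intro allI impI)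
    fix n v assume pn: "0 < p n \<and> p n < 1" and qn: "0 < q n" and v: "v < n_white a n"
    define F where "F j d \<longleftrightarrow> real r \<le> d (?K n j) \<and> (j \<noteq> 0 \<longrightarrow> d (?K n (j - 1)) < real r)" for j and d :: "nat \<Rightarrow> real"
    have F: "edge_pred (F j)" for j unfolding F_def by measurable
    let ?A = "\<lambda>j. {\<omega>\<in>space M. F j (deg_at n v \<omega> S) \<and> rings_in (waits n v \<omega>) (t j) (t (Suc i))}"
    note [measurable] = deg_at_measurable[OF v] waits_sets[OF v edge_pred_ring]
    have [measurable]: "Measurable.pred M (\<lambda>\<omega>. F j (deg_at n v \<omega> S))" for j unfolding F_def by measurable
    have "prob {\<omega>\<in>space M. up_event S i n (deg_at n v \<omega>) (waits n v \<omega>)} \<le> prob (\<Union>j\<in>{..i}. ?A j)"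
    proof (rule finite_measure_mono)
      show "{\<omega>\<in>space M. up_event S i n (deg_at n v \<omega>) (waits n v \<omega>)} \<subseteq> (\<Union>j\<in>{..i}. ?A j)"
      proof safe
        fix \<omega> assume \<omega>: "\<omega> \<in> space M" "up_event S i n (deg_at n v \<omega>) (waits n v \<omega>)"
        then obtain j where j: "j \<le> i" "poss n S j (deg_at n v \<omega>)" "rings_in (waits n v \<omega>) (t j) (t (Suc j))"
          by (auto simp: up_event_def tn)
        have dj: "real r \<le> deg_at n v \<omega> S (?K n j)"
          using j(2) deg_at_nonneg[of n v \<omega> "other S"] unfolding poss_def by (smt (verit))
        \<comment> \<open>The block of first susceptibility; \<open>u\<close> is non-decreasing, so
          from there on the degree stays at least r.\<close>
        define j0 where "j0 = (LEAST j. real r \<le> deg_at n v \<omega> S (?K n j))"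
        have j0: "real r \<le> deg_at n v \<omega> S (?K n j0)" unfolding j0_def by (rule LeastI[where P="\<lambda>j. real r \<le> deg_at n v \<omega> S (?K n j)" and k=j, OF dj])
        have j0j: "j0 \<le> j" unfolding j0_def by (rule Least_le[where P="\<lambda>j. real r \<le> deg_at n v \<omega> S (?K n j)" and k=j, OF dj])
        have Fj0: "F j0 (deg_at n v \<omega> S)"
          unfolding F_def using j0 not_less_Least[of "j0 - 1" "\<lambda>j. real r \<le> deg_at n v \<omega> S (?K n j)"]
          by (auto simp: j0_def[symmetric])
        have "t j0 \<le> t j" "t (Suc j) \<le> t (Suc i)" using t_mono[of j0 j] t_mono[of "Suc j" "Suc i"] j0j j(1) i by auto
        then have "rings_in (waits n v \<omega>) (t j0) (t (Suc i))"
          using j(3) unfolding rings_in_def by (meson le_less_trans order_trans)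
        then show "\<omega> \<in> (\<Union>j\<in>{..i}. ?A j)" using \<omega>(1) Fj0 j0j j(1) by (intro UN_I[of j0]) auto
      qed
    qed measurable
    also have "\<dots> \<le> (\<Sum>j\<le>i. prob (?A j))" by (rule finite_measure_subadditive_finite) auto
    also have "\<dots> = P n"
      unfolding P_def
    proof (intro sum.cong refl)
      fix j assume j: "j \<in> {..i}"
      define F' where "F' S' = (if S' = S then F j else (\<lambda>_. True))" for S'
      have "edge_pred (F' S')" for S' unfolding F'_def using F by auto
      from node_prob_prod[where F=F' and S=S and G="\<lambda>w. rings_in w (t j) (t (Suc i))", OF v this edge_pred_ring]
      have "prob (?A j) = prob {\<omega>\<in>space M. F j (deg_at n v \<omega> S)} * prob {\<omega>\<in>space M. rings_in (waits n v \<omega>) (t j) (t (Suc i))}"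
        by (simp add: F'_def prob_space)
      also have "prob {\<omega>\<in>space M. F j (deg_at n v \<omega> S)} = ?H n j - (if j = 0 then 0 else ?H n (j - 1))"
        using pn qn j i by (intro prob_tail_increment[OF v]) (auto simp: F_def fun_eq_iff intro!: scaled_count_mono u_mono)
      also have "prob {\<omega>\<in>space M. rings_in (waits n v \<omega>) (t j) (t (Suc i))} = ?a j"
        using j i t_mono[of 0 j] t_mono[of j "Suc i"] t0 by (intro prob_rings_at[OF v]) auto
      finally show "prob (?A j) = (?H n j - (if j = 0 then 0 else ?H n (j - 1))) * ?a j" .
    qed
    finally show "prob {\<omega>\<in>space M. up_event S i n (deg_at n v \<omega>) (waits n v \<omega>)} \<le> P n" .
  qed
  have "(\<lambda>n. \<Sum>j\<le>i. real (n_white a n) * ?H n j / q n * weight t (Suc i) j)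
      \<longlonglongrightarrow> (\<Sum>j\<le>i. own_rate reg r \<alpha> S (u S (Suc j)) (l (other S) j) * weight t (Suc i) j)"
    by (intro tendsto_sum tendsto_mult tendsto_const crit_rate[OF reg] u_nonneg) (use i in auto)
  also have "(\<lambda>n. \<Sum>j\<le>i. real (n_white a n) * ?H n j / q n * weight t (Suc i) j) = (\<lambda>n. real (n_white a n) * P n / q n)"
    by (simp add: P_eq sum_distrib_left sum_divide_distrib mult.assoc)
  finally have lim: "(\<lambda>n. real (n_white a n) * P n / q n)
      \<longlonglongrightarrow> (\<Sum>j\<le>i. own_rate reg r \<alpha> S (u S (Suc j)) (l (other S) j) * weight t (Suc i) j)" .
  show ?thesis by (rule AE_count_less[OF up_event_pred prob lim less]) (use u_pos i in auto)
qed

text \<open>Only nodes without any edge to the other colour are counted, where that colour is given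
  its largest upper barrier; this costs the factor (1-p)^N, which tends to 1 because q p does. For
  such a node the other colour is never possible, and sure susceptibility is that the own degree
  reaches r, which persists because the lower barriers increase.\<close>

lemma crit_lower:
  assumes reg: "reg = At_crit" and i: "i < m"
    and less: "l S (Suc i) < (\<Sum>j\<le>i. own_rate reg r \<alpha> S (l S j) (u (other S) (Suc j)) * weight t (Suc i) j)"
  shows "AE \<omega> in M. \<forall>\<^sub>F n in sequentially.
    q n * l S (Suc i) < real (card {v\<in>{..<n_white a n}. lo_event S i n (deg_at n v \<omega>) (waits n v \<omega>)})"
proof -
  have tn: "tn n j = t j" for n j unfolding tn_def using reg by simp
  have damp: "damping reg \<noteq> 0" using reg by (simp add: damping_def)
  let ?K = "\<lambda>n j. total S (l S j) n"
  let ?H = "\<lambda>n j. bin_tail (?K n j) (p n) r"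
  let ?N = "\<lambda>n. total (other S) (u (other S) m) n"
  let ?a = "\<lambda>j. 1 - exp (- (t (Suc i) - t j))"
  define P where "P n = (\<Sum>j\<le>i. (?H n j - (if j = 0 then 0 else ?H n (j - 1))) * ?a j) * (1 - p n) ^ ?N n" for n
  have P_eq: "P n = (\<Sum>j\<le>i. ?H n j * weight t (Suc i) j) * (1 - p n) ^ ?N n" for n
    unfolding P_def by (subst abel_summation) (simp add: crit_weight[OF reg])
  have prob: "\<forall>\<^sub>F n in sequentially. \<forall>v<n_white a n.
      P n \<le> prob {\<omega>\<in>space M. lo_event S i n (deg_at n v \<omega>) (waits n v \<omega>)}"
    using p_pos q_pos
  proof (eventually_elim, intro allI impI)
    fix n v assume pn: "0 < p n \<and> p n < 1" and qn: "0 < q n" and v: "v < n_white a n"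
    define F where "F j d \<longleftrightarrow> real r \<le> d (?K n j) \<and> (j \<noteq> 0 \<longrightarrow> d (?K n (j - 1)) < real r)" for j and d :: "nat \<Rightarrow> real"
    have F: "edge_pred (F j)" for j unfolding F_def by measurable
    have Kmono: "?K n j \<le> ?K n k" if "j \<le> k" "k \<le> m" for j k
      using scaled_count_mono[OF qn l_mono[OF damp that, of S]] by simp
    have dmono: "deg_at n v \<omega> S' N \<le> deg_at n v \<omega> S' N'" if "N \<le> N'" for \<omega> S' N N'
      unfolding deg_at_def using that by (rule edge_count_mono)
    let ?A = "\<lambda>j. {\<omega>\<in>space M. F j (deg_at n v \<omega> S) \<and> deg_at n v \<omega> (other S) (?N n) = 0
        \<and> rings_in (waits n v \<omega>) (t j) (t (Suc i))}"
    note [measurable] = deg_at_measurable[OF v] waits_sets[OF v edge_pred_ring]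
    have [measurable]: "Measurable.pred M (\<lambda>\<omega>. F j (deg_at n v \<omega> S))" for j unfolding F_def by measurable
    have disj: "disjoint_family_on ?A {..i}"
    proof -
      have "False" if "j < k" "k \<le> i" "F j (deg_at n v \<omega> S)" "F k (deg_at n v \<omega> S)" for j k \<omega>
      proof -
        have "j \<le> k - 1" "k - 1 \<le> m" using that i by auto
        from dmono[OF Kmono[OF this], of \<omega> S] show False using that by (auto simp: F_def)
      qed
      then show ?thesis unfolding disjoint_family_on_def
        by (auto simp: disjoint_iff) (metis linorder_neqE_nat)
    qed
    have "P n = (\<Sum>j\<le>i. prob (?A j))"
      unfolding P_def sum_distrib_right
    proof (intro sum.cong refl)
      fix j assume j: "j \<in> {..i}"
      define F' where "F' S' = (if S' = S then F j else (\<lambda>d. d (?N n) = 0))" for S'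
      have "edge_pred (F' S')" for S' unfolding F'_def using F by (cases "S' = S") (simp_all, measurable)
      from node_prob_prod[where F=F' and S=S and G="\<lambda>w. rings_in w (t j) (t (Suc i))", OF v this edge_pred_ring]
      have "prob (?A j) = prob {\<omega>\<in>space M. F j (deg_at n v \<omega> S)} * prob {\<omega>\<in>space M. deg_at n v \<omega> (other S) (?N n) = 0}
          * prob {\<omega>\<in>space M. rings_in (waits n v \<omega>) (t j) (t (Suc i))}"
        by (simp add: F'_def)
      also have "prob {\<omega>\<in>space M. F j (deg_at n v \<omega> S)} = ?H n j - (if j = 0 then 0 else ?H n (j - 1))"
        using pn j i by (intro prob_tail_increment[OF v]) (auto simp: F_def fun_eq_iff intro!: Kmono[simplified])
      also have "prob {\<omega>\<in>space M. deg_at n v \<omega> (other S) (?N n) = 0} = (1 - p n) ^ ?N n"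
        using deg_at_pmf[where S="other S" and N="?N n" and k=0, OF v] pn by (simp add: bin_pmf_def)
      also have "prob {\<omega>\<in>space M. rings_in (waits n v \<omega>) (t j) (t (Suc i))} = ?a j"
        using j i t_mono[of 0 j] t_mono[of j "Suc i"] t0 by (intro prob_rings_at[OF v]) auto
      finally show "(?H n j - (if j = 0 then 0 else ?H n (j - 1))) * ?a j * (1 - p n) ^ ?N n = prob (?A j)"
        by (simp only: mult_ac)
    qed
    also have "\<dots> = prob (\<Union>j\<in>{..i}. ?A j)"
      by (rule finite_measure_finite_Union[symmetric]) (use disj in auto)
    also have "\<dots> \<le> prob {\<omega>\<in>space M. lo_event S i n (deg_at n v \<omega>) (waits n v \<omega>)}"
    proof (rule finite_measure_mono)
      show "{\<omega>\<in>space M. lo_event S i n (deg_at n v \<omega>) (waits n v \<omega>)} \<in> sets M"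
        by (rule node_pred_sets[OF lo_event_pred v])
      show "(\<Union>j\<in>{..i}. ?A j) \<subseteq> {\<omega>\<in>space M. lo_event S i n (deg_at n v \<omega>) (waits n v \<omega>)}"
      proof
        fix \<omega> assume "\<omega> \<in> (\<Union>j\<in>{..i}. ?A j)"
        then obtain j x where j: "j \<le> i" "\<omega> \<in> space M" "F j (deg_at n v \<omega> S)" "deg_at n v \<omega> (other S) (?N n) = 0"
          and x: "t j < (\<Sum>k\<le>x. X n v k \<omega>)" "(\<Sum>k\<le>x. X n v k \<omega>) \<le> t (Suc i)"
          by (auto simp: rings_in_def)
        \<comment> \<open>The block that contains the ring; it is not earlier than the block in
          which the node became susceptible.\<close>
        have "\<exists>k. j \<le> k \<and> k \<le> i \<and> t k < (\<Sum>k\<le>x. X n v k \<omega>) \<and> (\<Sum>k\<le>x. X n v k \<omega>) \<le> t (Suc k)"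
        proof -
          define k where "k = (LEAST k. (\<Sum>k\<le>x. X n v k \<omega>) \<le> t (Suc k))"
          have k1: "(\<Sum>k\<le>x. X n v k \<omega>) \<le> t (Suc k)" unfolding k_def by (rule LeastI[where P="\<lambda>k. (\<Sum>k\<le>x. X n v k \<omega>) \<le> t (Suc k)" and k=i, OF x(2)])
          have k2: "k \<le> i" unfolding k_def by (rule Least_le[where P="\<lambda>k. (\<Sum>k\<le>x. X n v k \<omega>) \<le> t (Suc k)" and k=i, OF x(2)])
          have k3: "j \<le> k"
          proof (rule ccontr)
            assume "\<not> j \<le> k"
            then have "t (Suc k) \<le> t j" using t_mono[of "Suc k" j] j(1) i by simp
            then show False using k1 x(1) by simp
          qed
          have k4: "t k < (\<Sum>k\<le>x. X n v k \<omega>)"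
          proof (cases "k = j")
            case False
            then have "k - 1 < k" "Suc (k - 1) = k" using k3 by auto
            then show ?thesis using not_less_Least[of "k - 1" "\<lambda>k. (\<Sum>k\<le>x. X n v k \<omega>) \<le> t (Suc k)"]
              by (simp add: k_def[symmetric])
          qed (use x in simp)
          show ?thesis using k1 k2 k3 k4 by blast
        qed
        then obtain k where k: "j \<le> k" "k \<le> i" "t k < (\<Sum>k\<le>x. X n v k \<omega>)" "(\<Sum>k\<le>x. X n v k \<omega>) \<le> t (Suc k)"
          by blast
        have zero: "deg_at n v \<omega> (other S) (total (other S) (u (other S) (Suc k')) n) \<le> 0" if "k' \<le> i" for k'
        proof -
          have "total (other S) (u (other S) (Suc k')) n \<le> ?N n"
            using scaled_count_mono[OF qn u_mono[of "Suc k'" m "other S"]] that i by simp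
          from dmono[OF this, of \<omega> "other S"] show ?thesis using j(4) by simp
        qed
        have "real r \<le> deg_at n v \<omega> S (?K n k)"
          using j(3) dmono[OF Kmono[of j k], of \<omega> S] k i by (auto simp: F_def)
        then have sure: "sure n S k (deg_at n v \<omega>)"
          using zero[of k] k unfolding sure_def by linarith
        have noposs: "\<not> poss n (other S) k' (deg_at n v \<omega>)" if "k' \<le> k" for k'
          using zero[of k'] that k deg_at_nonneg[of n v \<omega> S "total S (l S k') n"] r2
          unfolding poss_def other_other by auto
        have "rings_in (waits n v \<omega>) (t k) (t (Suc k))"
          unfolding rings_in_def using k by blast
        then have "lo_event S i n (deg_at n v \<omega>) (waits n v \<omega>)"
          unfolding lo_event_def tn using sure noposs k by (intro bexI[of _ k]) auto
        then show "\<omega> \<in> {\<omega>\<in>space M. lo_event S i n (deg_at n v \<omega>) (waits n v \<omega>)}" using j(2) by simp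
      qed
    qed
    finally show "P n \<le> prob {\<omega>\<in>space M. lo_event S i n (deg_at n v \<omega>) (waits n v \<omega>)}" .
  qed
  have "(\<lambda>n. (\<Sum>j\<le>i. real (n_white a n) * ?H n j / q n * weight t (Suc i) j) * (1 - p n) ^ ?N n)
      \<longlonglongrightarrow> (\<Sum>j\<le>i. own_rate reg r \<alpha> S (l S j) (u (other S) (Suc j)) * weight t (Suc i) j) * 1"
    by (intro tendsto_sum tendsto_mult tendsto_const crit_rate[OF reg] total_sparse l_nonneg u_nonneg)
      (use i reg in auto)
  also have "(\<lambda>n. (\<Sum>j\<le>i. real (n_white a n) * ?H n j / q n * weight t (Suc i) j) * (1 - p n) ^ ?N n)
      = (\<lambda>n. real (n_white a n) * P n / q n)"
    by (simp add: P_eq sum_distrib_left sum_distrib_right sum_divide_distrib mult.assoc)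
  finally have lim: "(\<lambda>n. real (n_white a n) * P n / q n)
      \<longlonglongrightarrow> (\<Sum>j\<le>i. own_rate reg r \<alpha> S (l S j) (u (other S) (Suc j)) * weight t (Suc i) j)" by simp
  show ?thesis by (rule AE_count_greater[OF lo_event_pred prob lim less]) (use l_nonneg i in auto)
qed

section \<open>Almost sure confinement between the barriers\<close>

lemma poss_iff:
  assumes "tube r (n_white a n) (\<lambda>v j. X n v j \<omega>) m (tn n)"
  shows "poss n S j (deg_at n v \<omega>) \<longleftrightarrow> tube.possibly r (\<lambda>S. a S n) (\<lambda>S v i. E n S v i \<omega>)
      (\<lambda>S j. scaled_count n (u S j)) (\<lambda>S j. scaled_count n (l S j)) S j v"
    and "sure n S j (deg_at n v \<omega>) \<longleftrightarrow> tube.surely r (\<lambda>S. a S n) (\<lambda>S v i. E n S v i \<omega>)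
      (\<lambda>S j. scaled_count n (u S j)) (\<lambda>S j. scaled_count n (l S j)) S j v"
proof -
  have *: "int r \<le> x - y \<longleftrightarrow> real r \<le> real_of_int x - real_of_int y" for x y by linarith
  show "poss n S j (deg_at n v \<omega>) \<longleftrightarrow> tube.possibly r (\<lambda>S. a S n) (\<lambda>S v i. E n S v i \<omega>)
      (\<lambda>S j. scaled_count n (u S j)) (\<lambda>S j. scaled_count n (l S j)) S j v"
    unfolding poss_def tube.possibly_def[OF assms] * of_int_edges deg_at_def ..
  show "sure n S j (deg_at n v \<omega>) \<longleftrightarrow> tube.surely r (\<lambda>S. a S n) (\<lambda>S v i. E n S v i \<omega>)
      (\<lambda>S j. scaled_count n (u S j)) (\<lambda>S j. scaled_count n (l S j)) S j v"
    unfolding sure_def tube.surely_def[OF assms] * of_int_edges deg_at_def ..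
qed

text \<open>Finitely many blocks and two colours give finitely many almost sure events. Where they
  hold, together with good clocks, the deterministic comparison applies to every large n, with the
  barriers rounded down to integers.\<close>

lemma node_count_between_barriers:
  assumes m: "0 < m" and l0: "\<And>S. l S 0 = 0"
    and less_u: "\<And>S i. i < m \<Longrightarrow>
      (\<Sum>j\<le>i. own_rate reg r \<alpha> S (u S (Suc j)) (l (other S) j) * weight t (Suc i) j) < u S (Suc i)"
    and less_l: "\<And>S i. i < m \<Longrightarrow> l S (Suc i) = 0 \<or>
      l S (Suc i) < (\<Sum>j\<le>i. own_rate reg r \<alpha> S (l S j) (u (other S) (Suc j)) * weight t (Suc i) j)"
  shows "AE \<omega> in M. \<forall>\<^sub>F n in sequentially. \<forall>S.
    scaled_count n (l S m) \<le> node_count n \<omega> S (t m / eta reg r p q n) \<and>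
    node_count n \<omega> S (t m / eta reg r p q n) \<le> scaled_count n (u S m)"
proof -
  let ?U = "\<lambda>S i n \<omega>. {v\<in>{..<n_white a n}. up_event S i n (deg_at n v \<omega>) (waits n v \<omega>)}"
  let ?L = "\<lambda>S i n \<omega>. {v\<in>{..<n_white a n}. lo_event S i n (deg_at n v \<omega>) (waits n v \<omega>)}"
  have U: "AE \<omega> in M. \<forall>\<^sub>F n in sequentially. real (card (?U S i n \<omega>)) < q n * u S (Suc i)" if "i < m" for S i
    using crit_upper[OF _ that less_u[OF that]] noncrit_upper[OF _ that less_u[OF that]] by blast
  have L: "AE \<omega> in M. \<forall>\<^sub>F n in sequentially. q n * l S (Suc i) \<le> real (card (?L S i n \<omega>))" if i: "i < m" for S i
  proof (cases "l S (Suc i) = 0")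
    case False
    then have less: "l S (Suc i) < (\<Sum>j\<le>i. own_rate reg r \<alpha> S (l S j) (u (other S) (Suc j)) * weight t (Suc i) j)"
      using less_l[OF i] by blast
    have "AE \<omega> in M. \<forall>\<^sub>F n in sequentially. q n * l S (Suc i) < real (card (?L S i n \<omega>))"
      using crit_lower[OF _ i less] noncrit_lower[OF _ i less] by blast
    then show ?thesis by (rule AE_mp) (intro AE_I2 impI, erule eventually_mono, rule less_imp_le)
  qed simp
  have "AE \<omega> in M. \<forall>S. \<forall>i\<in>{..<m}. (\<forall>\<^sub>F n in sequentially. real (card (?U S i n \<omega>)) < q n * u S (Suc i))
      \<and> (\<forall>\<^sub>F n in sequentially. q n * l S (Suc i) \<le> real (card (?L S i n \<omega>)))"
    unfolding all_color using U L by (intro AE_conjI AE_finite_allI) auto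
  then show ?thesis using AE_good_clocks
  proof eventually_elim
    case (elim \<omega>)
    have ev: "\<forall>\<^sub>F n in sequentially. \<forall>i\<in>{..<m}. real (card (?U S i n \<omega>)) < q n * u S (Suc i)
        \<and> q n * l S (Suc i) \<le> real (card (?L S i n \<omega>))" for S
      using elim(1) by (intro eventually_ball_finite) (auto intro: eventually_conj)
    show ?case
      using ev[of Red] ev[of Black] q_pos eta_pos
    proof eventually_elim
      case n: (elim n)
      interpret T: tube r "n_white a n" "\<lambda>S. a S n" "\<lambda>v j. X n v j \<omega>" "\<lambda>S v i. E n S v i \<omega>" "\<lambda>k. L n k \<omega>"
        m "tn n" "\<lambda>S j. scaled_count n (u S j)" "\<lambda>S j. scaled_count n (l S j)"
      proof
        show "bootstrap.good_clocks (n_white a n) (\<lambda>v j. X n v j \<omega>)" using elim(2) by blast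
        show "tn n 0 = 0" by (simp add: tn_def t0)
        show "tn n i \<le> tn n (Suc i)" if "i < m" for i using tn_mono[OF n(4), of i "Suc i"] that by simp
      qed (use r2 in simp)
      have rings: "T.rings v = rings_in (waits n v \<omega>)" for v
        by (simp add: fun_eq_iff T.rings_def T.ring_time_def rings_in_def)
      have U_eq: "T.upper_set S i = ?U S i n \<omega>" for S i
        unfolding T.upper_set_def up_event_def rings poss_iff(1)[OF T.tube_axioms] by auto
      have L_eq: "T.lower_set S i = ?L S i n \<omega>" for S i
        unfolding T.lower_set_def lo_event_def rings poss_iff[OF T.tube_axioms] by (auto simp: Ball_def Bex_def)
      have bounds: "real (card (?U S i n \<omega>)) < q n * u S (Suc i) \<and> q n * l S (Suc i) \<le> real (card (?L S i n \<omega>))"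
        if "i < m" for S i using n(1,2) that by (cases S) auto
      \<comment> \<open>A cardinality below q u is at most the integer part of q u, so rounding the
        upper barrier down is harmless.\<close>
      have up: "card (T.upper_set S i) \<le> scaled_count n (u S (Suc i))" if "i < m" for S i
        unfolding U_eq unfolding scaled_count_def using bounds[OF that, of S] by (intro le_nat_floor) simp
      have lo: "scaled_count n (l S (Suc i)) \<le> card (T.lower_set S i)" if "i < m" for S i
      proof -
        have "real (scaled_count n (l S (Suc i))) \<le> q n * l S (Suc i)"
          unfolding scaled_count_def using n(3) l_nonneg[of "Suc i" S] that by simp
        then show ?thesis unfolding L_eq using bounds[OF that, of S] by linarith
      qed
      have z: "scaled_count n (l S 0) = 0" for S by (simp add: l0 scaled_count_def)
      note tube = T.count_in_tube[OF z up lo order_refl]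
      have tm: "0 \<le> tn n m" using tn_nonneg[OF n(4), of m] by simp
      show ?case
        unfolding tn_def[symmetric]
      proof (intro allI conjI)
        fix S
        show "scaled_count n (l S m) \<le> node_count n \<omega> S (tn n m)" by (rule tube(1)) auto
        show "node_count n \<omega> S (tn n m) \<le> scaled_count n (u S m)"
          unfolding T.count_def by (rule tube(2)) (use m T.last_index(1,2)[OF tm] in auto)
      qed
    qed
  qed
qed

end

text \<open>The term \<open>- 1\<close> is the loss from rounding the lower barrier down.\<close>

lemma node_count_limit:
  assumes \<epsilon>: "0 < \<epsilon>"
  shows "AE \<omega> in M. \<forall>\<^sub>F n in sequentially. \<forall>S.
    (f S \<kappa> - \<epsilon>) * q n - 1 \<le> real (node_count n \<omega> S (\<tau> \<kappa> / eta reg r p q n)) \<and>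
    real (node_count n \<omega> S (\<tau> \<kappa> / eta reg r p q n)) \<le> (f S \<kappa> + \<epsilon>) * q n"
proof -
  obtain m t u l where b: "0 < m" "t 0 = 0" "\<And>i. i < m \<Longrightarrow> t i \<le> t (Suc i)" "t m = \<tau> \<kappa>"
    "\<And>S i. i \<le> m \<Longrightarrow> 0 < u S i" "\<And>S i. i \<le> m \<Longrightarrow> 0 \<le> l S i" "\<And>S. l S 0 = 0"
    "\<And>S i. i < m \<Longrightarrow> u S i \<le> u S (Suc i)"
    "\<And>S i. damping reg \<noteq> 0 \<Longrightarrow> i < m \<Longrightarrow> l S i \<le> l S (Suc i)"
    "\<And>S. u S m \<le> f S \<kappa> + \<epsilon>" "\<And>S. f S \<kappa> - \<epsilon> \<le> l S m"
    "\<And>S i. i < m \<Longrightarrow> rate_domain reg \<alpha> S (u S (Suc i)) (l (other S) i)"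
    "\<And>S i. i < m \<Longrightarrow> rate_domain reg \<alpha> S (l S i) (u (other S) (Suc i))"
    "\<And>S i. i < m \<Longrightarrow> (\<Sum>j\<le>i. own_rate reg r \<alpha> S (u S (Suc j)) (l (other S) j) * weight t (Suc i) j) < u S (Suc i)"
    "\<And>S i. i < m \<Longrightarrow> l S (Suc i) = 0 \<or>
      l S (Suc i) < (\<Sum>j\<le>i. own_rate reg r \<alpha> S (l S j) (u (other S) (Suc j)) * weight t (Suc i) j)"
    by (rule barriers_exist[OF \<epsilon>], rule that; assumption)
  have "AE \<omega> in M. \<forall>\<^sub>F n in sequentially. \<forall>S.
    scaled_count n (l S m) \<le> node_count n \<omega> S (t m / eta reg r p q n) \<and>
    node_count n \<omega> S (t m / eta reg r p q n) \<le> scaled_count n (u S m)"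
    by (rule node_count_between_barriers[OF b(2,3,5,6,8,9,12,13,1,7,14,15)]) assumption+
  then show ?thesis
  proof eventually_elim
    case (elim \<omega>)
    then show ?case using q_pos
    proof eventually_elim
      case n: (elim n)
      show ?case
      proof
        fix S
        have "(f S \<kappa> - \<epsilon>) * q n - 1 \<le> q n * l S m - 1"
          using b(11)[of S] n(2) by (simp add: mult.commute mult_left_mono)
        also have "\<dots> \<le> real (scaled_count n (l S m))" unfolding scaled_count_def by linarith
        finally have lo: "(f S \<kappa> - \<epsilon>) * q n - 1 \<le> real (scaled_count n (l S m))" .
        have "real (scaled_count n (u S m)) \<le> q n * u S m"
          unfolding scaled_count_def using n(2) b(5)[of m S] by simp
        also have "\<dots> \<le> (f S \<kappa> + \<epsilon>) * q n"
          using b(10)[of S] n(2) by (simp add: mult.commute mult_left_mono)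
        finally have up: "real (scaled_count n (u S m)) \<le> (f S \<kappa> + \<epsilon>) * q n" .
        have "real (scaled_count n (l S m)) \<le> real (node_count n \<omega> S (\<tau> \<kappa> / eta reg r p q n))"
          "real (node_count n \<omega> S (\<tau> \<kappa> / eta reg r p q n)) \<le> real (scaled_count n (u S m))" using n(1) by (simp_all add: b(4))
        then show "(f S \<kappa> - \<epsilon>) * q n - 1 \<le> real (node_count n \<omega> S (\<tau> \<kappa> / eta reg r p q n)) \<and>
          real (node_count n \<omega> S (\<tau> \<kappa> / eta reg r p q n)) \<le> (f S \<kappa> + \<epsilon>) * q n"
          using lo up by linarith
      qed
    qed
  qed
qed

end

section \<open>Activation times from counts\<close>

context good_bootstrap
begin

text \<open>Counts refer to the process that stops at K*. A total of at least k at some time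
  therefore also shows k \<le> K*, which is how the later limits stay before the extension.\<close>

lemma activation_time_le:
  assumes "0 \<le> s" "k \<le> count Red s + count Black s"
  shows "natural k" "activation_time k \<le> ereal s"
  using le_last_index_iff[OF assms(1), of k] count_total[OF assms(1)] assms(2) by auto

lemma activation_time_ge:
  assumes "0 \<le> s" "natural k" "count Red s + count Black s < k"
  shows "ereal s \<le> activation_time k"
  using le_last_index_iff[OF assms(1), of k] count_total[OF assms(1)] assms(2,3) by force

lemma color_activation_time_le:
  assumes "0 \<le> s" "k \<le> count S s"
  shows "color_activation_time S k \<le> ereal s"
proof -
  have "color_activation_time S k \<le> activation_time (last_index s)"
    unfolding color_activation_time_def using assms(2) by (intro Inf_lower) (auto simp: count_def)
  also have "\<dots> \<le> ereal s" by (rule last_index(2)[OF assms(1)])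
  finally show ?thesis .
qed

text \<open>The infimum ranges over all indices of the extended process. A second time s', at which
  the stopped process already has k nodes of colour S, ensures that the first such index is reached
  before K*.\<close>

lemma color_activation_time_ge:
  assumes s: "0 \<le> s" "0 \<le> s'" and k: "count S s < k" "k \<le> count S s'"
  shows "ereal s \<le> color_activation_time S k"
  unfolding color_activation_time_def
proof (rule Inf_greatest, safe)
  fix j assume j: "k \<le> card (active j S)"
  show "ereal s \<le> activation_time j"
  proof (rule ccontr)
    assume "\<not> ?thesis"
    then have tj: "activation_time j \<le> ereal s" by simp
    \<comment> \<open>Cutting the index off at \<open>last_index s'\<close> keeps at least k nodes
      of colour S and makes the index natural.\<close>
    define i where "i = min j (last_index s')"
    have nat: "natural i" using natural_mono[OF last_index(1)[OF s(2)], of i] by (simp add: i_def)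
    have "k \<le> card (active i S)" using j k(2) by (simp add: i_def min_def count_def)
    moreover have "activation_time i \<le> ereal s"
      using activation_time_mono[of i j] tj by (auto simp: i_def intro: order_trans)
    then have "card (active i S) \<le> count S s"
      unfolding count_def using active_subset_last[OF s(1) nat, of S] natural_finite[OF last_index(1)[OF s(1)]]
      by (intro card_mono) auto
    ultimately show False using k(1) by simp
  qed
qed

end

section \<open>Solutions of the Cauchy problem\<close>

lemma power_lipschitz:
  fixes x y B :: real
  assumes "0 \<le> x" "x \<le> B" "0 \<le> y" "y \<le> B"
  shows "\<bar>x ^ n - y ^ n\<bar> \<le> real n * B ^ (n - 1) * \<bar>x - y\<bar>"
proof (induction n)
  case (Suc n)
  have B: "0 \<le> B" using assms by simp
  have "x ^ Suc n - y ^ Suc n = x * (x ^ n - y ^ n) + (x - y) * y ^ n" by (simp add: algebra_simps)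
  then have "\<bar>x ^ Suc n - y ^ Suc n\<bar> \<le> \<bar>x * (x ^ n - y ^ n)\<bar> + \<bar>(x - y) * y ^ n\<bar>" by linarith
  also have "\<bar>x * (x ^ n - y ^ n)\<bar> \<le> B * (real n * B ^ (n - 1) * \<bar>x - y\<bar>)"
    unfolding abs_mult using Suc.IH assms by (intro mult_mono) auto
  also have "B * (real n * B ^ (n - 1) * \<bar>x - y\<bar>) = real n * B ^ n * \<bar>x - y\<bar>"
    by (cases n) auto
  also have "\<bar>(x - y) * y ^ n\<bar> \<le> \<bar>x - y\<bar> * B ^ n"
    unfolding abs_mult using assms by (intro mult_left_mono) (auto intro: power_mono)
  finally show ?case by (simp add: algebra_simps)
qed simp

context process_setup
begin

text \<open>One outcome suffices: degree r towards S and degree 0 towards the other colour. Its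
  limiting probability is a product of two positive Poisson weights.\<close>

lemma at_inverse_pos:
  assumes reg: "reg = At_inverse" and nn: "0 \<le> x" "0 \<le> y"
  shows "0 < own_rate reg r \<alpha> S x y"
proof -
  have N: "(\<lambda>n. real (total S x n) * p n) \<longlonglongrightarrow> x + \<alpha> S" if "0 \<le> x" for x S
  proof (rule Lim_transform_eventually[OF total_ratio[OF that, of S]])
    show "\<forall>\<^sub>F n in sequentially. real (total S x n) / q n = real (total S x n) * p n"
      using regime reg by (intro eventually_sequentiallyI[of 1]) auto
  qed
  define la mu where "la = x + \<alpha> S" and "mu = y + \<alpha> (other S)"
  have pos: "0 < la" "0 < mu" using nn \<alpha>_pos[of S] \<alpha>_pos[of "other S"] by (auto simp: la_def mu_def)
  have lower: "(\<lambda>n. real (n_white a n) / real n * (bin_pmf (total (other S) y n) (p n) 0 * bin_pmf (total S x n) (p n) r))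
      \<longlonglongrightarrow> 1 * (exp (- mu) * mu ^ 0 / fact 0 * (exp (- la) * la ^ r / fact r))"
    unfolding la_def mu_def by (intro tendsto_mult white_ratio tendsto_bin_pmf p_pos p_tendsto N nn)
  have lim: "(\<lambda>n. real (n_white a n) * bin_diff (total S x n) (total (other S) y n) (p n) r / (q n * eta reg r p q n))
      \<longlonglongrightarrow> own_rate reg r \<alpha> S x y"
    by (rule noncrit_rate) (use nn reg in \<open>auto simp: rate_domain_def\<close>)
  have "1 * (exp (- mu) * mu ^ 0 / fact 0 * (exp (- la) * la ^ r / fact r)) \<le> own_rate reg r \<alpha> S x y"
  proof (rule tendsto_le[OF _ lim lower])
    show "\<forall>\<^sub>F n in sequentially. real (n_white a n) / real n * (bin_pmf (total (other S) y n) (p n) 0 * bin_pmf (total S x n) (p n) r)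
      \<le> real (n_white a n) * bin_diff (total S x n) (total (other S) y n) (p n) r / (q n * eta reg r p q n)"
      using q_pos p_pos
    proof eventually_elim
      case (elim n)
      have pn: "0 \<le> p n" "p n \<le> 1" using elim by auto
      have "bin_pmf (total (other S) y n) (p n) 0 * bin_pmf (total S x n) (p n) r
          \<le> (1 - p n) ^ total (other S) y n * bin_tail (total S x n) (p n) r"
        using bin_tail_ge[OF pn, of "total S x n" r] pn by (simp add: bin_pmf_def mult_left_mono)
      also have "\<dots> \<le> bin_diff (total S x n) (total (other S) y n) (p n) r" by (rule bin_diff_ge_tail[OF pn])
      finally have "real (n_white a n) / real n * (bin_pmf (total (other S) y n) (p n) 0 * bin_pmf (total S x n) (p n) r)
          \<le> real (n_white a n) / real n * bin_diff (total S x n) (total (other S) y n) (p n) r"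
        by (rule mult_left_mono) simp
      also have "\<dots> = real (n_white a n) * bin_diff (total S x n) (total (other S) y n) (p n) r / (q n * eta reg r p q n)"
        using reg elim by simp
      finally show ?case .
    qed
  qed simp
  moreover have "0 < 1 * (exp (- mu) * mu ^ 0 / fact 0 * (exp (- la) * la ^ r / fact r))" using pos by simp
  ultimately show ?thesis by linarith
qed

end

section \<open>Regularity and positivity along the solution\<close>

locale cauchy = process_setup +
  fixes f :: "color \<Rightarrow> real \<Rightarrow> real" and \<kappa>f :: ereal
  assumes sol: "solution (beta reg r \<alpha>) f \<kappa>f" and \<alpha>_less: "\<alpha> Black < \<alpha> Red"
begin

definition rate_sum :: "real \<Rightarrow> real" where
  "rate_sum x = beta reg r \<alpha> Red (\<lambda>S. f S x) + beta reg r \<alpha> Black (\<lambda>S. f S x)"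

text \<open>The parameter of the Cauchy problem is the scaled number of coloured nodes;
  \<open>clock\<close> converts it into scaled time.\<close>

definition clock :: "real \<Rightarrow> real" where
  "clock \<kappa> = integral {0..\<kappa>} (\<lambda>x. 1 / rate_sum x)"

lemma f0: "f S 0 = 0"
  using sol by (simp add: solution_def)

lemma \<kappa>f_pos: "0 < \<kappa>f"
  using sol by (simp add: solution_def)

lemma sol_at:
  assumes "0 \<le> x" "ereal x < \<kappa>f"
  shows "0 \<le> f S x" "rate_sum x \<noteq> 0"
    "(f S has_real_derivative beta reg r \<alpha> S (\<lambda>S. f S x) / rate_sum x) (at x within {z. 0 \<le> z \<and> ereal z < \<kappa>f})"
  using sol assms unfolding solution_def Let_def rate_sum_def by auto

context
  fixes \<kappa> :: real
  assumes \<kappa>: "0 < \<kappa>" "ereal \<kappa> < \<kappa>f"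
begin

lemma in_domain: "x \<in> {0..\<kappa>} \<Longrightarrow> ereal x < \<kappa>f"
  using \<kappa>(2) by (auto intro: le_less_trans[of _ "ereal \<kappa>"])

lemma f_nonneg': "x \<in> {0..\<kappa>} \<Longrightarrow> 0 \<le> f S x"
  using sol_at(1) in_domain by auto

lemma f_deriv:
  assumes "x \<in> {0..\<kappa>}"
  shows "(f S has_real_derivative beta reg r \<alpha> S (\<lambda>S. f S x) / rate_sum x) (at x within {0..\<kappa>})"
  by (rule DERIV_subset[OF sol_at(3)]) (use assms in_domain in auto)

lemma f_cont: "continuous_on {0..\<kappa>} (f S)"
  by (rule DERIV_continuous_on[OF f_deriv])

lemma f_bounded: "\<exists>B. \<forall>S. \<forall>x\<in>{0..\<kappa>}. f S x \<le> B"
proof -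
  have "\<exists>B. \<forall>x\<in>{0..\<kappa>}. f S x \<le> B" for S
  proof -
    obtain x0 where "\<forall>x\<in>{0..\<kappa>}. f S x \<le> f S x0"
      using continuous_attains_sup[OF compact_Icc _ f_cont[of S]] \<kappa> by fastforce
    then show ?thesis by blast
  qed
  then obtain B where "\<And>S. \<forall>x\<in>{0..\<kappa>}. f S x \<le> B S" by metis
  then show ?thesis unfolding all_color
    by (intro exI[of _ "max (B Red) (B Black)"]) (auto intro: max.coboundedI1 max.coboundedI2)
qed

text \<open>As long as Red is ahead, its rate is 1 and that of Black is at most 1, so the lead does
  not shrink. At the earliest point without a positive lead, which exists by compactness, the lead
  would still be at least its initial value \<alpha> Red - \<alpha> Black.\<close>

lemma above_gap:
  assumes "reg = Above_inverse" "x \<in> {0..\<kappa>}"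
  shows "f Black x + \<alpha> Black < f Red x + \<alpha> Red"
proof (rule ccontr)
  define D where "D y = f Red y + \<alpha> Red - (f Black y + \<alpha> Black)" for y
  assume "\<not> ?thesis"
  then have x: "D x \<le> 0" by (simp add: D_def)
  have Dc: "continuous_on {0..\<kappa>} D" unfolding D_def by (intro continuous_intros f_cont)
  let ?Z = "{0..x} \<inter> D -` {..0}"
  have "closed ?Z"
    by (rule continuous_closed_preimage[OF continuous_on_subset[OF Dc]]) (use assms in auto)
  moreover have "bounded ?Z" by (rule bounded_subset[OF compact_imp_bounded[OF compact_Icc]]) auto
  ultimately have "compact ?Z" by (simp add: compact_eq_bounded_closed)
  moreover have "?Z \<noteq> {}" using x assms by auto
  ultimately obtain z where z: "z \<in> ?Z" "\<And>y. y \<in> ?Z \<Longrightarrow> z \<le> y"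
    by (metis compact_attains_inf)
  have D0: "0 < D 0" using \<alpha>_less by (simp add: D_def f0)
  have zI: "z \<in> {0..\<kappa>}" using z(1) assms by auto
  have pos: "0 < D y" if "0 \<le> y" "y < z" for y
  proof (rule ccontr)
    assume "\<not> 0 < D y"
    then have "y \<in> ?Z" using that z(1) by auto
    then show False using z(2) that by fastforce
  qed
  have "D 0 \<le> D z"
  proof (rule DERIV_nonneg_imp_increasing_open[of 0 z D])
    show "0 \<le> z" using zI by simp
    show "continuous_on {0..z} D" by (rule continuous_on_subset[OF Dc]) (use zI in auto)
    fix y assume y: "0 < y" "y < z"
    have yI: "y \<in> {0..\<kappa>}" using y zI by auto
    have "at y within {0..\<kappa>} = at y" using y zI by (intro at_within_Icc_at) auto
    then have d: "(f S has_real_derivative beta reg r \<alpha> S (\<lambda>S. f S y) / rate_sum y) (at y)" for S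
      using f_deriv[OF yI, of S] by simp
    have "(D has_real_derivative beta reg r \<alpha> Red (\<lambda>S. f S y) / rate_sum y - beta reg r \<alpha> Black (\<lambda>S. f S y) / rate_sum y) (at y)"
      unfolding D_def by (rule derivative_eq_intros d refl)+ simp
    moreover have "0 \<le> beta reg r \<alpha> Red (\<lambda>S. f S y) / rate_sum y - beta reg r \<alpha> Black (\<lambda>S. f S y) / rate_sum y"
    proof -
      have "f Black y + \<alpha> Black < f Red y + \<alpha> Red" using pos[of y] y by (simp add: D_def)
      then have "1 / 2 \<le> (f Red y + \<alpha> Red) / (f Red y + \<alpha> Red + f Black y + \<alpha> Black)"
        using f_nonneg'[OF yI, of Red] f_nonneg'[OF yI, of Black] \<alpha>_pos[of Red] \<alpha>_pos[of Black]
        by (simp add: field_simps)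
      then have "beta reg r \<alpha> Red (\<lambda>S. f S y) = 1" using assms(1) by simp
      moreover have "beta reg r \<alpha> Black (\<lambda>S. f S y) = 0 \<or> beta reg r \<alpha> Black (\<lambda>S. f S y) = 1"
        using assms(1) by simp
      ultimately show ?thesis by (auto simp: rate_sum_def)
    qed
    ultimately show "\<exists>d. (D has_real_derivative d) (at y) \<and> 0 \<le> d" by blast
  qed
  then show False using D0 z(1) by auto
qed

lemma above_rates:
  assumes "reg = Above_inverse" "0 \<le> x" "0 \<le> y" "y + \<alpha> (other S) < x + \<alpha> S"
  shows "own_rate reg r \<alpha> S x y = 1" "own_rate reg r \<alpha> (other S) y x = 0"
proof -
  have pos: "0 < x + \<alpha> S" "0 < y + \<alpha> (other S)" using assms \<alpha>_pos[of S] \<alpha>_pos[of "other S"] by auto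
  have "1 / 2 \<le> (x + \<alpha> S) / (x + \<alpha> S + (y + \<alpha> (other S)))"
    "\<not> 1 / 2 \<le> (y + \<alpha> (other S)) / (x + \<alpha> S + (y + \<alpha> (other S)))"
    using pos assms(4) by (auto simp: field_simps)
  then show "own_rate reg r \<alpha> S x y = 1" "own_rate reg r \<alpha> (other S) y x = 0"
    using assms(1) by (cases S; simp add: own_rate_def add_ac)+
qed

lemma own_rate_poly:
  assumes "reg = At_crit \<or> reg = Below_inverse"
  obtains C where "0 < C" "\<And>S x y. own_rate reg r \<alpha> S x y = C * (x + \<alpha> S) ^ r"
  using assms
proof (elim disjE)
  assume "reg = At_crit"
  then show thesis using r2 by (intro that[of "1 / real r * (1 - 1 / real r) ^ (r - 1)"]) (auto simp: own_rate_def)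
next
  assume "reg = Below_inverse"
  then show thesis by (intro that[of "1 / fact r"]) (auto simp: own_rate_def)
qed

text \<open>For the two polynomial regimes this is the Lipschitz bound of a power on a bounded set.
  In the last regime the rates are constant on each side of the line of equal strength, and the
  solution stays on one side at a positive distance, so the Lipschitz constant is 0 near it.\<close>

lemma rate_neighbourhood:
  "\<exists>\<epsilon>0>0. \<exists>K\<ge>0. \<forall>S. \<forall>z\<in>{0..\<kappa>}. \<forall>x\<ge>0. \<forall>y\<ge>0.
    \<bar>x - f S z\<bar> \<le> \<epsilon>0 \<longrightarrow> \<bar>y - f (other S) z\<bar> \<le> \<epsilon>0 \<longrightarrow> rate_domain reg \<alpha> S x y \<and>
    \<bar>own_rate reg r \<alpha> S x y - own_rate reg r \<alpha> S (f S z) (f (other S) z)\<bar>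
      \<le> K * (\<bar>x - f S z\<bar> + \<bar>y - f (other S) z\<bar>)"
proof (cases reg)
  case Above_inverse
  define D where "D y = f Red y + \<alpha> Red - (f Black y + \<alpha> Black)" for y
  have "continuous_on {0..\<kappa>} D" unfolding D_def by (intro continuous_intros f_cont)
  then obtain z0 where z0: "z0 \<in> {0..\<kappa>}" "\<And>z. z \<in> {0..\<kappa>} \<Longrightarrow> D z0 \<le> D z"
    using continuous_attains_inf[OF compact_Icc, of 0 \<kappa> D] \<kappa> by auto
  have D0: "0 < D z0" using above_gap[OF Above_inverse z0(1)] by (simp add: D_def)
  show ?thesis
  \<comment> \<open>Moving both coordinates by a quarter of the minimal lead leaves at least half of
    it.\<close>
  proof (rule exI[of _ "D z0 / 4"], intro exI[of _ 0] conjI allI ballI impI)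
    fix z x y :: real and S' assume z: "z \<in> {0..\<kappa>}" and xy: "0 \<le> x" "0 \<le> y"
      and near: "\<bar>x - f S' z\<bar> \<le> D z0 / 4" "\<bar>y - f (other S') z\<bar> \<le> D z0 / 4"
    have Dz: "D z0 \<le> D z" by (rule z0(2)[OF z])
    have gap: "f Black z + \<alpha> Black < f Red z + \<alpha> Red" by (rule above_gap[OF Above_inverse z])
    have n: "x \<le> f S' z + D z0 / 4" "f S' z - D z0 / 4 \<le> x"
      "y \<le> f (other S') z + D z0 / 4" "f (other S') z - D z0 / 4 \<le> y"
      using near unfolding abs_le_iff by linarith+
    show "rate_domain reg \<alpha> S' x y"
    proof (cases S')
      case Red
      have "y + \<alpha> Black < x + \<alpha> Red" using n Dz D0 D_def[of z] Red by simp
      then show ?thesis using xy Red by (simp add: rate_domain_def)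
    next
      case Black
      have "x + \<alpha> Black < y + \<alpha> Red" using n Dz D0 D_def[of z] Black by simp
      then show ?thesis using xy Black by (simp add: rate_domain_def)
    qed
    show "\<bar>own_rate reg r \<alpha> S' x y - own_rate reg r \<alpha> S' (f S' z) (f (other S') z)\<bar>
      \<le> 0 * (\<bar>x - f S' z\<bar> + \<bar>y - f (other S') z\<bar>)"
    proof (cases S')
      case Red
      have "y + \<alpha> (other Red) < x + \<alpha> Red" using n Dz D0 D_def[of z] Red by simp
      then show ?thesis
        using above_rates(1)[where x=x and y=y and S=Red] above_rates(1)[where x="f Red z" and y="f Black z" and S=Red] gap xy f_nonneg'[OF z] Above_inverse Red
        by simp
    next
      case Black
      have "x + \<alpha> (other Red) < y + \<alpha> Red" using n Dz D0 D_def[of z] Black by simp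
      then show ?thesis
        using above_rates(2)[where x=y and y=x and S=Red] above_rates(2)[where x="f Red z" and y="f Black z" and S=Red] gap xy f_nonneg'[OF z] Above_inverse Black
        by simp
    qed
  qed (use D0 in auto)
next
  case At_inverse
  show ?thesis
  proof (intro exI[of _ 1] conjI allI ballI impI)
    fix S z x y assume z: "z \<in> {0..\<kappa>}" and xy: "(0::real) \<le> x" "(0::real) \<le> y"
    show "rate_domain reg \<alpha> S x y" using xy At_inverse by (simp add: rate_domain_def)
    show "\<bar>own_rate reg r \<alpha> S x y - own_rate reg r \<alpha> S (f S z) (f (other S) z)\<bar>
      \<le> 1 * (\<bar>x - f S z\<bar> + \<bar>y - f (other S) z\<bar>)"
      using at_inverse_lipschitz[where S=S and x=x and y=y and x'="f S z" and y'="f (other S) z",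
          OF At_inverse xy f_nonneg'[OF z] f_nonneg'[OF z]] by simp
  qed auto
next
  have poly: ?thesis if reg: "reg = At_crit \<or> reg = Below_inverse"
  proof -
    obtain C where C: "0 < C" "\<And>S x y. own_rate reg r \<alpha> S x y = C * (x + \<alpha> S) ^ r"
      using own_rate_poly[OF reg] by blast
    obtain B0 where B0: "\<And>S x. x \<in> {0..\<kappa>} \<Longrightarrow> f S x \<le> B0" using f_bounded by blast
    define B where "B = B0 + 1 + \<alpha> Red + \<alpha> Black"
    have \<alpha>B: "\<alpha> S \<le> \<alpha> Red + \<alpha> Black" for S using \<alpha>_pos[of Red] \<alpha>_pos[of Black] by (cases S) auto
    have Bn: "0 \<le> B" using B0[of 0 Red] f0 \<kappa> \<alpha>_pos[of Red] \<alpha>_pos[of Black] by (simp add: B_def)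
    show ?thesis
    proof (rule exI[of _ 1], intro exI[of _ "C * (real r * B ^ (r - 1))"] conjI allI ballI impI)
      show "0 \<le> C * (real r * B ^ (r - 1))" using C(1) Bn by simp
      fix S z x y assume z: "z \<in> {0..\<kappa>}" and xy: "(0::real) \<le> x" "(0::real) \<le> y"
        and near: "\<bar>x - f S z\<bar> \<le> 1" "\<bar>y - f (other S) z\<bar> \<le> 1"
      show "rate_domain reg \<alpha> S x y" using xy reg by (auto simp: rate_domain_def)
      have "\<bar>own_rate reg r \<alpha> S x y - own_rate reg r \<alpha> S (f S z) (f (other S) z)\<bar>
          = C * \<bar>(x + \<alpha> S) ^ r - (f S z + \<alpha> S) ^ r\<bar>"
        using C(1) by (simp add: C(2) abs_mult flip: right_diff_distrib)
      also have "\<dots> \<le> C * (real r * B ^ (r - 1) * \<bar>(x + \<alpha> S) - (f S z + \<alpha> S)\<bar>)"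
        using C(1) near(1) xy(1) f_nonneg'[OF z, of S] B0[OF z, of S] \<alpha>_pos[of S] \<alpha>B[of S]
        by (intro mult_left_mono power_lipschitz) (auto simp: B_def abs_le_iff)
      also have "\<dots> = C * (real r * B ^ (r - 1)) * \<bar>x - f S z\<bar>" by simp
      also have "\<dots> \<le> C * (real r * B ^ (r - 1)) * (\<bar>x - f S z\<bar> + \<bar>y - f (other S) z\<bar>)"
        using C(1) Bn by (intro mult_left_mono) auto
      finally show "\<bar>own_rate reg r \<alpha> S x y - own_rate reg r \<alpha> S (f S z) (f (other S) z)\<bar>
        \<le> C * (real r * B ^ (r - 1)) * (\<bar>x - f S z\<bar> + \<bar>y - f (other S) z\<bar>)" .
    qed simp
  qed
  { case At_crit then show ?thesis using poly by simp }
  { case Below_inverse then show ?thesis using poly by simp }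
qed

lemma own_rate_cont: "continuous_on {0..\<kappa>} (\<lambda>x. own_rate reg r \<alpha> S (f S x) (f (other S) x))"
proof -
  obtain \<epsilon>0 K where e: "0 < \<epsilon>0" and K: "0 \<le> K"
    and nb: "\<And>z x y. z \<in> {0..\<kappa>} \<Longrightarrow> 0 \<le> x \<Longrightarrow> 0 \<le> y \<Longrightarrow> \<bar>x - f S z\<bar> \<le> \<epsilon>0 \<Longrightarrow> \<bar>y - f (other S) z\<bar> \<le> \<epsilon>0 \<Longrightarrow>
      \<bar>own_rate reg r \<alpha> S x y - own_rate reg r \<alpha> S (f S z) (f (other S) z)\<bar> \<le> K * (\<bar>x - f S z\<bar> + \<bar>y - f (other S) z\<bar>)"
    using rate_neighbourhood by metis
  show ?thesis
    unfolding continuous_on_def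
  proof
    fix z assume z: "z \<in> {0..\<kappa>}"
    have lim: "((\<lambda>x. \<bar>f T x - f T z\<bar>) \<longlongrightarrow> 0) (at z within {0..\<kappa>})" for T
    proof -
      have "(f T \<longlongrightarrow> f T z) (at z within {0..\<kappa>})" using f_cont[of T] z by (auto simp: continuous_on_def)
      then have "((\<lambda>x. \<bar>f T x - f T z\<bar>) \<longlongrightarrow> \<bar>f T z - f T z\<bar>) (at z within {0..\<kappa>})" by (intro tendsto_intros)
      then show ?thesis by simp
    qed
    have ev: "\<forall>\<^sub>F x in at z within {0..\<kappa>}. \<bar>f T x - f T z\<bar> < \<epsilon>0" for T
      using order_tendstoD(2)[OF lim e] .
    have "((\<lambda>x. own_rate reg r \<alpha> S (f S x) (f (other S) x) - own_rate reg r \<alpha> S (f S z) (f (other S) z)) \<longlongrightarrow> 0)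
        (at z within {0..\<kappa>})"
    proof (rule Lim_null_comparison)
      show "((\<lambda>x. K * (\<bar>f S x - f S z\<bar> + \<bar>f (other S) x - f (other S) z\<bar>)) \<longlongrightarrow> 0) (at z within {0..\<kappa>})"
        using tendsto_mult[OF tendsto_const tendsto_add[OF lim lim], of K] by simp
      have dom: "\<forall>\<^sub>F x in at z within {0..\<kappa>}. x \<in> {0..\<kappa>}"
        by (simp add: eventually_at_filter)
      show "\<forall>\<^sub>F x in at z within {0..\<kappa>}. norm (own_rate reg r \<alpha> S (f S x) (f (other S) x)
          - own_rate reg r \<alpha> S (f S z) (f (other S) z)) \<le> K * (\<bar>f S x - f S z\<bar> + \<bar>f (other S) x - f (other S) z\<bar>)"
        using ev[of S] ev[of "other S"] dom
        by eventually_elim (use nb[OF z] f_nonneg' in \<open>simp add: less_imp_le\<close>)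
    qed
    then show "((\<lambda>x. own_rate reg r \<alpha> S (f S x) (f (other S) x)) \<longlongrightarrow> own_rate reg r \<alpha> S (f S z) (f (other S) z))
        (at z within {0..\<kappa>})" by (rule LIM_zero_cancel)
  qed
qed

lemma beta_cont: "continuous_on {0..\<kappa>} (\<lambda>x. beta reg r \<alpha> S (\<lambda>S. f S x))"
  unfolding beta_eq by (intro continuous_intros own_rate_cont f_cont)

lemma rate_sum_cont: "continuous_on {0..\<kappa>} rate_sum"
  unfolding rate_sum_def[abs_def] by (intro continuous_intros beta_cont)

text \<open>A solution is only required to keep the denominator away from 0. Since \<beta>_S depends
  on f_S alone, its value g along the solution satisfies a linear equation g' = c g with continuous
  c. Hence g multiplied by exp(-I), with I the integral of c, is constant, and g keeps the sign of
  its positive initial value.\<close>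

lemma crit_positive:
  assumes reg: "reg = At_crit" and x: "x \<in> {0..\<kappa>}"
  shows "0 < beta reg r \<alpha> S (\<lambda>S. f S x)"
proof -
  define C where "C = 1 / real r * (1 - 1 / real r) ^ (r - 1)"
  have C: "0 < C" using r2 by (simp add: C_def)
  define g where "g x = C * (f S x + \<alpha> S) ^ r - f S x" for x
  have g: "beta reg r \<alpha> S (\<lambda>S. f S x) = g x" for x using reg by (simp add: g_def C_def)
  define c where "c x = (C * (real r * (f S x + \<alpha> S) ^ (r - 1)) - 1) / rate_sum x" for x
  have nz: "rate_sum x \<noteq> 0" if "x \<in> {0..\<kappa>}" for x using sol_at(2)[of x] in_domain that by auto
  have c_cont: "continuous_on {0..\<kappa>} c"
    unfolding c_def by (intro continuous_intros f_cont rate_sum_cont) (use nz in auto)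
  define I where "I x = integral {0..x} c" for x
  have I': "(I has_real_derivative c x) (at x within {0..\<kappa>})" if "x \<in> {0..\<kappa>}" for x
    unfolding I_def[abs_def] by (rule integral_has_real_derivative[OF c_cont that])
  have g': "(g has_real_derivative c x * g x) (at x within {0..\<kappa>})" if "x \<in> {0..\<kappa>}" for x
  proof -
    note d = f_deriv[OF that, of S, unfolded g]
    show ?thesis
      unfolding g_def
      by (rule derivative_eq_intros d refl)+ (use nz[OF that] in \<open>simp add: c_def g_def field_simps\<close>)
  qed
  have "g 0 * exp (- I 0) \<le> g x * exp (- I x)"
  proof (rule mono_of_deriv_within[where a=0 and b=\<kappa> and f="\<lambda>x. g x * exp (- I x)" and f'="\<lambda>x. 0"])
    fix y assume y: "y \<in> {0..\<kappa>}"
    show "((\<lambda>x. g x * exp (- I x)) has_real_derivative 0) (at y within {0..\<kappa>})"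
      by (rule derivative_eq_intros g'[OF y] I'[OF y] refl)+ (simp add: algebra_simps)
  qed (use x in auto)
  moreover have "0 < g 0" using C \<alpha>_pos[of S] by (simp add: g_def f0)
  ultimately have "0 < g x * exp (- I x)" using mult_pos_pos[OF _ exp_gt_zero, of "g 0" "- I 0"] by linarith
  then show ?thesis unfolding g by (simp add: zero_less_mult_iff)
qed

lemma beta_nonneg:
  assumes "x \<in> {0..\<kappa>}"
  shows "0 \<le> beta reg r \<alpha> S (\<lambda>S. f S x)"
proof (cases reg)
  case At_crit
  then show ?thesis using crit_positive[OF _ assms] by (simp add: less_imp_le)
next
  case Below_inverse
  then show ?thesis using f_nonneg'[OF assms, of S] \<alpha>_pos[of S] by (auto intro!: zero_le_power)
next
  case At_inverse
  have "0 \<le> f T x + \<alpha> T" for T using f_nonneg'[OF assms, of T] \<alpha>_pos[of T] by simp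
  then show ?thesis unfolding At_inverse beta.simps
    by (intro infsum_nonneg sum_nonneg mult_nonneg_nonneg divide_nonneg_nonneg zero_le_power) auto
next
  case Above_inverse
  then show ?thesis by simp
qed

lemma rate_sum_pos: "x \<in> {0..\<kappa>} \<Longrightarrow> 0 < rate_sum x"
  using beta_nonneg[of x Red] beta_nonneg[of x Black] sol_at(2)[of x] in_domain[of x]
  by (simp add: rate_sum_def)

lemma clock_deriv: "x \<in> {0..\<kappa>} \<Longrightarrow> (clock has_real_derivative 1 / rate_sum x) (at x within {0..\<kappa>})"
  unfolding clock_def[abs_def]
  by (rule integral_has_real_derivative) (use sol_at(2) in_domain in \<open>auto intro!: continuous_intros rate_sum_cont\<close>)

text \<open>With h = 1/\<open>rate_sum\<close> the normalised vector field is written as rate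
  multiplied by elapsed time, the form in which the barriers are constructed.\<close>

lemma fluid: "fluid r p q a \<alpha> reg M X E L f clock (\<lambda>x. 1 / rate_sum x) \<kappa>"
proof (intro fluid.intro trajectory.intro)
  show "process_setup r p q a \<alpha> reg M X E L" by (rule process_setup_axioms)
  show "0 < \<kappa>" by (rule \<kappa>(1))
  show "0 \<le> damping reg" by (cases reg) (auto simp: damping_def)
  show "clock 0 = 0" by (simp add: clock_def)
  show "f S 0 = 0" for S by (rule f0)
  show "0 < 1 / rate_sum x" if "x \<in> {0..\<kappa>}" for x using rate_sum_pos[OF that] by simp
  show "(clock has_real_derivative 1 / rate_sum x) (at x within {0..\<kappa>})" if "x \<in> {0..\<kappa>}" for x
    by (rule clock_deriv[OF that])
  show "(f S has_real_derivative (own_rate reg r \<alpha> S (f S x) (f (other S) x) - damping reg * f S x) * (1 / rate_sum x))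
      (at x within {0..\<kappa>})" if "x \<in> {0..\<kappa>}" for x S
    using f_deriv[OF that, of S] unfolding beta_eq by simp
  show "0 \<le> own_rate reg r \<alpha> S (f S x) (f (other S) x) - damping reg * f S x" if "x \<in> {0..\<kappa>}" for x S
    using beta_nonneg[OF that, of S] unfolding beta_eq .
  show "\<exists>c>0. \<forall>S. \<forall>x\<in>{0..\<kappa>}. c \<le> own_rate reg r \<alpha> S (f S x) (f (other S) x) - damping reg * f S x"
    if "damping reg \<noteq> 0"
  proof -
    have reg: "reg = At_crit" using that by (cases reg) (auto simp: damping_def)
    have "\<exists>c>0. \<forall>x\<in>{0..\<kappa>}. c \<le> beta reg r \<alpha> S (\<lambda>S. f S x)" for S
    proof -
      obtain x0 where x0: "x0 \<in> {0..\<kappa>}"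
        "\<And>x. x \<in> {0..\<kappa>} \<Longrightarrow> beta reg r \<alpha> S (\<lambda>S. f S x0) \<le> beta reg r \<alpha> S (\<lambda>S. f S x)"
        using continuous_attains_inf[OF compact_Icc _ beta_cont[of S]] \<kappa> by auto
      then show ?thesis using crit_positive[OF reg x0(1), of S] by blast
    qed
    then obtain c where c: "\<And>S. 0 < c S" "\<And>S x. x \<in> {0..\<kappa>} \<Longrightarrow> c S \<le> beta reg r \<alpha> S (\<lambda>S. f S x)" by metis
    show ?thesis
    proof (intro exI[of _ "min (c Red) (c Black)"] conjI allI ballI)
      fix S x assume "x \<in> {0..\<kappa>}"
      then have "c S \<le> own_rate reg r \<alpha> S (f S x) (f (other S) x) - damping reg * f S x"
        using c(2)[of x S] unfolding beta_eq by simp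
      then show "min (c Red) (c Black) \<le> own_rate reg r \<alpha> S (f S x) (f (other S) x) - damping reg * f S x"
        by (cases S) auto
    qed (use c(1) in auto)
  qed
  show "\<exists>\<epsilon>0>0. \<exists>K\<ge>0. \<forall>S. \<forall>z\<in>{0..\<kappa>}. \<forall>x\<ge>0. \<forall>y\<ge>0.
    \<bar>x - f S z\<bar> \<le> \<epsilon>0 \<longrightarrow> \<bar>y - f (other S) z\<bar> \<le> \<epsilon>0 \<longrightarrow> rate_domain reg \<alpha> S x y \<and>
    \<bar>own_rate reg r \<alpha> S x y - own_rate reg r \<alpha> S (f S z) (f (other S) z)\<bar>
      \<le> K * (\<bar>x - f S z\<bar> + \<bar>y - f (other S) z\<bar>)"
    by (rule rate_neighbourhood)
qed

text \<open>The components of the normalised vector field sum to 1.\<close>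

lemma f_total: "x \<in> {0..\<kappa>} \<Longrightarrow> f Red x + f Black x = x"
proof -
  assume x: "x \<in> {0..\<kappa>}"
  have d: "((\<lambda>x. f Red x + f Black x - x) has_real_derivative 0) (at y within {0..\<kappa>})" if "y \<in> {0..\<kappa>}" for y
  proof -
    have "beta reg r \<alpha> Red (\<lambda>S. f S y) / rate_sum y + beta reg r \<alpha> Black (\<lambda>S. f S y) / rate_sum y = 1"
      using rate_sum_pos[OF that] by (simp add: add_divide_distrib[symmetric] rate_sum_def[symmetric])
    moreover note d = f_deriv[OF that]
    ultimately show ?thesis by - (rule derivative_eq_intros d refl | simp)+
  qed
  have "f Red 0 + f Black 0 - 0 \<le> f Red x + f Black x - x"
    by (rule mono_of_deriv_within[where a=0 and b=\<kappa> and f'="\<lambda>_. 0", OF d]) (use x in auto)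
  moreover have "- (f Red 0 + f Black 0 - 0) \<le> - (f Red x + f Black x - x)"
    by (rule mono_of_deriv_within[where a=0 and b=\<kappa> and f="\<lambda>x. - (f Red x + f Black x - x)" and f'="\<lambda>_. - 0", OF DERIV_minus[OF d]])
      (use x in auto)
  ultimately show ?thesis using f0 by simp
qed

lemma clock_nonneg: "0 \<le> clock \<kappa>"
  using fluid.axioms(2)[OF fluid] trajectory.\<tau>_mono[of f clock _ _ _ \<kappa> _ 0 \<kappa>] \<kappa> by (auto simp: clock_def)

text \<open>Separates the only case in which a colour does not grow, Black for q >> 1/p. A colour
  that exceeds some positive level belongs to the first alternative, so its count is strictly
  increasing and can be inverted.\<close>

lemma beta_positive_or_zero:
  "(\<forall>x\<in>{0..\<kappa>}. 0 < beta reg r \<alpha> S (\<lambda>S. f S x)) \<or> (reg = Above_inverse \<and> S = Black \<and> (\<forall>x\<in>{0..\<kappa>}. f S x \<le> 0))"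
proof (cases reg)
  case At_crit
  then show ?thesis using crit_positive by blast
next
  case Below_inverse
  have "0 < f S x + \<alpha> S" if "x \<in> {0..\<kappa>}" for x using f_nonneg'[OF that, of S] \<alpha>_pos[of S] by simp
  then show ?thesis using Below_inverse by auto
next
  case At_inverse
  have "0 < own_rate reg r \<alpha> S (f S x) (f (other S) x)" if "x \<in> {0..\<kappa>}" for x
    by (rule at_inverse_pos[OF At_inverse f_nonneg'[OF that] f_nonneg'[OF that]])
  then show ?thesis using At_inverse by (auto simp: beta_eq damping_def simp del: beta.simps)
next
  case Above_inverse
  have rates: "beta reg r \<alpha> Red (\<lambda>S. f S x) = 1" "beta reg r \<alpha> Black (\<lambda>S. f S x) = 0" if "x \<in> {0..\<kappa>}" for x
  proof -
    have "own_rate reg r \<alpha> Red (f Red x) (f Black x) = 1" "own_rate reg r \<alpha> (other Red) (f Black x) (f Red x) = 0"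
      using above_rates[where x="f Red x" and y="f Black x" and S=Red, OF Above_inverse f_nonneg'[OF that] f_nonneg'[OF that]] above_gap[OF Above_inverse that] by auto
    then show "beta reg r \<alpha> Red (\<lambda>S. f S x) = 1" "beta reg r \<alpha> Black (\<lambda>S. f S x) = 0"
      unfolding beta_eq by (simp_all add: Above_inverse damping_def)
  qed
  show ?thesis
  proof (cases S)
    case Red
    then show ?thesis using rates(1) by simp
  next
    case Black
    have "f Black x \<le> 0" if x: "x \<in> {0..\<kappa>}" for x
    proof -
      have "- f Black 0 \<le> - f Black x"
      proof (rule mono_of_deriv_within[where a=0 and b=\<kappa> and f="\<lambda>x. - f Black x" and f'="\<lambda>_. - 0"])
        fix y assume y: "y \<in> {0..\<kappa>}"
        have "(f Black has_real_derivative 0) (at y within {0..\<kappa>})"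
          using f_deriv[OF y, of Black] unfolding rates(2)[OF y] by simp
        then show "((\<lambda>x. - f Black x) has_real_derivative - 0) (at y within {0..\<kappa>})" by (rule DERIV_minus)
      qed (use x in auto)
      then show ?thesis by (simp add: f0)
    qed
    then show ?thesis using Black Above_inverse by simp
  qed
qed

lemma f_strict_mono:
  assumes pos: "\<And>x. x \<in> {0..\<kappa>} \<Longrightarrow> 0 < beta reg r \<alpha> S (\<lambda>S. f S x)" and xy: "0 \<le> x" "x < y" "y \<le> \<kappa>"
  shows "f S x < f S y"
proof (rule DERIV_pos_imp_increasing_open[OF xy(2), of "f S"])
  show "continuous_on {x..y} (f S)" by (rule continuous_on_subset[OF f_cont]) (use xy in auto)
  fix z assume z: "x < z" "z < y"
  then have zI: "z \<in> {0..\<kappa>}" using xy by auto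
  have "at z within {0..\<kappa>} = at z" using z xy by (intro at_within_Icc_at) auto
  then show "\<exists>d. (f S has_real_derivative d) (at z) \<and> 0 < d"
    using f_deriv[OF zI, of S] pos[OF zI] rate_sum_pos[OF zI] by (auto intro!: exI divide_pos_pos)
qed

end

end

section \<open>Limits of the activation times\<close>

context cauchy
begin

lemma counts_at:
  assumes "0 < x" "ereal x < \<kappa>f" "0 < \<epsilon>"
  shows "AE \<omega> in M. \<forall>\<^sub>F n in sequentially. \<forall>S.
    (f S x - \<epsilon>) * q n - 1 \<le> real (node_count n \<omega> S (clock x / eta reg r p q n)) \<and>
    real (node_count n \<omega> S (clock x / eta reg r p q n)) \<le> (f S x + \<epsilon>) * q n"
  by (rule fluid.node_count_limit[OF fluid[OF assms(1,2)] assms(3)])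

lemma good_at:
  assumes "bootstrap.good_clocks (n_white a n) (\<lambda>v j. X n v j \<omega>)"
  shows "good_bootstrap r (n_white a n) (\<lambda>v j. X n v j \<omega>)"
  using assms r2 by (intro good_bootstrap.intro) auto

lemma eventually_q_ge: "\<forall>\<^sub>F n in sequentially. c \<le> q n"
  using filterlim_at_top[THEN iffD1, OF q_top] by blast

lemma eventually_slack:
  assumes "0 < c"
  shows "\<forall>\<^sub>F n in sequentially. b \<le> c * q n"
  using eventually_q_ge[of "b / c"] by eventually_elim (use assms in \<open>simp add: divide_le_eq mult.commute\<close>)

lemma total_count_ge:
  assumes \<kappa>: "0 \<le> \<kappa>" "\<kappa> < x" "ereal x < \<kappa>f"
  shows "AE \<omega> in M. \<forall>\<^sub>F n in sequentially. nat \<lfloor>\<kappa> * q n\<rfloor>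
    \<le> node_count n \<omega> Red (clock x / eta reg r p q n) + node_count n \<omega> Black (clock x / eta reg r p q n)"
proof -
  \<comment> \<open>Of the slack 4 \<epsilon> q, half covers the deviations of the two colours and
    half their two rounding errors.\<close>
  define \<epsilon> where "\<epsilon> = (x - \<kappa>) / 4"
  have \<epsilon>: "0 < \<epsilon>" using \<kappa> by (simp add: \<epsilon>_def)
  have x0: "0 < x" using \<kappa> by simp
  have fx: "f Red x + f Black x = x" using f_total[OF x0 \<kappa>(3)] x0 by simp
  show ?thesis
    using counts_at[OF x0 \<kappa>(3) \<epsilon>]
  proof eventually_elim
    case (elim \<omega>)
    have "\<forall>\<^sub>F n in sequentially. 2 \<le> 2 * \<epsilon> * q n" by (rule eventually_slack) (use \<epsilon> in simp)
    then show ?case using elim q_pos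
    proof eventually_elim
      case 1: (elim n)
      let ?N = "\<lambda>S. real (node_count n \<omega> S (clock x / eta reg r p q n))"
      have "(f Red x - \<epsilon>) * q n - 1 + ((f Black x - \<epsilon>) * q n - 1) \<le> ?N Red + ?N Black"
        using 1 by (intro add_mono) auto
      moreover have "(f Red x - \<epsilon>) * q n - 1 + ((f Black x - \<epsilon>) * q n - 1) = (f Red x + f Black x) * q n - 2 * \<epsilon> * q n - 2"
        by (simp add: algebra_simps)
      moreover have "x * q n - 2 * \<epsilon> * q n - 2 * \<epsilon> * q n = \<kappa> * q n" by (simp add: \<epsilon>_def algebra_simps)
      ultimately have "\<kappa> * q n \<le> ?N Red + ?N Black" using 1(1) unfolding fx by linarith
      moreover have "real (nat \<lfloor>\<kappa> * q n\<rfloor>) \<le> \<kappa> * q n" using \<kappa>(1) 1 by simp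
      ultimately show ?case by linarith
    qed
  qed
qed

lemma total_count_less:
  assumes \<kappa>: "0 < x" "x < \<kappa>" "ereal \<kappa> < \<kappa>f"
  shows "AE \<omega> in M. \<forall>\<^sub>F n in sequentially.
    node_count n \<omega> Red (clock x / eta reg r p q n) + node_count n \<omega> Black (clock x / eta reg r p q n)
    < nat \<lfloor>\<kappa> * q n\<rfloor>"
proof -
  define \<epsilon> where "\<epsilon> = (\<kappa> - x) / 4"
  have \<epsilon>: "0 < \<epsilon>" using \<kappa> by (simp add: \<epsilon>_def)
  have x\<kappa>: "ereal x < \<kappa>f" using \<kappa> by (auto intro: less_trans[of _ "ereal \<kappa>"])
  have fx: "f Red x + f Black x = x" using f_total[OF \<kappa>(1) x\<kappa>] \<kappa> by simp
  show ?thesis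
    using counts_at[OF \<kappa>(1) x\<kappa> \<epsilon>]
  proof eventually_elim
    case (elim \<omega>)
    have "\<forall>\<^sub>F n in sequentially. 2 \<le> 2 * \<epsilon> * q n" by (rule eventually_slack) (use \<epsilon> in simp)
    then show ?case using elim q_pos
    proof eventually_elim
      case 1: (elim n)
      let ?N = "\<lambda>S. real (node_count n \<omega> S (clock x / eta reg r p q n))"
      have "?N Red + ?N Black \<le> (f Red x + \<epsilon>) * q n + (f Black x + \<epsilon>) * q n"
        using 1 by (intro add_mono) auto
      moreover have "(f Red x + \<epsilon>) * q n + (f Black x + \<epsilon>) * q n = (f Red x + f Black x) * q n + 2 * \<epsilon> * q n"
        by (simp add: algebra_simps)
      moreover have "x * q n + 2 * \<epsilon> * q n + 2 * \<epsilon> * q n = \<kappa> * q n" by (simp add: \<epsilon>_def algebra_simps)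
      ultimately have "?N Red + ?N Black \<le> \<kappa> * q n - 2" using 1(1) unfolding fx by linarith
      moreover have "\<kappa> * q n - 1 < real (nat \<lfloor>\<kappa> * q n\<rfloor>)" by linarith
      ultimately have "?N Red + ?N Black < real (nat \<lfloor>\<kappa> * q n\<rfloor>)" by linarith
      then show ?case by linarith
    qed
  qed
qed

lemma color_count_ge:
  assumes \<kappa>: "0 \<le> y" "y < f S x" "0 < x" "ereal x < \<kappa>f"
  shows "AE \<omega> in M. \<forall>\<^sub>F n in sequentially. nat \<lfloor>y * q n\<rfloor> \<le> node_count n \<omega> S (clock x / eta reg r p q n)"
proof -
  define \<epsilon> where "\<epsilon> = (f S x - y) / 2"
  have \<epsilon>: "0 < \<epsilon>" using \<kappa> by (simp add: \<epsilon>_def)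
  show ?thesis
    using counts_at[OF \<kappa>(3,4) \<epsilon>]
  proof eventually_elim
    case (elim \<omega>)
    show ?case using elim eventually_slack[OF \<epsilon>, of 1] q_pos
    proof eventually_elim
      case (elim n)
      have "(f S x - \<epsilon>) * q n - \<epsilon> * q n = y * q n" by (simp add: \<epsilon>_def algebra_simps)
      moreover have "(f S x - \<epsilon>) * q n - 1 \<le> real (node_count n \<omega> S (clock x / eta reg r p q n))" using elim(1) by blast
      ultimately have "y * q n \<le> real (node_count n \<omega> S (clock x / eta reg r p q n))" using elim(2) by linarith
      moreover have "real (nat \<lfloor>y * q n\<rfloor>) \<le> y * q n" using \<kappa>(1) elim by simp
      ultimately show ?case by linarith
    qed
  qed
qed

lemma color_count_less:
  assumes \<kappa>: "f S x < y" "0 < x" "ereal x < \<kappa>f"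
  shows "AE \<omega> in M. \<forall>\<^sub>F n in sequentially. node_count n \<omega> S (clock x / eta reg r p q n) < nat \<lfloor>y * q n\<rfloor>"
proof -
  define \<epsilon> where "\<epsilon> = (y - f S x) / 2"
  have \<epsilon>: "0 < \<epsilon>" using \<kappa> by (simp add: \<epsilon>_def)
  show ?thesis
    using counts_at[OF \<kappa>(2,3) \<epsilon>]
  proof eventually_elim
    case (elim \<omega>)
    show ?case using elim eventually_slack[OF \<epsilon>, of 1]
    proof eventually_elim
      case (elim n)
      have "(f S x + \<epsilon>) * q n + \<epsilon> * q n = y * q n" by (simp add: \<epsilon>_def algebra_simps)
      moreover have "real (node_count n \<omega> S (clock x / eta reg r p q n)) \<le> (f S x + \<epsilon>) * q n" using elim(1) by blast
      ultimately have "real (node_count n \<omega> S (clock x / eta reg r p q n)) \<le> y * q n - 1" using elim(2) by linarith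
      moreover have "y * q n - 1 < real (nat \<lfloor>y * q n\<rfloor>)" by linarith
      ultimately have "real (node_count n \<omega> S (clock x / eta reg r p q n)) < real (nat \<lfloor>y * q n\<rfloor>)" by linarith
      then show ?case by linarith
    qed
  qed
qed

lemma scaled_time:
  assumes "0 < eta reg r p q n"
  shows "Z \<le> ereal (c / eta reg r p q n) \<Longrightarrow> ereal (eta reg r p q n) * Z \<le> ereal c"
    and "ereal (c / eta reg r p q n) \<le> Z \<Longrightarrow> ereal c \<le> ereal (eta reg r p q n) * Z"
proof -
  have c: "ereal c = ereal (eta reg r p q n) * ereal (c / eta reg r p q n)" using assms by simp
  show "Z \<le> ereal (c / eta reg r p q n) \<Longrightarrow> ereal (eta reg r p q n) * Z \<le> ereal c"
    unfolding c using assms by (intro ereal_mult_left_mono) auto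
  show "ereal (c / eta reg r p q n) \<le> Z \<Longrightarrow> ereal c \<le> ereal (eta reg r p q n) * Z"
    unfolding c using assms by (intro ereal_mult_left_mono) auto
qed

lemma clock_scaled_nonneg: "0 < x \<Longrightarrow> ereal x < \<kappa>f \<Longrightarrow> 0 < eta reg r p q n \<Longrightarrow> 0 \<le> clock x / eta reg r p q n"
  using clock_nonneg[of x] by simp

lemma exists_above: "ereal \<kappa> < \<kappa>f \<Longrightarrow> \<exists>x>\<kappa>. ereal x < \<kappa>f"
  using ereal_dense2[of "ereal \<kappa>" \<kappa>f] by auto

section \<open>From counts to limits of activation times\<close>

lemma T_upper:
  assumes \<kappa>: "0 \<le> \<kappa>" "\<kappa> < x" "ereal x < \<kappa>f"
  shows "AE \<omega> in M. \<forall>\<^sub>F n in sequentially.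
    ereal (eta reg r p q n) * T r a X E L n (nat \<lfloor>\<kappa> * q n\<rfloor>) \<omega> \<le> ereal (clock x)"
  using total_count_ge[OF \<kappa>] AE_good_clocks
proof eventually_elim
  case (elim \<omega>)
  show ?case using elim(1) eta_pos
  proof eventually_elim
    case n: (elim n)
    interpret good_bootstrap r "n_white a n" "\<lambda>S. a S n" "\<lambda>v j. X n v j \<omega>" "\<lambda>S v i. E n S v i \<omega>" "\<lambda>k. L n k \<omega>"
      using elim(2) by (intro good_at) blast
    have s: "0 \<le> clock x / eta reg r p q n" using clock_scaled_nonneg \<kappa> n(2) by simp
    show ?case unfolding T_def by (rule scaled_time(1)[OF n(2) activation_time_le(2)[OF s n(1)]])
  qed
qed

lemma T_lower:
  assumes \<kappa>: "0 < x" "x < \<kappa>" "ereal \<kappa> < \<kappa>f"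
  shows "AE \<omega> in M. \<forall>\<^sub>F n in sequentially.
    ereal (clock x) \<le> ereal (eta reg r p q n) * T r a X E L n (nat \<lfloor>\<kappa> * q n\<rfloor>) \<omega>"
proof -
  \<comment> \<open>At the later point \<open>x'\<close> more than \<kappa> q nodes are coloured,
    which certifies that this activation does not come after K*.\<close>
  obtain x' where x': "\<kappa> < x'" "ereal x' < \<kappa>f" using exists_above[OF \<kappa>(3)] by blast
  have x\<kappa>: "ereal x < \<kappa>f" using \<kappa> by (auto intro: less_trans[of _ "ereal \<kappa>"])
  have \<kappa>0: "0 \<le> \<kappa>" using \<kappa> by simp
  show ?thesis
    using total_count_less[OF \<kappa>] total_count_ge[OF \<kappa>0 x'] AE_good_clocks
  proof eventually_elim
    case (elim \<omega>)
    show ?case using elim(1,2) eta_pos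
    proof eventually_elim
      case n: (elim n)
      interpret good_bootstrap r "n_white a n" "\<lambda>S. a S n" "\<lambda>v j. X n v j \<omega>" "\<lambda>S v i. E n S v i \<omega>" "\<lambda>k. L n k \<omega>"
        using elim(3) by (intro good_at) blast
      have s: "0 \<le> clock x / eta reg r p q n" "0 \<le> clock x' / eta reg r p q n"
        using clock_scaled_nonneg \<kappa> x' x\<kappa> n(3) by simp_all
      show ?case unfolding T_def
        by (rule scaled_time(2)[OF n(3) activation_time_ge[OF s(1) activation_time_le(1)[OF s(2) n(2)] n(1)]])
    qed
  qed
qed

lemma T_color_upper:
  assumes "0 \<le> y" "y < f S x" "0 < x" "ereal x < \<kappa>f"
  shows "AE \<omega> in M. \<forall>\<^sub>F n in sequentially.
    ereal (eta reg r p q n) * T_color r a X E L S n (nat \<lfloor>y * q n\<rfloor>) \<omega> \<le> ereal (clock x)"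
  using color_count_ge[OF assms] AE_good_clocks
proof eventually_elim
  case (elim \<omega>)
  show ?case using elim(1) eta_pos
  proof eventually_elim
    case n: (elim n)
    interpret good_bootstrap r "n_white a n" "\<lambda>S. a S n" "\<lambda>v j. X n v j \<omega>" "\<lambda>S v i. E n S v i \<omega>" "\<lambda>k. L n k \<omega>"
      using elim(2) by (intro good_at) blast
    have s: "0 \<le> clock x / eta reg r p q n" using clock_scaled_nonneg assms n(2) by simp
    show ?case unfolding T_color_def by (rule scaled_time(1)[OF n(2) color_activation_time_le[OF s n(1)]])
  qed
qed

lemma T_color_lower:
  assumes x: "f S x < y" "0 < x" "ereal x < \<kappa>f" and x': "0 \<le> y" "y < f S x'" "0 < x'" "ereal x' < \<kappa>f"
  shows "AE \<omega> in M. \<forall>\<^sub>F n in sequentially.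
    ereal (clock x) \<le> ereal (eta reg r p q n) * T_color r a X E L S n (nat \<lfloor>y * q n\<rfloor>) \<omega>"
  using color_count_less[OF x] color_count_ge[OF x'] AE_good_clocks
proof eventually_elim
  case (elim \<omega>)
  show ?case using elim(1,2) eta_pos
  proof eventually_elim
    case n: (elim n)
    interpret good_bootstrap r "n_white a n" "\<lambda>S. a S n" "\<lambda>v j. X n v j \<omega>" "\<lambda>S v i. E n S v i \<omega>" "\<lambda>k. L n k \<omega>"
      using elim(3) by (intro good_at) blast
    have s: "0 \<le> clock x / eta reg r p q n" "0 \<le> clock x' / eta reg r p q n"
      using clock_scaled_nonneg x x' n(3) by simp_all
    show ?case unfolding T_color_def
      by (rule scaled_time(2)[OF n(3) color_activation_time_ge[OF s n(1,2)]])
  qed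
qed

text \<open>Each bound holds outside a null set that depends on x. Two sequences converging to
  \<kappa> from below and above reduce this to countably many null sets, and continuity of
  \<open>clock\<close> closes the gap.\<close>

lemma AE_tendsto_clock:
  fixes Z :: "nat \<Rightarrow> _ \<Rightarrow> ereal"
  assumes \<kappa>: "0 < \<kappa>" "ereal \<kappa> < \<kappa>f"
    and lower: "\<And>x. 0 < x \<Longrightarrow> x < \<kappa> \<Longrightarrow> AE \<omega> in M. \<forall>\<^sub>F n in sequentially. ereal (clock x) \<le> Z n \<omega>"
    and upper: "\<And>x. \<kappa> < x \<Longrightarrow> ereal x < \<kappa>f \<Longrightarrow> AE \<omega> in M. \<forall>\<^sub>F n in sequentially. Z n \<omega> \<le> ereal (clock x)"
  shows "AE \<omega> in M. (\<lambda>n. Z n \<omega>) \<longlonglongrightarrow> ereal (clock \<kappa>)"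
proof -
  obtain \<kappa>1 where \<kappa>1: "\<kappa> < \<kappa>1" "ereal \<kappa>1 < \<kappa>f" using exists_above[OF \<kappa>(2)] by blast
  have \<kappa>1pos: "0 < \<kappa>1" using \<kappa> \<kappa>1 by simp
  \<comment> \<open>Two successors keep the factor strictly below 1, so all points are positive here
    and stay below \<kappa>1 in the next definition.\<close>
  define x where "x k = \<kappa> - \<kappa> * inverse (real (Suc (Suc k)))" for k
  define y where "y k = \<kappa> + (\<kappa>1 - \<kappa>) * inverse (real (Suc (Suc k)))" for k
  have inv: "0 < inverse (real (Suc (Suc k)))" "inverse (real (Suc (Suc k))) < 1" for k
    by (auto simp: inverse_eq_divide)
  have x: "0 < x k" "x k < \<kappa>" for k
    using \<kappa> inv[of k] mult_strict_left_mono[OF inv(2)[of k] \<kappa>(1)] by (auto simp: x_def)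
  have y: "\<kappa> < y k" "y k < \<kappa>1" for k
  proof -
    have d: "0 < \<kappa>1 - \<kappa>" using \<kappa>1 by simp
    show "\<kappa> < y k" "y k < \<kappa>1"
      using mult_pos_pos[OF d inv(1)[of k]] mult_strict_left_mono[OF inv(2)[of k] d] by (auto simp: y_def)
  qed
  have y\<kappa>: "ereal (y k) < \<kappa>f" for k using y(2)[of k] \<kappa>1(2) by (auto intro: less_trans[of _ "ereal \<kappa>1"])
  have lim0: "(\<lambda>k. inverse (real (Suc (Suc k)))) \<longlonglongrightarrow> 0"
    using LIMSEQ_inverse_real_of_nat by (rule LIMSEQ_Suc)
  have cont: "continuous_on {0..\<kappa>1} clock" by (rule DERIV_continuous_on[OF clock_deriv[OF \<kappa>1pos \<kappa>1(2)]])
  have cx: "(\<lambda>k. clock (x k)) \<longlonglongrightarrow> clock \<kappa>"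
  proof (rule continuous_on_tendsto_compose[OF cont])
    show "x \<longlonglongrightarrow> \<kappa>" unfolding x_def using tendsto_diff[OF tendsto_const tendsto_mult[OF tendsto_const lim0], of \<kappa> \<kappa>] by simp
    show "\<forall>\<^sub>F k in sequentially. x k \<in> {0..\<kappa>1}" using x \<kappa>1 by (intro always_eventually allI) (auto intro: less_imp_le less_trans)
  qed (use \<kappa> \<kappa>1 in auto)
  have cy: "(\<lambda>k. clock (y k)) \<longlonglongrightarrow> clock \<kappa>"
  proof (rule continuous_on_tendsto_compose[OF cont])
    show "y \<longlonglongrightarrow> \<kappa>" unfolding y_def using tendsto_add[OF tendsto_const tendsto_mult[OF tendsto_const lim0], of \<kappa> "\<kappa>1 - \<kappa>"] by simp
    show "\<forall>\<^sub>F k in sequentially. y k \<in> {0..\<kappa>1}" using y \<kappa> by (intro always_eventually allI) (auto intro: less_imp_le less_trans)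
  qed (use \<kappa> \<kappa>1 in auto)
  have "AE \<omega> in M. \<forall>k. (\<forall>\<^sub>F n in sequentially. ereal (clock (x k)) \<le> Z n \<omega>) \<and> (\<forall>\<^sub>F n in sequentially. Z n \<omega> \<le> ereal (clock (y k)))"
    unfolding AE_all_countable using lower[OF x] upper[OF y(1) y\<kappa>] by (intro allI AE_conjI)
  then show ?thesis
  proof eventually_elim
    case (elim \<omega>)
    show ?case
    proof (rule order_tendstoI)
      fix b assume b: "b < ereal (clock \<kappa>)"
      have "(\<lambda>k. ereal (clock (x k))) \<longlonglongrightarrow> ereal (clock \<kappa>)" using cx by simp
      then have "\<forall>\<^sub>F k in sequentially. b < ereal (clock (x k))" by (rule order_tendstoD(1)[OF _ b])
      then obtain k where "b < ereal (clock (x k))" by (auto simp: eventually_sequentially)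
      then show "\<forall>\<^sub>F n in sequentially. b < Z n \<omega>"
        by (intro eventually_mono[OF conjunct1[OF elim[rule_format, of k]]]) (rule less_le_trans)
    next
      fix b assume b: "ereal (clock \<kappa>) < b"
      have "(\<lambda>k. ereal (clock (y k))) \<longlonglongrightarrow> ereal (clock \<kappa>)" using cy by simp
      then have "\<forall>\<^sub>F k in sequentially. ereal (clock (y k)) < b" by (rule order_tendstoD(2)[OF _ b])
      then obtain k where "ereal (clock (y k)) < b" by (auto simp: eventually_sequentially)
      then show "\<forall>\<^sub>F n in sequentially. Z n \<omega> < b"
        by (intro eventually_mono[OF conjunct2[OF elim[rule_format, of k]]]) (rule le_less_trans)
    qed
  qed
qed

theorem T_limit:
  assumes "0 \<le> \<kappa>" "ereal \<kappa> < \<kappa>f"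
  shows "AE \<omega> in M. (\<lambda>n. ereal (eta reg r p q n) * T r a X E L n (nat \<lfloor>\<kappa> * q n\<rfloor>) \<omega>) \<longlonglongrightarrow> ereal (clock \<kappa>)"
proof (cases "\<kappa> = 0")
  case True
  then show ?thesis by (simp add: T_def bootstrap.activation_time_0 clock_def zero_ereal_def[symmetric])
next
  case False
  then show ?thesis using assms T_lower T_upper by (intro AE_tendsto_clock) auto
qed

lemma f_mono_within:
  assumes "0 \<le> x" "x \<le> y" "ereal y < \<kappa>f"
  shows "f S x \<le> f S y"
proof (cases "y = 0")
  case False
  then have y: "0 < y" using assms by simp
  show ?thesis
    by (rule mono_of_deriv_within[OF f_deriv[OF y assms(3)]])
      (use assms beta_nonneg[OF y assms(3)] rate_sum_pos[OF y assms(3)] in \<open>auto intro!: divide_nonneg_pos\<close>)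
qed (use assms in simp)

text \<open>\<open>Lim\<close> denotes a limit only if one exists. Since f_S is non-decreasing, the
  left limit at \<open>\<kappa>f\<close>, finite or not, exists and is the supremum of the
  values.\<close>

lemma left_limit_reached:
  assumes c: "ereal c < Lim (at_left \<kappa>f) (\<lambda>x. ereal (f S (real_of_ereal x)))"
  shows "\<exists>x. 0 \<le> x \<and> ereal x < \<kappa>f \<and> c < f S x"
proof (rule ccontr)
  assume no: "\<not> ?thesis"
  let ?g = "\<lambda>x. ereal (f S (real_of_ereal x))"
  let ?A = "{x. 0 \<le> x \<and> x < \<kappa>f}"
  have real: "\<exists>z. x = ereal z \<and> 0 \<le> z" if "x \<in> ?A" for x using that by (cases x) auto
  have mono: "?g x \<le> ?g y" if "x \<in> ?A" "y \<in> ?A" "x \<le> y" for x y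
    using real[OF that(1)] real[OF that(2)] that f_mono_within by fastforce
  have lim: "(?g \<longlongrightarrow> (SUP x\<in>?A. ?g x)) (at_left \<kappa>f)"
  proof (rule order_tendstoI)
    fix b assume "b < (SUP x\<in>?A. ?g x)"
    then obtain x where x: "x \<in> ?A" "b < ?g x" by (auto simp: less_SUP_iff)
    then have "\<forall>y>x. y < \<kappa>f \<longrightarrow> b < ?g y" using mono by (auto intro: less_le_trans)
    then show "\<forall>\<^sub>F y in at_left \<kappa>f. b < ?g y" using x by (subst eventually_at_left[OF \<kappa>f_pos]) auto
  next
    fix b assume b: "(SUP x\<in>?A. ?g x) < b"
    have "?g y < b" if "0 < y" "y < \<kappa>f" for y
      using that by (intro le_less_trans[OF SUP_upper b]) auto
    then show "\<forall>\<^sub>F y in at_left \<kappa>f. ?g y < b" using \<kappa>f_pos by (subst eventually_at_left[OF \<kappa>f_pos]) auto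
  qed
  have "\<not> trivial_limit (at_left \<kappa>f)"
    unfolding trivial_limit_def eventually_at_left[OF \<kappa>f_pos] using dense by blast
  then have "Lim (at_left \<kappa>f) ?g = (SUP x\<in>?A. ?g x)" using lim by (rule tendsto_Lim)
  also have "\<dots> \<le> ereal c"
  proof (rule SUP_least)
    fix x assume "x \<in> ?A"
    then obtain z where "x = ereal z" "0 \<le> z" "ereal z < \<kappa>f" using real by blast
    then show "?g x \<le> ereal c" using no by (auto simp: not_less)
  qed
  finally show False using c by simp
qed

theorem T_color_limit:
  assumes c: "0 < c" and less: "ereal c < Lim (at_left \<kappa>f) (\<lambda>x. ereal (f S (real_of_ereal x)))"
  shows "AE \<omega> in M. (\<lambda>n. ereal (eta reg r p q n) * T_color r a X E L S n (nat \<lfloor>c * q n\<rfloor>) \<omega>)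
    \<longlonglongrightarrow> ereal (clock (the_inv_into {x. 0 \<le> x \<and> ereal x < \<kappa>f} (f S) c))"
proof -
  obtain x1 where x1: "0 \<le> x1" "ereal x1 < \<kappa>f" "c < f S x1" using left_limit_reached[OF less] by blast
  then have x1pos: "0 < x1" using c f0[of S] by (cases "x1 = 0") auto
  obtain \<kappa> where \<kappa>: "0 \<le> \<kappa>" "\<kappa> \<le> x1" "f S \<kappa> = c"
    using IVT'[of "f S" 0 c x1] f_cont[OF x1pos x1(2), of S] f0[of S] c x1 by auto
  have \<kappa>pos: "0 < \<kappa>" using \<kappa> c f0[of S] by (cases "\<kappa> = 0") auto
  have \<kappa>\<kappa>: "ereal \<kappa> < \<kappa>f" using \<kappa>(2) x1(2) by (auto intro: le_less_trans[of _ "ereal x1"])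
  have strict: "f S x < f S y" if "0 \<le> x" "x < y" "ereal y < \<kappa>f" for x y
  proof -
    \<comment> \<open>An interval containing both \<open>y\<close> and \<open>x1\<close>: the
      positive value at \<open>x1\<close> rules out the degenerate alternative on all of it.\<close>
    define z where "z = max x1 y"
    have z: "0 < z" "ereal z < \<kappa>f" "y \<le> z" "x1 \<in> {0..z}" using x1 x1pos that by (auto simp: z_def max_def)
    have "\<not> f S x1 \<le> 0" using x1(3) c by simp
    then have "\<forall>x\<in>{0..z}. 0 < beta reg r \<alpha> S (\<lambda>S. f S x)"
      using beta_positive_or_zero[OF z(1,2), of S] z(4) by blast
    then show ?thesis using that z by (intro f_strict_mono[OF z(1,2)]) auto
  qed
  \<comment> \<open>Injectivity on the whole domain identifies \<open>the_inv_into\<close> with the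
    preimage obtained from the intermediate value theorem.\<close>
  have "inj_on (f S) {x. 0 \<le> x \<and> ereal x < \<kappa>f}"
    by (rule linorder_inj_onI') (use strict in fastforce)
  then have inv: "the_inv_into {x. 0 \<le> x \<and> ereal x < \<kappa>f} (f S) c = \<kappa>"
    using \<kappa> \<kappa>\<kappa> by (intro the_inv_into_f_eq) auto
  show ?thesis
    unfolding inv
  proof (rule AE_tendsto_clock[OF \<kappa>pos \<kappa>\<kappa>])
    show "AE \<omega> in M. \<forall>\<^sub>F n in sequentially. ereal (clock x)
        \<le> ereal (eta reg r p q n) * T_color r a X E L S n (nat \<lfloor>c * q n\<rfloor>) \<omega>" if x: "0 < x" "x < \<kappa>" for x
    proof (rule T_color_lower[OF _ x(1) _ _ x1(3) x1pos x1(2)])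
      show "f S x < c" using strict[of x \<kappa>] x \<kappa> \<kappa>\<kappa> by simp
      show "ereal x < \<kappa>f" using x \<kappa>\<kappa> by (auto intro: less_trans[of _ "ereal \<kappa>"])
    qed (use c in simp)
    show "AE \<omega> in M. \<forall>\<^sub>F n in sequentially. ereal (eta reg r p q n) * T_color r a X E L S n (nat \<lfloor>c * q n\<rfloor>) \<omega>
        \<le> ereal (clock x)" if x: "\<kappa> < x" "ereal x < \<kappa>f" for x
      using strict[of \<kappa> x] x \<kappa> \<kappa>pos c by (intro T_color_upper) auto
  qed
qed

end

theorem theorem4p8:
  fixes M :: "'w measure"
    and r :: nat
    and p q :: "nat \<Rightarrow> real"
    and a :: "color \<Rightarrow> nat \<Rightarrow> nat"
    and \<alpha> :: "color \<Rightarrow> real"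
    and reg :: regime
    and X :: "nat \<Rightarrow> nat \<Rightarrow> nat \<Rightarrow> 'w \<Rightarrow> real"
    and E :: "nat \<Rightarrow> color \<Rightarrow> nat \<Rightarrow> nat \<Rightarrow> 'w \<Rightarrow> bool"
    and L :: "nat \<Rightarrow> nat \<Rightarrow> 'w \<Rightarrow> real"
    and f :: "color \<Rightarrow> real \<Rightarrow> real"
    and \<kappa>f :: ereal
  assumes "r \<ge> 2"
    and "\<forall>n\<ge>1. 0 < p n \<and> p n < 1"
    and "(\<lambda>n. 1 / real n) \<in> o(p)"
    and "p \<in> o(\<lambda>n. 1 / (real n powr (1 / real r) * ln (real n)))"
    and "in_regime reg r p q"
    and "\<forall>S. (\<lambda>n. real (a S n) / q n) \<longlonglongrightarrow> \<alpha> S"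
    and "\<alpha> Red > \<alpha> Black" and "\<alpha> Black > 0"
    and "random_input M p (n_white a) X E L"
    and "maximal_solution (beta reg r \<alpha>) f \<kappa>f"
  shows "(\<forall>\<kappa>. 0 \<le> \<kappa> \<and> ereal \<kappa> < \<kappa>f \<longrightarrow>
           (AE \<omega> in M. (\<lambda>n. ereal (eta reg r p q n) * T r a X E L n (nat \<lfloor>\<kappa> * q n\<rfloor>) \<omega>)
              \<longlonglongrightarrow> ereal (integral {0..\<kappa>} (\<lambda>x. 1 / (beta reg r \<alpha> Red (\<lambda>S. f S x) + beta reg r \<alpha> Black (\<lambda>S. f S x))))))
       \<and> (\<forall>S \<kappa>S. 0 < \<kappa>S \<and>
             ereal \<kappa>S < Lim (at_left \<kappa>f) (\<lambda>x. ereal (f S (real_of_ereal x))) \<longrightarrow>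
           (AE \<omega> in M. (\<lambda>n. ereal (eta reg r p q n) *
                T_color r a X E L S n (nat \<lfloor>\<kappa>S * q n\<rfloor>) \<omega>)
              \<longlonglongrightarrow> ereal (integral {0..the_inv_into {x. 0 \<le> x \<and> ereal x < \<kappa>f} (f S) \<kappa>S}
                   (\<lambda>x. 1 / (beta reg r \<alpha> Red (\<lambda>S. f S x) + beta reg r \<alpha> Black (\<lambda>S. f S x))))))"
proof -
  have \<alpha>: "\<alpha> S > 0" for S using assms(7,8) by (cases S) auto
  interpret prob_space M using assms(9) by (simp add: random_input_def)
  interpret cauchy r p q a \<alpha> reg M X E L f \<kappa>f
  proof
    show "solution (beta reg r \<alpha>) f \<kappa>f" using assms(10) by (simp add: maximal_solution_def)
    show "(\<lambda>n. real (a S n) / q n) \<longlonglongrightarrow> \<alpha> S" for S using assms(6) by blast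
    show "\<alpha> S > 0" for S by (rule \<alpha>)
    show "\<alpha> Black < \<alpha> Red" by (rule assms(7))
  qed (fact assms)+
  show ?thesis
    using T_limit T_color_limit unfolding clock_def rate_sum_def by simp
qed

end
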